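(* Let $m\ge1$, $1\le k\le n-m$, $\operatorname{Re}\lambda>k+m-1$, $a\in\mathcal P_m$, $d=(m+1)/2$, $\delta=(n-k)/2-d$, and $$\lambda_2=\frac{\Gamma_m(n/2)\,\Gamma_m((\lambda-k)/2)}{\Gamma_m(\lambda/2)\,\Gamma_m((n-k)/2)}.$$ Then the following equalities hold, each provided that either of its sides exists in the Lebesgue sense: $$\frac1{\sigma_{n,n-k}}\int_{V_{n,n-k}}d\xi\int_{\mathfrak M_{n-k,m}}\hat f(\xi,t)\,|t't|^{(\lambda-n)/2}dt=\lambda_2\int_{\mathfrak M_{n,m}}f(x)\,|x'x|^{(\lambda-n)/2}dx,$$ $$\frac1{\sigma_{n,n-k}}\int_{V_{n,n-k}}d\xi\int_{\mathfrak M_{n-k,m}}\hat f(\xi,t)\,|t't|^{(\lambda-n)/2}|I_m+t't|^{-\lambda/2}dt=\lambda_2\int_{\mathfrak M_{n,m}}f(x)\,|x'x|^{(\lambda-n)/2}|I_m+x'x|^{(k-\lambda)/2}dx,$$ $$\frac1{\sigma_{n,n-k}}\int_{V_{n,n-k}}d\xi\int_{\mathfrak M_{n-k,m}}\hat f(\xi,t)\,|t't|^{-\delta}(t't-a)_+^{(\lambda-k)/2-d}dt=\lambda_2\int_{\mathfrak M_{n,m}}f(x)\,|x'x|^{d-n/2}(x'x-a)_+^{\lambda/2-d}dx.$$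
   Context: $\mathfrak M_{n,m}$: real $n\times m$ matrices with Lebesgue measure; $x'$ transpose; $|a|$ absolute value of the determinant; $\mathcal P_m$: cone of positive definite symmetric $m\times m$ matrices. For a symmetric $m\times m$ matrix $s$, $s_+^\alpha=|s|^\alpha$ if $s\in\mathcal P_m$ and $0$ otherwise. $\Gamma_m(\alpha)=\pi^{m(m-1)/4}\prod_{j=0}^{m-1}\Gamma(\alpha-j/2)$. $V_{n,n-k}=\{\xi\in\mathfrak M_{n,n-k}:\xi'\xi=I_{n-k}\}$ with $O(n)$-invariant measure $d\xi$ of total mass $\sigma_{n,n-k}$. Radon transform: for $\xi\in V_{n,n-k}$, $t\in\mathfrak M_{n-k,m}$, $\hat f(\xi,t)=\int_{\mathfrak M_{k,m}}f\left(g_\xi\begin{bmatrix}\omega\\ t\end{bmatrix}\right)d\omega$, where $g_\xi\in SO(n)$ is any rotation sending $\begin{bmatrix}0\\ I_{n-k}\end{bmatrix}$ to $\xi$. Existence "in the Lebesgue sense" of a side means that it is finite with the function $f$ and the weight replaced by their absolute values. *)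

theory Defs
  imports "HOL-Analysis.Analysis"
begin

text \<open>
  An \<open>a \<times> b\<close> matrix is an element of \<^typ>\<open>real ^ 'b ^ 'a\<close>.  With \<open>k\<close> the cardinality of \<open>'k\<close>
  and \<open>n - k\<close> that of \<open>'l\<close>, the \<open>n\<close> rows are indexed by the sum type \<^typ>\<open>'k + 'l\<close>, so that
  \<open>[\<omega>; t]\<close> is a matrix over the index type itself.
\<close>

definition stack :: "real ^ 'm ^ 'k \<Rightarrow> real ^ 'm ^ 'l \<Rightarrow> real ^ 'm ^ ('k::finite + 'l::finite)" where
  "stack \<omega> t = (\<chi> i. case i of Inl a \<Rightarrow> \<omega> $ a | Inr b \<Rightarrow> t $ b)"

definition stiefel :: "(real ^ 'l ^ 'n) set" where
  "stiefel = {\<xi>. transpose \<xi> ** \<xi> = mat 1}"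

definition stiefel_measure :: "real \<Rightarrow> (real ^ 'l ^ 'n) measure \<Rightarrow> bool" where
  "stiefel_measure \<sigma> \<mu> \<longleftrightarrow>
     sets \<mu> = sets (restrict_space borel stiefel) \<and>
     (\<forall>g :: real ^ 'n ^ 'n. orthogonal_matrix g \<longrightarrow> distr \<mu> \<mu> (\<lambda>\<xi>. g ** \<xi>) = \<mu>) \<and>
     0 < \<sigma> \<and> emeasure \<mu> stiefel = ennreal \<sigma>"

text \<open>
  Some rotation taking the frame \<open>[0; I]\<close> to \<open>\<xi>\<close>.  For \<open>\<xi>\<close> in the Stiefel manifold one exists, and
  two of them differ by an orthogonal transformation of the variable \<open>\<omega>\<close> below, which
  leaves the transform unchanged.
\<close>

definition frame_rotation :: "real ^ 'l ^ ('k::finite + 'l::finite) \<Rightarrow> real ^ ('k + 'l) ^ ('k + 'l)" where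
  "frame_rotation \<xi> = (SOME g. orthogonal_matrix g \<and> det g = 1 \<and> g ** stack 0 (mat 1) = \<xi>)"

definition radon ::
  "(real ^ 'm ^ ('k::finite + 'l::finite) \<Rightarrow> complex) \<Rightarrow> real ^ 'l ^ ('k::finite + 'l::finite) \<Rightarrow> real ^ 'm ^ 'l \<Rightarrow> complex" where
  "radon f \<xi> t = (LINT \<omega>|lebesgue. f (frame_rotation \<xi> ** stack \<omega> t))"

text \<open>The transform of \<open>\<bar>f\<bar>\<close>, with values in \<open>[0, \<infinity>]\<close>.\<close>

definition radon_abs ::
  "(real ^ 'm ^ ('k::finite + 'l::finite) \<Rightarrow> complex) \<Rightarrow> real ^ 'l ^ ('k::finite + 'l::finite) \<Rightarrow> real ^ 'm ^ 'l \<Rightarrow> ennreal" where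
  "radon_abs f \<xi> t = (\<integral>\<^sup>+\<omega>. ennreal (norm (f (frame_rotation \<xi> ** stack \<omega> t))) \<partial>lebesgue)"

definition radon_side ::
  "real \<Rightarrow> (real ^ 'l ^ ('k::finite + 'l::finite)) measure \<Rightarrow> (real ^ 'm ^ ('k::finite + 'l::finite) \<Rightarrow> complex)
    \<Rightarrow> (real ^ 'm ^ 'l \<Rightarrow> complex) \<Rightarrow> complex" where
  "radon_side \<sigma> \<mu> f w = complex_of_real (1 / \<sigma>) * (LINT \<xi>|\<mu>. LINT t|lebesgue. radon f \<xi> t * w t)"

definition radon_side_exists ::
  "(real ^ 'l ^ ('k::finite + 'l::finite)) measure \<Rightarrow> (real ^ 'm ^ ('k::finite + 'l::finite) \<Rightarrow> complex)
    \<Rightarrow> (real ^ 'm ^ 'l \<Rightarrow> complex) \<Rightarrow> bool" where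
  "radon_side_exists \<mu> f w \<longleftrightarrow>
     (\<integral>\<^sup>+\<xi>. \<integral>\<^sup>+t. radon_abs f \<xi> t * ennreal (norm (w t)) \<partial>lebesgue \<partial>\<mu>) < \<infinity>"

definition function_side ::
  "(real ^ 'm ^ 'n \<Rightarrow> complex) \<Rightarrow> (real ^ 'm ^ 'n \<Rightarrow> complex) \<Rightarrow> complex" where
  "function_side f v = (LINT x|lebesgue. f x * v x)"

definition function_side_exists ::
  "(real ^ 'm ^ 'n \<Rightarrow> complex) \<Rightarrow> (real ^ 'm ^ 'n \<Rightarrow> complex) \<Rightarrow> bool" where
  "function_side_exists f v \<longleftrightarrow>
     (\<integral>\<^sup>+x. ennreal (norm (f x)) * ennreal (norm (v x)) \<partial>lebesgue) < \<infinity>"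

text \<open>
  The equality provided that either side exists.  As a Bochner integral defaults to \<open>0\<close> when it
  does not exist, the existence of both sides is made part of the conclusion.
\<close>

definition radon_identity ::
  "real \<Rightarrow> (real ^ 'l ^ ('k::finite + 'l::finite)) measure \<Rightarrow> (real ^ 'm ^ ('k::finite + 'l::finite) \<Rightarrow> complex)
    \<Rightarrow> (real ^ 'm ^ 'l \<Rightarrow> complex) \<Rightarrow> complex \<Rightarrow> (real ^ 'm ^ ('k::finite + 'l::finite) \<Rightarrow> complex) \<Rightarrow> bool" where
  "radon_identity \<sigma> \<mu> f w c v \<longleftrightarrow>
     (radon_side_exists \<mu> f w \<or> function_side_exists f v \<longrightarrow>
       radon_side_exists \<mu> f w \<and> function_side_exists f v \<and>
       radon_side \<sigma> \<mu> f w = c * function_side f v)"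

definition posdef :: "real ^ 'm ^ 'm \<Rightarrow> bool" where
  "posdef s \<longleftrightarrow> transpose s = s \<and> (\<forall>x. x \<noteq> 0 \<longrightarrow> 0 < x \<bullet> (s *v x))"

text \<open>
  \<open>|s|\<^sup>\<alpha>\<close>; it is \<open>0\<close> at singular \<open>s\<close>, whatever the exponent.  This does not affect the integrals:
  for \<open>x\<close> with at least as many rows as columns, \<open>x'x\<close> is singular only on a null set.
\<close>

definition det_powr :: "real ^ 'm ^ 'm \<Rightarrow> complex \<Rightarrow> complex" where
  "det_powr s \<alpha> = complex_of_real \<bar>det s\<bar> powr \<alpha>"

definition det_powr_plus :: "real ^ 'm ^ 'm \<Rightarrow> complex \<Rightarrow> complex" where
  "det_powr_plus s \<alpha> = (if posdef s then det_powr s \<alpha> else 0)"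

definition multi_Gamma :: "nat \<Rightarrow> complex \<Rightarrow> complex" where
  "multi_Gamma m \<alpha> =
     complex_of_real (pi powr (real m * (real m - 1) / 4)) * (\<Prod>j<m. Gamma (\<alpha> - of_nat j / 2))"

end

theory Submission
  imports Defs "HOL-Probability.Distributions"
begin

text \<open>
  Substituting \<open>x = g ** stack \<omega> t\<close>, with \<open>g\<close> a rotation taking the standard frame to \<open>\<xi>\<close>, turns the
  left-hand side into the integral of \<open>f x\<close> against the mean over \<open>\<xi>\<close> of the weight at
  \<open>transpose \<xi> ** x\<close>, so the law of \<open>gram (transpose \<xi> ** x)\<close> for fixed \<open>x\<close> has to be found.  By
  invariance of the measure it depends on \<open>gram x = gram c\<close> only.  Averaging over \<open>x\<close> in a ball, passing
  from \<open>t\<close> to a square matrix \<open>h\<close> by uniqueness of relatively invariant measures on the cone, and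
  substituting \<open>\<omega> = \<tau> ** h\<close>, one finds the law of \<open>transpose c ** R ** c\<close>, where \<open>R\<close> is the inverse of
  \<open>mat 1 + gram \<tau>\<close> and \<open>\<tau>\<close> has density proportional to \<open>det (mat 1 + gram \<tau>) powr (- n / 2)\<close>.
  In this chart the first two weights are integrated by a linear substitution in \<open>\<tau>\<close>.  For the third
  weight one changes to \<open>\<eta>\<close> with \<open>R = mat 1 - gram \<eta>\<close>, which again needs no nonlinear Jacobian: it
  follows from the translation invariance of \<open>\<bar>det h\<bar>\<close> times Lebesgue measure as a measure of \<open>gram h\<close>,
  proved for one rank-one translation at a time.  The constants are computed row by row in \<open>\<tau>\<close>.
\<close>

subsection \<open>Positive definite matrices\<close>


text \<open>No volume element on the Stiefel manifold or on the cone is written down: matrix changes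
  of variables are linear substitutions combined with Fubini. The image of Lebesgue measure on m x m
  matrices under \<open>gram\<close> is a multiple of |s|^(-1/2) ds on the cone, so |det h| =
  |s|^(1/2) is exactly the weight that makes it translation invariant. The exponent of the third
  weight is made for this: |R|^(-delta) times the density |I + t't|^(-n/2) of t =
  \<open>\<tau>\<close> is |I + t't|^(-(k+m+1)/2), which the change to \<open>\<eta>\<close> turns
  into Lebesgue measure on the ball where \<open>mat 1 - gram \<eta>\<close> is positive definite.
  All three weights thus lead to the integral of |I + t't|^(-lam/2) over k x m matrices, convergent
  for Re lam > k + m - 1. The law of R is normalised by the same integral with n in place of lam,
  and \<open>lam2\<close> is the quotient of the two. The kernel integrals are computed twice, for
  absolute values with Re lam and for complex values: the first computation shows that either side
  exists as soon as the other does, and it licenses Fubini in the second.\<close>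

abbreviation gram :: "real ^ 'm ^ 'n \<Rightarrow> real ^ 'm ^ 'm" where
  "gram x \<equiv> transpose x ** x"

lemma transpose_add: "transpose (A + B) = transpose A + transpose (B :: real ^ 'm ^ 'n)"
  by (simp add: transpose_def vec_eq_iff)

lemma transpose_diff: "transpose (A - B) = transpose A - transpose (B :: real ^ 'm ^ 'n)"
  by (simp add: transpose_def vec_eq_iff)

lemma inner_gram: "z \<bullet> (gram x *v z) = (norm (x *v z))\<^sup>2" for x :: "real ^ 'm ^ 'n"
  by (simp add: dot_lmul_matrix[symmetric] matrix_vector_mul_assoc[symmetric] power2_norm_eq_inner
      vector_transpose_matrix transpose_matrix_vector inner_commute flip: dot_lmul_matrix)

lemma transpose_gram [simp]: "transpose (gram x) = gram x" for x :: "real ^ 'm ^ 'n"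
  by (simp add: matrix_transpose_mul)

lemma posdef_mat_1: "posdef (mat 1 :: real ^ 'm ^ 'm)"
  by (simp add: posdef_def transpose_mat)

text \<open>Since z . (x'x z) = |x z|^2, a Gram matrix is always semidefinite, and it has the same
  kernel as \<open>x\<close>; definiteness is therefore the same as invertibility.\<close>

lemma posdef_gram_iff: "posdef (gram x) \<longleftrightarrow> det (gram x) \<noteq> 0" for x :: "real ^ 'm ^ 'n"
proof -
  have "posdef (gram x) \<longleftrightarrow> (\<forall>z. z \<noteq> 0 \<longrightarrow> x *v z \<noteq> 0)"
    by (simp add: posdef_def inner_gram)
  also have "\<dots> \<longleftrightarrow> (\<forall>z. gram x *v z = 0 \<longrightarrow> z = 0)"
  proof -
    have "gram x *v z = 0 \<longleftrightarrow> x *v z = 0" for z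
    proof
      assume "gram x *v z = 0"
      then have "z \<bullet> (gram x *v z) = 0" by simp
      then show "x *v z = 0" by (simp add: inner_gram)
    qed (simp add: matrix_vector_mul_assoc[symmetric])
    then show ?thesis by auto
  qed
  also have "\<dots> \<longleftrightarrow> det (gram x) \<noteq> 0"
    using matrix_left_invertible_ker[of "gram x"] invertible_left_inverse[of "gram x"]
      invertible_det_nz[of "gram x"] by blast
  finally show ?thesis .
qed

lemma posdef_conj:
  fixes s q :: "real ^ 'm ^ 'm"
  assumes "posdef s" "det q \<noteq> 0"
  shows "posdef (transpose q ** s ** q)"
  unfolding posdef_def
proof (intro conjI allI impI)
  show "transpose (transpose q ** s ** q) = transpose q ** s ** q"
    using assms by (simp add: posdef_def matrix_transpose_mul matrix_mul_assoc)
  fix z :: "real ^ 'm" assume "z \<noteq> 0"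
  then have "q *v z \<noteq> 0"
    using assms(2) by (metis invertible_det_nz invertible_left_inverse matrix_left_invertible_ker)
  have "z \<bullet> (transpose q ** s ** q *v z) = (q *v z) \<bullet> (s *v (q *v z))"
    unfolding matrix_vector_mul_assoc[symmetric]
    using dot_lmul_matrix[of z "transpose q" "s *v (q *v z)"] by (simp add: inner_commute)
  with \<open>q *v z \<noteq> 0\<close> show "0 < z \<bullet> (transpose q ** s ** q *v z)"
    using assms by (simp add: posdef_def)
qed

lemma posdef_conj_iff:
  fixes s q :: "real ^ 'm ^ 'm"
  assumes "det q \<noteq> 0"
  shows "posdef (transpose q ** s ** q) \<longleftrightarrow> posdef s"
proof
  assume *: "posdef (transpose q ** s ** q)"
  obtain p where p: "q ** p = mat 1" "p ** q = mat 1"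
    using assms invertible_def[of q] invertible_det_nz[of q] by blast
  have "transpose p ** (transpose q ** s ** q) ** p = transpose (q ** p) ** s ** (q ** p)"
    by (simp add: matrix_transpose_mul matrix_mul_assoc)
  also have "\<dots> = s" by (simp add: p transpose_mat)
  finally have "transpose p ** (transpose q ** s ** q) ** p = s" .
  moreover have "det p \<noteq> 0" using det_mul[of p q] p(2) by auto
  ultimately show "posdef s" using posdef_conj[OF *, of p] by simp
qed (rule posdef_conj[OF _ assms])

lemma posdef_add_gram:
  assumes "posdef s" shows "posdef (s + gram (x :: real ^ 'm ^ 'n))"
  using assms unfolding posdef_def
  by (auto simp: transpose_add matrix_vector_mult_add_rdistrib inner_add_right inner_gram
      intro!: add_pos_nonneg)

section \<open>Measurability of matrix operations and a Borel choice of Cholesky factors\<close>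

lemma borel_measurable_vec_lambda [measurable (raw)]:
  fixes f :: "'a \<Rightarrow> 'n::finite \<Rightarrow> 'b::euclidean_space"
  assumes [measurable]: "\<And>i. (\<lambda>x. f x i) \<in> borel_measurable M"
  shows "(\<lambda>x. \<chi> i. f x i) \<in> borel_measurable M"
proof (rule borel_measurable_euclidean_space[THEN iffD2], intro ballI)
  fix b :: "'b ^ 'n" assume "b \<in> Basis"
  then obtain i u where b: "b = axis i u" "u \<in> Basis" by (auto simp: Basis_vec_def)
  show "(\<lambda>x. (\<chi> i. f x i) \<bullet> b) \<in> borel_measurable M"
    by (simp add: b inner_axis)
qed

lemma borel_measurable_vec_nth [measurable (raw)]:
  fixes f :: "'a \<Rightarrow> 'b::euclidean_space ^ 'n::finite"
  assumes "f \<in> borel_measurable M"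
  shows "(\<lambda>x. f x $ i) \<in> borel_measurable M"
  using assms by (rule measurable_compose) (intro borel_measurable_continuous_onI continuous_intros)

lemma borel_measurable_matrix_mult [measurable (raw)]:
  fixes f :: "'a \<Rightarrow> real ^ 'b ^ 'c" and g :: "'a \<Rightarrow> real ^ 'd ^ 'b"
  assumes [measurable]: "f \<in> borel_measurable M" "g \<in> borel_measurable M"
  shows "(\<lambda>x. f x ** g x) \<in> borel_measurable M"
  unfolding matrix_matrix_mult_def by measurable

lemma borel_measurable_matrix_vector_mult [measurable (raw)]:
  fixes f :: "'a \<Rightarrow> real ^ 'b ^ 'c" and g :: "'a \<Rightarrow> real ^ 'b"
  assumes [measurable]: "f \<in> borel_measurable M" "g \<in> borel_measurable M"
  shows "(\<lambda>x. f x *v g x) \<in> borel_measurable M"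
  unfolding matrix_vector_mult_def by measurable

lemma borel_measurable_transpose [measurable (raw)]:
  fixes f :: "'a \<Rightarrow> real ^ 'b ^ 'c"
  assumes [measurable]: "f \<in> borel_measurable M"
  shows "(\<lambda>x. transpose (f x)) \<in> borel_measurable M"
  unfolding transpose_def by measurable

lemma borel_measurable_det [measurable (raw)]:
  fixes f :: "'a \<Rightarrow> real ^ 'b ^ 'b"
  assumes [measurable]: "f \<in> borel_measurable M"
  shows "(\<lambda>x. det (f x)) \<in> borel_measurable M"
  unfolding det_def by measurable

text \<open>Gram-Schmidt on the standard basis for the inner product given by \<open>s\<close>. The
  vectors are chosen as functions before \<open>s\<close> is fixed, so that they can be Borel in
  \<open>s\<close>. The support condition replaces linear independence: the earlier vectors vanish
  at the new index \<open>k\<close>, hence the new vector keeps the entry 1 there and is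
  nonzero.\<close>

lemma borel_Gram_Schmidt:
  "\<exists>v :: 'm::finite \<Rightarrow> real ^ 'm ^ 'm \<Rightarrow> real ^ 'm. (\<forall>i. v i \<in> borel_measurable borel) \<and>
     (\<forall>s. posdef s \<longrightarrow> (\<forall>i\<in>S. \<forall>j\<in>S. v i s \<bullet> (s *v v j s) = of_bool (i = j)) \<and>
       (\<forall>i\<in>S. \<forall>j. j \<notin> S \<longrightarrow> v i s $ j = 0))"
proof (induction S rule: finite_induct[OF finite])
  case 1
  show ?case by (intro exI[of _ "\<lambda>_ _. 0"]) auto
next
  case (2 k S)
  then obtain v :: "'m \<Rightarrow> real ^ 'm ^ 'm \<Rightarrow> real ^ 'm"
    where v [measurable]: "\<And>i. v i \<in> borel_measurable borel"
    and orth: "\<And>s i j. posdef s \<Longrightarrow> i \<in> S \<Longrightarrow> j \<in> S \<Longrightarrow> v i s \<bullet> (s *v v j s) = of_bool (i = j)"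
    and supp: "\<And>s i j. posdef s \<Longrightarrow> i \<in> S \<Longrightarrow> j \<notin> S \<Longrightarrow> v i s $ j = 0" by metis
  define w where "w s = axis k 1 - (\<Sum>j\<in>S. (v j s \<bullet> (s *v axis k 1)) *\<^sub>R v j s)" for s
  define u where "u s = (1 / sqrt (w s \<bullet> (s *v w s))) *\<^sub>R w s" for s
  have w [measurable]: "w \<in> borel_measurable borel" unfolding w_def by measurable
  have u [measurable]: "u \<in> borel_measurable borel" unfolding u_def by measurable
  have sym: "a \<bullet> (s *v b) = b \<bullet> (s *v a)" if "posdef s" for a b and s :: "real ^ 'm ^ 'm"
    using that unfolding posdef_def
    by (metis dot_lmul_matrix inner_commute transpose_matrix_vector)
  have wk: "w s $ k = 1" if "posdef s" for s
    using supp[OF that _ \<open>k \<notin> S\<close>] by (simp add: w_def)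
  have w0: "w s \<noteq> 0" if "posdef s" for s
    using wk[OF that] by (metis zero_index zero_neq_one)
  have wpos: "w s \<bullet> (s *v w s) > 0" if "posdef s" for s
    using that w0[OF that] unfolding posdef_def by blast
  have vw: "v i s \<bullet> (s *v w s) = 0" if "posdef s" "i \<in> S" for s i
  proof -
    have "v i s \<bullet> (s *v w s) = v i s \<bullet> (s *v axis k 1)
        - (\<Sum>j\<in>S. (v j s \<bullet> (s *v axis k 1)) * (v i s \<bullet> (s *v v j s)))"
      by (simp add: w_def matrix_vector_mult_diff_distrib inner_diff_right inner_sum_right
          matrix_vector_mult_scaleR linear_sum[OF matrix_vector_mul_linear] o_def)
    also have "(\<Sum>j\<in>S. (v j s \<bullet> (s *v axis k 1)) * (v i s \<bullet> (s *v v j s)))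
        = (\<Sum>j\<in>S. if j = i then v i s \<bullet> (s *v axis k 1) else 0)"
      using that by (intro sum.cong) (auto simp: orth)
    finally show ?thesis using that by (simp add: sum.delta)
  qed
  have vu: "v i s \<bullet> (s *v u s) = 0" if "posdef s" "i \<in> S" for s i
    using vw[OF that] by (simp add: u_def matrix_vector_mult_scaleR)
  have uu: "u s \<bullet> (s *v u s) = 1" if "posdef s" for s
    using wpos[OF that] by (simp add: u_def matrix_vector_mult_scaleR field_simps)
  have us: "u s $ j = 0" if "posdef s" "j \<notin> insert k S" for s j
    using that supp[OF that(1)] by (simp add: u_def w_def axis_def)
  have uv: "u s \<bullet> (s *v v i s) = 0" if "posdef s" "i \<in> S" for s i
    using vu[OF that] sym[OF that(1)] by simp
  show ?case
  proof (intro exI[of _ "v(k := u)"] conjI allI impI ballI)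
    fix i show "(v(k := u)) i \<in> borel_measurable borel" by simp
  next
    fix s :: "real ^ 'm ^ 'm" and i j assume s: "posdef s" and "i \<in> insert k S" "j \<in> insert k S"
    then show "(v(k := u)) i s \<bullet> (s *v (v(k := u)) j s) = of_bool (i = j)"
      using \<open>k \<notin> S\<close> uu[OF s] vu[OF s] uv[OF s] orth[OF s] by (cases "i = k"; cases "j = k") auto
  next
    fix s :: "real ^ 'm ^ 'm" and i j assume "posdef s" "i \<in> insert k S" "j \<notin> insert k S"
    then show "(v(k := u)) i s $ j = 0"
      using us supp by (cases "i = k") auto
  qed
qed

lemma borel_Cholesky:
  obtains q :: "real ^ 'm ^ 'm \<Rightarrow> real ^ 'm ^ 'm"
  where "q \<in> borel_measurable borel" "\<And>s. posdef s \<Longrightarrow> transpose (q s) ** s ** q s = mat 1"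
proof -
  obtain v :: "'m \<Rightarrow> real ^ 'm ^ 'm \<Rightarrow> real ^ 'm"
    where v [measurable]: "\<And>i. v i \<in> borel_measurable borel"
    and orth: "\<And>s i j. posdef s \<Longrightarrow> v i s \<bullet> (s *v v j s) = of_bool (i = j)"
    using borel_Gram_Schmidt[of UNIV] by blast
  define q where "q s = (\<chi> a b. v b s $ a)" for s
  show ?thesis
  proof
    show "q \<in> borel_measurable borel" unfolding q_def by measurable
    fix s :: "real ^ 'm ^ 'm" assume s: "posdef s"
    have "(transpose (q s) ** s ** q s) $ i $ j = v i s \<bullet> (s *v v j s)" for i j
      unfolding matrix_mul_assoc[symmetric]
      by (simp add: matrix_matrix_mult_def transpose_def q_def inner_vec_def matrix_vector_mult_def)
    then show "transpose (q s) ** s ** q s = mat 1"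
      using orth[OF s] by (simp add: vec_eq_iff mat_def)
  qed
qed

lemma posdef_obtain_root:
  assumes "posdef (s :: real ^ 'm ^ 'm)"
  obtains h where "s = gram h" "det h \<noteq> 0"
proof -
  obtain q :: "real ^ 'm ^ 'm" where q: "transpose q ** s ** q = mat 1"
    using borel_Cholesky[where 'm='m] assms by blast
  have "det (transpose q ** s ** q) = 1" by (simp only: q det_I)
  then have "det q * det s * det q = 1"
    by (simp add: det_mul det_transpose)
  then have "det q \<noteq> 0" by auto
  then obtain h where h: "q ** h = mat 1" "h ** q = mat 1"
    using invertible_def[of q] invertible_det_nz[of q] by blast
  have "gram h = transpose h ** (transpose q ** s ** q) ** h" by (simp add: q)
  also have "\<dots> = transpose (q ** h) ** s ** (q ** h)"
    by (simp add: matrix_transpose_mul matrix_mul_assoc)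
  also have "\<dots> = s" by (simp add: h transpose_mat)
  finally have "s = gram h" ..
  moreover have "det h \<noteq> 0" using det_mul[of h q] h(2) by auto
  ultimately show ?thesis using that by blast
qed

lemma posdef_det_pos: "posdef (s :: real ^ 'm ^ 'm) \<Longrightarrow> 0 < det s"
proof -
  assume "posdef s"
  then obtain h where "s = gram h" "det h \<noteq> 0" by (rule posdef_obtain_root)
  then show ?thesis by (simp add: det_mul det_transpose flip: power2_eq_square)
qed


subsection \<open>Orthogonal matrices\<close>

lemma matrix_add_rdistrib: "(A + B) ** C = A ** C + B ** C" for A :: "real ^ 'm ^ 'n"
  by (simp add: matrix_matrix_mult_def vec_eq_iff sum.distrib distrib_right)

lemma matrix_diff_ldistrib: "A ** (B - C) = A ** B - A ** C" for A :: "real ^ 'm ^ 'n"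
  by (simp add: matrix_matrix_mult_def vec_eq_iff sum_subtractf right_diff_distrib)

lemma matrix_diff_rdistrib: "(A - B) ** C = A ** C - B ** C" for A :: "real ^ 'm ^ 'n"
  by (simp add: matrix_matrix_mult_def vec_eq_iff sum_subtractf left_diff_distrib)

text \<open>An orthogonal map takes a multiple of one basis vector to \<open>y\<close>, and
  conjugation by it makes the matrix diagonal. The index \<open>undefined\<close> is an arbitrary
  one.\<close>

lemma det_one_add_outer:
  fixes y :: "real ^ 'm"
  shows "det (mat 1 + (\<chi> i j. y $ i * y $ j)) = 1 + (norm y)\<^sup>2"
proof -
  have "norm y = norm (axis undefined (norm y) :: real ^ 'm)" by (simp add: norm_vec_def axis_def L2_set_def if_distrib[of norm] if_distrib[of "\<lambda>x. x\<^sup>2"] cong: if_cong)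
      (simp add: sum_nonneg)
  then obtain f :: "real ^ 'm \<Rightarrow> real ^ 'm"
    where f: "orthogonal_transformation f" "f (axis undefined (norm y)) = y"
    by (rule orthogonal_transformation_exists[OF sym])
  define g where "g = matrix f"
  have g: "orthogonal_matrix g" "g *v axis undefined (norm y) = y"
    using f matrix_works[of f "axis undefined (norm y)", unfolded linear_matrix_vector_mul_eq]
    unfolding g_def orthogonal_transformation_matrix by auto
  define e :: "real ^ 'm" where "e = axis undefined (norm y)"
  have out: "(\<chi> i j. y $ i * y $ j) = g ** (\<chi> i j. e $ i * e $ j) ** transpose g"
    unfolding g(2)[folded e_def, symmetric]
    by (simp add: vec_eq_iff matrix_matrix_mult_def matrix_vector_mult_def transpose_def
        sum_distrib_left sum_distrib_right mult_ac)
  have "mat 1 + (\<chi> i j. y $ i * y $ j) = g ** (mat 1 + (\<chi> i j. e $ i * e $ j)) ** transpose g"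
    using g(1) by (simp add: out matrix_add_ldistrib matrix_add_rdistrib orthogonal_matrix_def)
  then have "det (mat 1 + (\<chi> i j. y $ i * y $ j))
      = det (mat 1 + (\<chi> i j. e $ i * e $ j)) * (det g * det g)"
    by (simp add: det_mul det_transpose)
  also have "det g * det g = 1"
    using det_orthogonal_matrix[OF g(1)] by auto
  also have "det (mat 1 + (\<chi> i j. e $ i * e $ j)) = (\<Prod>i\<in>UNIV. (mat 1 + (\<chi> i j. e $ i * e $ j)) $ i $ i)"
    by (rule det_diagonal) (auto simp: e_def mat_def axis_def)
  also have "\<dots> = (\<Prod>i\<in>(UNIV :: 'm set). if i = undefined then 1 + (norm y)\<^sup>2 else 1)"
    by (intro prod.cong) (auto simp: e_def mat_def axis_def power2_eq_square)
  also have "\<dots> = 1 + (norm y)\<^sup>2" by (simp add: prod.delta)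
  finally show ?thesis by simp
qed

text \<open>The orthogonal complements of the two column spaces have equal dimension, so an isometry
  between them completes the map that sends the columns of \<open>x\<close> to those of
  \<open>y\<close>.\<close>

lemma orthogonal_matrix_transitive:
  fixes x y :: "real ^ 'm ^ 'n"
  assumes x: "gram x = mat 1" and y: "gram y = mat 1"
  obtains g where "orthogonal_matrix g" "g ** x = y"
proof -
  define K where "K x = {z. transpose x *v z = 0}" for x :: "real ^ 'm ^ 'n"
  have sub: "subspace (K x)" for x
    unfolding K_def by (rule linear_subspace_kernel) (rule matrix_vector_mul_linear)
  have dim: "dim (K x) + CARD('m) = CARD('n)" if "gram x = mat 1" for x :: "real ^ 'm ^ 'n"
  proof -
    have "inj ((*v) x)"
      using that matrix_left_invertible_injective[of x] by blast
    then have "dim (range ((*v) x)) = CARD('m)"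
      using full_rank_injective[of x] rank_dim_range[of x] by simp
    moreover have "K x = {z \<in> UNIV. \<forall>w\<in>range ((*v) x). orthogonal w z}"
    proof -
      have "transpose x *v z = 0 \<longleftrightarrow> (\<forall>w. (x *v w) \<bullet> z = 0)" for z
        using dot_lmul_matrix[of z x] inner_eq_zero_iff[of "z v* x"] by (auto simp: inner_commute)
      then show ?thesis by (auto simp: K_def orthogonal_def)
    qed
    moreover have "subspace (range ((*v) x))"
      by (intro linear_subspace_image matrix_vector_mul_linear subspace_UNIV)
    ultimately show ?thesis
      using dim_subspace_orthogonal_to_vectors[of "range ((*v) x)" UNIV] by simp
  qed
  have "dim (K x) = dim (K y)" using dim[OF x] dim[OF y] by simp
  then obtain f where f: "linear f" "f ` K x = K y" "\<And>z. z \<in> K x \<Longrightarrow> norm (f z) = norm z"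
    by (rule isometries_subspaces[OF sub sub]) auto
  \<comment> \<open>The first term carries the projection of \<open>z\<close> to the column space of
    \<open>x\<close> over to the columns of \<open>y\<close>; the second applies \<open>f\<close> to
    the remaining orthogonal component.\<close>
  define h where "h z = y *v (transpose x *v z) + f (z - x *v (transpose x *v z))" for z
  have lin: "linear h"
    unfolding h_def
    by (rule linearI) (simp_all add: matrix_vector_right_distrib matrix_vector_mult_diff_distrib
        matrix_vector_mult_scaleR linear_add[OF f(1)] linear_diff[OF f(1)] linear_scale[OF f(1)]
        algebra_simps)
  have nrm: "norm (A *v z) = norm z" if "gram A = mat 1" for A :: "real ^ 'm ^ 'n" and z
    using inner_gram[of z A] that by (simp add: power2_norm_eq_inner norm_eq)
  have orth: "(A *v a) \<bullet> b = 0" if "b \<in> K A" for A :: "real ^ 'm ^ 'n" and a b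
    using that dot_lmul_matrix[of b A a] by (simp add: K_def inner_commute)
  have Kx: "z - x *v (transpose x *v z) \<in> K x" for z
    using x by (simp add: K_def matrix_vector_mult_diff_distrib matrix_vector_mul_assoc matrix_mul_assoc
        del: transpose_matrix_vector)
  have "norm (h z) = norm z" for z
  proof -
    let ?a = "transpose x *v z" and ?b = "z - x *v (transpose x *v z)"
    have "f ?b \<in> K y" using f(2) Kx by blast
    then have "(norm (h z))\<^sup>2 = (norm (y *v ?a))\<^sup>2 + (norm (f ?b))\<^sup>2"
      unfolding h_def by (intro norm_add_Pythagorean) (simp add: orthogonal_def orth)
    also have "\<dots> = (norm (x *v ?a))\<^sup>2 + (norm ?b)\<^sup>2"
      using nrm[OF x] nrm[OF y] f(3)[OF Kx] by simp
    also have "\<dots> = (norm (x *v ?a + ?b))\<^sup>2"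
      using norm_add_Pythagorean[of "x *v ?a" ?b] orth[OF Kx] by (simp add: orthogonal_def)
    finally show ?thesis by simp
  qed
  with lin have oh: "orthogonal_transformation h"
    by (simp add: orthogonal_transformation)
  show ?thesis
  proof
    show "orthogonal_matrix (matrix h)"
      using oh by (simp add: orthogonal_transformation_matrix)
    have "(matrix h ** x) *v z = y *v z" for z
    proof -
      have "(matrix h ** x) *v z = matrix h *v (x *v z)"
        by (simp only: matrix_vector_mul_assoc)
      also have "\<dots> = h (x *v z)"
        by (rule matrix_works[OF lin[folded linear_matrix_vector_mul_eq]])
      also have "transpose x *v (x *v z) = z"
        by (simp only: matrix_vector_mul_assoc x matrix_vector_mul_lid)
      then have "h (x *v z) = y *v z"
        by (simp add: h_def linear_0[OF f(1)] del: transpose_matrix_vector)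
      finally show ?thesis .
    qed
    then show "matrix h ** x = y" by (simp add: matrix_eq)
  qed
qed

section \<open>Symmetrisation by an orthogonal factor\<close>

lemma trace_mult: "trace (A ** B) = (\<Sum>i\<in>UNIV. \<Sum>j\<in>UNIV. A $ i $ j * B $ j $ i)"
  by (simp add: trace_def matrix_matrix_mult_def)

text \<open>A perturbation for the variational argument below: with \<open>c = cos u\<close> and
  \<open>s = sin u\<close> the derivative of the trace at \<open>u = 0\<close> is the skew entry
  \<open>r $ j $ i - r $ i $ j\<close>.\<close>

lemma orthogonal_plane_rotation:
  fixes i j :: "'m::finite"
  assumes "i \<noteq> j" "c\<^sup>2 + s\<^sup>2 = 1"
  defines "R \<equiv> (\<chi> a b. if a = i \<and> b = i \<or> a = j \<and> b = j then c else
      if a = i \<and> b = j then s else if a = j \<and> b = i then - s else of_bool (a = b)) :: real ^ 'm ^ 'm"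
  shows "orthogonal_matrix R"
    and "trace (R ** r) = trace r + (c - 1) * (r $ i $ i + r $ j $ j) + s * (r $ j $ i - r $ i $ j)"
proof -
  have split: "sum f UNIV = sum f (UNIV - {i, j}) + (f i + f j)" for f :: "'m \<Rightarrow> real"
    using assms(1) sum.subset_diff[of "{i, j}" UNIV f] by simp
  have row: "(\<Sum>b\<in>UNIV. R $ a $ b * v b) = (if a = i then c * v i + s * v j else
      if a = j then c * v j - s * v i else v a)" for a and v :: "'m \<Rightarrow> real"
  proof -
    have "(\<Sum>b\<in>UNIV - {i, j}. R $ a $ b * v b) = (\<Sum>b\<in>UNIV - {i, j}. if b = a then v a else 0)"
      by (intro sum.cong) (auto simp: R_def)
    then show ?thesis
      unfolding split using assms(1) by (cases "a = i"; cases "a = j") (simp_all add: R_def)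
  qed
  have "R ** transpose R = mat 1"
    unfolding vec_eq_iff
  proof (intro allI)
    fix a b
    have "(R ** transpose R) $ a $ b = (if a = i then c * R $ b $ i + s * R $ b $ j else
      if a = j then c * R $ b $ j - s * R $ b $ i else R $ b $ a)"
      unfolding matrix_matrix_mult_def transpose_def by (simp add: row)
    then show "(R ** transpose R) $ a $ b = mat 1 $ a $ b"
      using assms(1,2) by (cases "a = i"; cases "a = j"; cases "b = i"; cases "b = j")
        (simp_all add: R_def mat_def power2_eq_square mult.commute[of s c])
  qed
  then show "orthogonal_matrix R"
    unfolding orthogonal_matrix_def using matrix_left_right_inverse by blast
  have "trace (R ** r) = (\<Sum>a\<in>UNIV. if a = i then c * r $ i $ i + s * r $ j $ i else
      if a = j then c * r $ j $ j - s * r $ i $ j else r $ a $ a)"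
    unfolding trace_mult row by (intro sum.cong) auto
  also have "\<dots> = (\<Sum>a\<in>UNIV - {i, j}. r $ a $ a) + (c * r $ i $ i + s * r $ j $ i) + (c * r $ j $ j - s * r $ i $ j)"
    unfolding split using assms(1) by simp
  also have "(\<Sum>a\<in>UNIV - {i, j}. r $ a $ a) = trace r - r $ i $ i - r $ j $ j"
    unfolding trace_def split by simp
  finally show "trace (R ** r) = trace r + (c - 1) * (r $ i $ i + r $ j $ j) + s * (r $ j $ i - r $ i $ j)"
    by (simp add: algebra_simps)
qed

lemma compact_orthogonal_matrices: "compact {g :: real ^ 'm ^ 'm. orthogonal_matrix g}"
proof -
  have eq: "{g :: real ^ 'm ^ 'm. orthogonal_matrix g} = (\<lambda>g. gram g) -` {mat 1}"
    by (auto simp: orthogonal_matrix)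
  have "continuous_on UNIV (\<lambda>g :: real ^ 'm ^ 'm. gram g)"
    unfolding matrix_matrix_mult_def transpose_def by (intro continuous_intros)
  then have "closed {g :: real ^ 'm ^ 'm. orthogonal_matrix g}"
    unfolding eq by (rule closed_vimage[OF closed_singleton])
  moreover have "norm g \<le> (\<Sum>i\<in>(UNIV :: 'm set). 1)" if "orthogonal_matrix g" for g :: "real ^ 'm ^ 'm"
  proof -
    have "norm (g $ i) = 1" for i
      using that by (simp add: orthogonal_matrix_orthonormal_rows row_def vec_lambda_eta)
    then show ?thesis
      using L2_set_le_sum[of UNIV "\<lambda>i. norm (g $ i)"] by (simp add: norm_vec_def[of g])
  qed
  then have "bounded {g :: real ^ 'm ^ 'm. orthogonal_matrix g}"
    unfolding bounded_iff by blast
  ultimately show ?thesis by (simp add: compact_eq_bounded_closed)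
qed

text \<open>Maximising the trace of \<open>g ** p\<close> over the orthogonal group: at a maximum no plane rotation
  increases the trace to first order, which says that \<open>g ** p\<close> is symmetric.\<close>

lemma orthogonal_mult_symmetric:
  fixes p :: "real ^ 'm ^ 'm"
  obtains g where "orthogonal_matrix g" "transpose (g ** p) = g ** p"
proof -
  have "continuous_on A (\<lambda>g. trace (g ** p))" for A
    unfolding trace_mult by (intro continuous_intros)
  then have "\<exists>g\<in>{g. orthogonal_matrix g}. \<forall>h\<in>{g. orthogonal_matrix g}. trace (h ** p) \<le> trace (g ** p)"
    using orthogonal_matrix_id by (intro continuous_attains_sup compact_orthogonal_matrices) auto
  then obtain g where g: "orthogonal_matrix g"
    and max: "\<And>h. orthogonal_matrix h \<Longrightarrow> trace (h ** p) \<le> trace (g ** p)"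
    by auto
  define r where "r = g ** p"
  have "r $ i $ j = r $ j $ i" if "i \<noteq> j" for i j
  proof -
    let ?D = "r $ j $ i - r $ i $ j" and ?T = "r $ i $ i + r $ j $ j"
    have le: "(c - 1) * ?T + s * ?D \<le> 0" if cs: "c\<^sup>2 + s\<^sup>2 = 1" for c s
    proof -
      note R = orthogonal_plane_rotation[OF \<open>i \<noteq> j\<close> cs]
      have "trace r + (c - 1) * ?T + s * ?D \<le> trace r"
        using max[OF orthogonal_matrix_mul[OF R(1) g]]
        unfolding R(2)[of r, symmetric] by (simp only: r_def matrix_mul_assoc)
      then show ?thesis by simp
    qed
    have der: "((\<lambda>u. (cos u - 1) * ?T + sin u * ?D) has_real_derivative ?D) (at 0)"
      by (rule derivative_eq_intros refl | simp)+
    have "(cos u - 1) * ?T + sin u * ?D \<le> 0" for u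
      by (rule le) simp
    then have "?D = 0"
      by (intro DERIV_local_max[OF der, of 1]) simp_all
    then show ?thesis by simp
  qed
  then have "r $ i $ j = r $ j $ i" for i j by (cases "i = j") auto
  then have "transpose r = r"
    unfolding vec_eq_iff transpose_def vec_lambda_beta by blast
  then show ?thesis using that g unfolding r_def by blast
qed

text \<open>If g p is symmetric with g orthogonal, then p' = g p g, so p'p = (g p)(g p)' = g (p p')
  g'. This serves to exchange p'p for p p' where a chosen root has its canonical product on the
  wrong side.\<close>

lemma gram_orthogonally_similar:
  fixes p :: "real ^ 'm ^ 'm"
  obtains g where "orthogonal_matrix g" "transpose g ** gram p ** g = p ** transpose p"
proof -
  obtain g where g: "orthogonal_matrix g" and sym: "transpose (g ** p) = g ** p"
    by (rule orthogonal_mult_symmetric)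
  have "transpose g ** (g ** (p ** transpose p)) = p ** transpose p"
    using g by (simp add: matrix_mul_assoc orthogonal_matrix_def)
  moreover have "transpose p ** transpose g = g ** p"
    using sym by (simp add: matrix_transpose_mul)
  then have "transpose p = g ** p ** g"
    using g by (metis matrix_mul_assoc matrix_mul_rid orthogonal_matrix_def)
  have "gram p = g ** p ** g ** p" by (simp add: \<open>transpose p = g ** p ** g\<close>)
  moreover have "g ** p ** g ** p = (g ** p) ** transpose (g ** p)"
    unfolding sym by (simp add: matrix_mul_assoc)
  moreover have "transpose g ** ((g ** p) ** transpose (g ** p)) ** g = p ** transpose p"
    unfolding matrix_transpose_mul using g by (simp add: matrix_mul_assoc[symmetric] orthogonal_matrix_def)
      (simp add: matrix_mul_assoc orthogonal_matrix_def)
  ultimately have "transpose g ** gram p ** g = p ** transpose p" by simp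
  then show ?thesis using that g by blast
qed


subsection \<open>Lebesgue measure under linear substitutions\<close>

lemma nn_integral_lborel_translate:
  fixes a :: "'a::euclidean_space"
  assumes [measurable]: "f \<in> borel_measurable borel"
  shows "(\<integral>\<^sup>+x. f (a + x) \<partial>lborel) = (\<integral>\<^sup>+x. f x \<partial>lborel)"
proof -
  have "(\<integral>\<^sup>+x. f x \<partial>lborel) = (\<integral>\<^sup>+x. f x \<partial>distr lborel borel ((+) a))"
    by (simp add: lborel_distr_plus)
  then show ?thesis by (simp add: nn_integral_distr)
qed

lemma nn_integral_lborel_swap:
  fixes f :: "'a::euclidean_space \<Rightarrow> 'b::euclidean_space \<Rightarrow> ennreal"
  assumes "case_prod f \<in> borel_measurable (borel \<Otimes>\<^sub>M borel)"
  shows "(\<integral>\<^sup>+x. \<integral>\<^sup>+y. f x y \<partial>lborel \<partial>lborel) = (\<integral>\<^sup>+y. \<integral>\<^sup>+x. f x y \<partial>lborel \<partial>lborel)"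
  using assms by (intro lborel_pair.Fubini'[symmetric]) (simp cong: measurable_cong_sets)

lemma borel_measurable_linear:
  fixes T :: "'a::euclidean_space \<Rightarrow> 'b::euclidean_space"
  shows "linear T \<Longrightarrow> T \<in> borel_measurable borel"
  by (intro borel_measurable_continuous_onI linear_continuous_on linear_conv_bounded_linear[THEN iffD1])

text \<open>A test function of integral exactly 1 in every Euclidean space. It inserts a factor 1
  ahead of Fubini, and the scale of a linear map is read off from it.\<close>

definition unit_box :: "'a::euclidean_space \<Rightarrow> ennreal" where
  "unit_box x = indicator (cbox 0 One) x"

lemma unit_box_measurable [measurable]: "unit_box \<in> borel_measurable borel"
  unfolding unit_box_def[abs_def] by measurable

lemma nn_integral_unit_box [simp]: "(\<integral>\<^sup>+x. unit_box x \<partial>lborel) = 1"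
  unfolding unit_box_def by (simp add: emeasure_lborel_cbox_eq)

lemma nn_integral_unit_box_translate [simp]: "(\<integral>\<^sup>+x. unit_box (x - a) \<partial>lborel) = 1"
  using nn_integral_lborel_translate[of unit_box "- a"] by simp

text \<open>Uniqueness of translation invariant measures, obtained by convolving with the unit box.\<close>

lemma nn_integral_lborel_linear_scale:
  fixes T :: "'a::euclidean_space \<Rightarrow> 'b::euclidean_space"
  assumes T: "linear T" and S: "linear S" and TS: "\<And>y. T (S y) = y" and ST: "\<And>x. S (T x) = x"
  obtains c :: real where "0 < c"
    "\<And>f. f \<in> borel_measurable borel \<Longrightarrow> (\<integral>\<^sup>+x. f (T x) \<partial>lborel) = ennreal c * (\<integral>\<^sup>+y. f y \<partial>lborel)"
proof -
  note [measurable] = borel_measurable_linear[OF T] borel_measurable_linear[OF S]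
  define C where "C = (\<integral>\<^sup>+x. unit_box (- T x) \<partial>lborel)"
  have main: "(\<integral>\<^sup>+x. f (T x) \<partial>lborel) = C * (\<integral>\<^sup>+y. f y \<partial>lborel)"
    if [measurable]: "f \<in> borel_measurable borel" for f
  proof -
    have "(\<integral>\<^sup>+x. f (T x) \<partial>lborel) = (\<integral>\<^sup>+x. \<integral>\<^sup>+y. f (T x) * unit_box (y - T x) \<partial>lborel \<partial>lborel)"
      by (simp add: nn_integral_cmult)
    also have "\<dots> = (\<integral>\<^sup>+y. \<integral>\<^sup>+x. f (T x) * unit_box (y - T x) \<partial>lborel \<partial>lborel)"
      by (intro nn_integral_lborel_swap) measurable
    also have "\<dots> = (\<integral>\<^sup>+y. \<integral>\<^sup>+x. f (y + T x) * unit_box (- T x) \<partial>lborel \<partial>lborel)"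
    proof (rule nn_integral_cong)
      fix y
      \<comment> \<open>Translating \<open>x\<close> by \<open>S y\<close> moves \<open>y\<close>
        from the box into the argument of \<open>f\<close>; after the next exchange the two
        integrals separate.\<close>
      have "(\<integral>\<^sup>+x. f (T (S y + x)) * unit_box (y - T (S y + x)) \<partial>lborel)
          = (\<integral>\<^sup>+x. f (T x) * unit_box (y - T x) \<partial>lborel)"
        by (rule nn_integral_lborel_translate[where f="\<lambda>x. f (T x) * unit_box (y - T x)"]) simp
      then show "(\<integral>\<^sup>+x. f (T x) * unit_box (y - T x) \<partial>lborel) = (\<integral>\<^sup>+x. f (y + T x) * unit_box (- T x) \<partial>lborel)"
        by (simp add: linear_add[OF T] TS)
    qed
    also have "\<dots> = (\<integral>\<^sup>+x. \<integral>\<^sup>+y. f (y + T x) * unit_box (- T x) \<partial>lborel \<partial>lborel)"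
      by (intro nn_integral_lborel_swap) measurable
    also have "\<dots> = (\<integral>\<^sup>+x. unit_box (- T x) * (\<integral>\<^sup>+y. f y \<partial>lborel) \<partial>lborel)"
    proof (rule nn_integral_cong)
      fix x
      have "(\<integral>\<^sup>+y. f (y + T x) * unit_box (- T x) \<partial>lborel)
          = (\<integral>\<^sup>+y. f (T x + y) \<partial>lborel) * unit_box (- T x)"
        by (subst nn_integral_multc) (simp_all add: add.commute)
      then show "(\<integral>\<^sup>+y. f (y + T x) * unit_box (- T x) \<partial>lborel) = unit_box (- T x) * (\<integral>\<^sup>+y. f y \<partial>lborel)"
        using nn_integral_lborel_translate[of f "T x"] by (simp add: mult.commute)
    qed
    also have "\<dots> = C * (\<integral>\<^sup>+y. f y \<partial>lborel)"
      by (simp add: nn_integral_multc C_def)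
    finally show ?thesis .
  qed
  \<comment> \<open>The identity for the unit box composed with \<open>S\<close> exhibits an inverse
    of \<open>C\<close>, which is therefore neither 0 nor infinite.\<close>
  have C1: "C * (\<integral>\<^sup>+y. unit_box (S y) \<partial>lborel) = 1"
    using main[of "\<lambda>y. unit_box (S y)"] by (simp add: ST)
  then have "C \<noteq> 0" by auto
  moreover have "C \<noteq> top"
    using C1 by (auto simp: ennreal_top_mult split: if_splits)
  ultimately have "0 < enn2real C" "ennreal (enn2real C) = C"
    by (auto simp: enn2real_positive_iff less_top[symmetric] zero_less_iff_neq_zero)
  with main show ?thesis using that[of "enn2real C"] by simp
qed

section \<open>The modulus of matrix multiplication\<close>

lemma linear_matrix_right: "linear (\<lambda>x :: real ^ 'm ^ 'k. x ** A)" for A :: "real ^ 'l ^ 'm"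
  by (rule linearI) (simp_all add: matrix_add_rdistrib scalar_matrix_assoc)

lemma linear_matrix_left: "linear (\<lambda>x :: real ^ 'm ^ 'k. A ** x)" for A :: "real ^ 'k ^ 'l"
  by (rule linearI) (simp_all add: matrix_add_ldistrib matrix_scalar_ac scalar_matrix_assoc)

lemma matrix_inverse_obtain:
  fixes A :: "real ^ 'm ^ 'm"
  assumes "det A \<noteq> 0"
  obtains B where "A ** B = mat 1" "B ** A = mat 1" "det B = 1 / det A"
proof -
  obtain B where B: "A ** B = mat 1" "B ** A = mat 1"
    using assms invertible_det_nz[of A] unfolding invertible_def by blast
  have "det B * det A = 1" using B(2) det_mul[of B A] by simp
  then have "det B = 1 / det A" using assms by (simp add: field_simps)
  with B that show ?thesis by blast
qed

lemma ennreal_cancel_pos: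
  assumes "0 < (a::real)" "0 < b" "ennreal a * ennreal b = 1"
  shows "a * b = 1"
  using assms by (metis ennreal_1 ennreal_inj ennreal_mult less_imp_le mult_nonneg_nonneg zero_le_one)

lemma right_mult_scale:
  fixes A :: "real ^ 'm ^ 'm"
  assumes "det A \<noteq> 0"
  shows "\<exists>c>0. \<forall>f :: real ^ 'm ^ 'k \<Rightarrow> ennreal. f \<in> borel_measurable borel \<longrightarrow>
      (\<integral>\<^sup>+x. f (x ** A) \<partial>lborel) = ennreal c * (\<integral>\<^sup>+y. f y \<partial>lborel)"
proof -
  obtain B where B: "A ** B = mat 1" "B ** A = mat 1"
    using assms by (rule matrix_inverse_obtain)
  have "y ** B ** A = y" "y ** A ** B = y" for y :: "real ^ 'm ^ 'k"
    using B by (simp_all add: matrix_mul_assoc[symmetric])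
  then show ?thesis
    by (rule nn_integral_lborel_linear_scale[OF linear_matrix_right[of A] linear_matrix_right[of B]]) blast
qed

text \<open>At first only an unspecified multiplicative function of \<open>A\<close>; its values on
  elementary matrices determine it later. The type argument carries the number of rows of
  \<open>x\<close>, which \<open>A\<close> does not show.\<close>

definition right_scale :: "'k::finite itself \<Rightarrow> real ^ 'm ^ 'm \<Rightarrow> real" where
  "right_scale _ A = (SOME c. 0 < c \<and> (\<forall>f :: real ^ 'm ^ 'k \<Rightarrow> ennreal. f \<in> borel_measurable borel \<longrightarrow>
      (\<integral>\<^sup>+x. f (x ** A) \<partial>lborel) = ennreal c * (\<integral>\<^sup>+y. f y \<partial>lborel)))"

lemma right_scale_some:
  fixes A :: "real ^ 'm ^ 'm"
  assumes "det A \<noteq> 0"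
  shows "0 < right_scale TYPE('k::finite) A \<and> (\<forall>f :: real ^ 'm ^ 'k \<Rightarrow> ennreal. f \<in> borel_measurable borel \<longrightarrow>
      (\<integral>\<^sup>+x. f (x ** A) \<partial>lborel) = ennreal (right_scale TYPE('k) A) * (\<integral>\<^sup>+y. f y \<partial>lborel))"
  unfolding right_scale_def by (rule someI_ex) (rule right_mult_scale[where 'k='k, OF assms])

lemma right_scale_pos: "det A \<noteq> 0 \<Longrightarrow> 0 < right_scale TYPE('k::finite) A"
  using right_scale_some[where 'k='k] by blast

lemma right_scale:
  fixes A :: "real ^ 'm ^ 'm" and f :: "real ^ 'm ^ 'k \<Rightarrow> ennreal"
  assumes "det A \<noteq> 0" "f \<in> borel_measurable borel"
  shows "(\<integral>\<^sup>+x. f (x ** A) \<partial>lborel) = ennreal (right_scale TYPE('k) A) * (\<integral>\<^sup>+y. f y \<partial>lborel)"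
  using right_scale_some[where 'k='k, OF assms(1)] assms(2) by blast

lemma right_scaleI:
  fixes A :: "real ^ 'm ^ 'm"
  assumes "det A \<noteq> 0" "0 < c"
    and "(\<integral>\<^sup>+x. unit_box (x ** A :: real ^ 'm ^ 'k) \<partial>lborel) = ennreal c"
  shows "right_scale TYPE('k::finite) A = c"
  using right_scale[where 'k='k, OF assms(1), of unit_box] right_scale_pos[where 'k='k, OF assms(1)]
    assms(2,3) by simp

lemma right_scale_mult:
  fixes A B :: "real ^ 'm ^ 'm"
  assumes A: "det A \<noteq> 0" and B: "det B \<noteq> 0"
  shows "right_scale TYPE('k::finite) (A ** B) = right_scale TYPE('k) A * right_scale TYPE('k) B"
proof (rule right_scaleI)
  have "(\<integral>\<^sup>+x. unit_box (x ** A ** B :: real ^ 'm ^ 'k) \<partial>lborel)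
      = ennreal (right_scale TYPE('k) A) * (\<integral>\<^sup>+x. unit_box (x ** B :: real ^ 'm ^ 'k) \<partial>lborel)"
    by (rule right_scale[OF A]) measurable
  also have "(\<integral>\<^sup>+x. unit_box (x ** B :: real ^ 'm ^ 'k) \<partial>lborel) = ennreal (right_scale TYPE('k) B)"
    by (subst right_scale[OF B]) simp_all
  finally show "(\<integral>\<^sup>+x. unit_box (x ** (A ** B) :: real ^ 'm ^ 'k) \<partial>lborel)
      = ennreal (right_scale TYPE('k) A * right_scale TYPE('k) B)"
    using right_scale_pos[where 'k='k, OF A] by (simp add: matrix_mul_assoc ennreal_mult')
  show "0 < right_scale TYPE('k) A * right_scale TYPE('k) B"
    using right_scale_pos[where 'k='k, OF A] right_scale_pos[where 'k='k, OF B] by simp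
  show "det (A ** B) \<noteq> 0" using A B by (simp add: det_mul)
qed

lemma right_scale_id: "right_scale TYPE('k::finite) (mat 1 :: real ^ 'm ^ 'm) = 1"
  by (rule right_scaleI) auto

lemma Basis_matrix: "(Basis :: (real ^ 'm ^ 'k) set) = (\<lambda>(i, j). axis i (axis j 1)) ` UNIV"
  by (auto simp: Basis_vec_def)

lemma inj_axis_axis: "inj (\<lambda>(i, j). axis i (axis j 1) :: real ^ 'm ^ 'k)"
  by (auto simp: inj_on_def axis_eq_axis)

text \<open>Right multiplication by a diagonal matrix scales each coordinate separately, column
  \<open>j\<close> by \<open>A $ j $ j\<close>, and each column has as many entries as there are
  rows.\<close>

lemma right_scale_diagonal:
  fixes A :: "real ^ 'm ^ 'm"
  assumes A: "det A \<noteq> 0" and diag: "\<And>i j. i \<noteq> j \<Longrightarrow> A $ i $ j = 0"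
  shows "right_scale TYPE('k::finite) A = 1 / \<bar>det A\<bar> ^ CARD('k)"
proof -
  have det: "det A = (\<Prod>i\<in>UNIV. A $ i $ i)" using diag by (rule det_diagonal)
  then have nz: "A $ i $ i \<noteq> 0" for i using A by simp
  define c :: "real ^ 'm ^ 'k \<Rightarrow> real" where "c b = (b ** A) \<bullet> b" for b
  have xA: "(x ** A) $ i $ j = x $ i $ j * A $ j $ j" for x :: "real ^ 'm ^ 'k" and i j
  proof -
    have "(x ** A) $ i $ j = (\<Sum>a\<in>UNIV. if a = j then x $ i $ j * A $ j $ j else 0)"
      unfolding matrix_matrix_mult_def vec_lambda_beta by (intro sum.cong) (auto simp: diag)
    then show ?thesis by (simp add: sum.delta)
  qed
  have c: "c (axis i (axis j 1)) = A $ j $ j" for i j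
    by (simp add: c_def inner_axis xA)
  have cx: "c b * (x \<bullet> b) = (x ** A) \<bullet> b" if "b \<in> Basis" for b and x :: "real ^ 'm ^ 'k"
    using that by (auto simp: Basis_matrix c inner_axis xA)
  have T: "(\<Sum>b\<in>Basis. (c b * (x \<bullet> b)) *\<^sub>R b) = x ** A" for x :: "real ^ 'm ^ 'k"
    using euclidean_representation[of "x ** A"] by (simp add: cx cong: sum.cong)
  have "(\<Prod>b\<in>(Basis :: (real ^ 'm ^ 'k) set). \<bar>c b\<bar>) = (\<Prod>(i :: 'k, j)\<in>UNIV. \<bar>A $ j $ j\<bar>)"
    unfolding Basis_matrix by (subst prod.reindex[OF inj_axis_axis]) (auto simp: c intro!: prod.cong)
  also have "\<dots> = (\<Prod>i\<in>(UNIV :: 'k set). \<Prod>j\<in>UNIV. \<bar>A $ j $ j\<bar>)"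
    unfolding UNIV_Times_UNIV[symmetric] by (rule prod.cartesian_product[symmetric])
  also have "\<dots> = \<bar>det A\<bar> ^ CARD('k)" by (simp add: det abs_prod)
  finally have pr: "(\<Prod>b\<in>(Basis :: (real ^ 'm ^ 'k) set). \<bar>c b\<bar>) = \<bar>det A\<bar> ^ CARD('k)" .
  have cnz: "c b \<noteq> 0" if "b \<in> Basis" for b
    using that nz by (auto simp: Basis_matrix c)
  have eq: "lborel = density (distr lborel borel (\<lambda>x :: real ^ 'm ^ 'k. x ** A)) (\<lambda>_. ennreal (\<bar>det A\<bar> ^ CARD('k)))"
    using lborel_affine_euclidean[of c 0] cnz by (simp add: T pr)
  have "(\<integral>\<^sup>+x. unit_box (x :: real ^ 'm ^ 'k) \<partial>lborel) = (\<integral>\<^sup>+x. unit_box (x :: real ^ 'm ^ 'k)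
      \<partial>density (distr lborel borel (\<lambda>x :: real ^ 'm ^ 'k. x ** A)) (\<lambda>_. ennreal (\<bar>det A\<bar> ^ CARD('k))))"
    by (subst eq) simp
  also have "\<dots> = ennreal (\<bar>det A\<bar> ^ CARD('k)) * (\<integral>\<^sup>+x. unit_box (x ** A :: real ^ 'm ^ 'k) \<partial>lborel)"
    by (simp add: nn_integral_density nn_integral_distr nn_integral_cmult)
  also have "(\<integral>\<^sup>+x. unit_box (x ** A :: real ^ 'm ^ 'k) \<partial>lborel) = ennreal (right_scale TYPE('k) A)"
    using right_scale[where 'k='k, OF A, of unit_box] by simp
  finally have "\<bar>det A\<bar> ^ CARD('k) * right_scale TYPE('k) A = 1"
    using A right_scale_pos[where 'k='k, OF A] by (intro ennreal_cancel_pos) auto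
  then show ?thesis using A by (simp add: field_simps)
qed

lemma square_eq_1_pos: "0 < (a::real) \<Longrightarrow> a * a = 1 \<Longrightarrow> a = 1"
  by (metis less_imp_le mult_1 power2_eq_imp_eq power2_eq_square zero_le_one)

text \<open>A transvection is conjugate to its square and a transposition is an involution, hence both
  have scale \<open>1\<close>.\<close>

lemma right_scale_eq:
  fixes A :: "real ^ 'm ^ 'm"
  assumes "det A \<noteq> 0"
  shows "right_scale TYPE('k::finite) A = 1 / \<bar>det A\<bar> ^ CARD('k)"
  using assms
proof (induction A rule: induct_matrix_elementary_alt)
  case (1 A B)
  then show ?case by (simp add: det_mul right_scale_mult abs_mult power_mult_distrib)
next
  case (2 A i)
  then show ?case by (simp add: det_zero_row)
next
  case (3 A)
  then show ?case by (intro right_scale_diagonal) auto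
next
  case (4 a b)
  let ?S = "(\<chi> i j. mat 1 $ i $ Transposition.transpose a b j) :: real ^ 'm ^ 'm"
  have SS: "?S ** ?S = mat 1"
  proof -
    have "(\<Sum>k\<in>UNIV. ?S $ i $ k * ?S $ k $ j) = (\<Sum>k\<in>UNIV. if k = Transposition.transpose a b j then mat 1 $ i $ j else 0)" for i j
      by (intro sum.cong) (auto simp: mat_def)
    then show ?thesis
      by (simp add: matrix_matrix_mult_def vec_eq_iff sum.delta)
  qed
  have "\<bar>det ?S\<bar> * \<bar>det ?S\<bar> = 1" using det_mul[of ?S ?S] by (simp add: SS flip: abs_mult)
  with 4(2) have "\<bar>det ?S\<bar> = 1" by (metis square_eq_1_pos zero_less_abs_iff)
  moreover have "right_scale TYPE('k) ?S = 1"
    by (rule square_eq_1_pos) (use right_scale_mult[where 'k='k, OF 4(2) 4(2)]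
      right_scale_pos[where 'k='k, OF 4(2)] in \<open>simp_all add: SS right_scale_id\<close>)
  ultimately show ?case by simp
next
  case (5 a b)
  let ?E = "(\<chi> i j. of_bool (i = a \<and> j = b \<or> i = j)) :: real ^ 'm ^ 'm"
  \<comment> \<open>\<open>D\<close> doubles coordinate \<open>a\<close>. Conjugation by it doubles
    the single off-diagonal entry of \<open>?E\<close>, and that is what squaring \<open>?E\<close>
    does.\<close>
  define D :: "real ^ 'm ^ 'm" where "D = (\<chi> i j. if i = j then if i = a then 2 else 1 else 0)"
  have det: "det D = 2"
    by (subst det_diagonal) (auto simp: D_def prod.delta)
  have comm: "D ** ?E = ?E ** ?E ** D"
    unfolding vec_eq_iff
  proof (intro allI)
    fix x y
    have DM: "(D ** M) $ x $ y = (if x = a then 2 else 1) * M $ x $ y" for M x y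
    proof -
      have "(\<Sum>k\<in>UNIV. D $ x $ k * M $ k $ y) = (\<Sum>k\<in>UNIV. if k = x then (if x = a then 2 else 1) * M $ x $ y else 0)"
        by (intro sum.cong) (auto simp: D_def)
      then show ?thesis by (simp add: matrix_matrix_mult_def sum.delta)
    qed
    have MD: "(M ** D) $ x $ y = M $ x $ y * (if y = a then 2 else 1)" for M x y
    proof -
      have "(\<Sum>k\<in>UNIV. M $ x $ k * D $ k $ y) = (\<Sum>k\<in>UNIV. if k = y then M $ x $ y * (if y = a then 2 else 1) else 0)"
        by (intro sum.cong) (auto simp: D_def)
      then show ?thesis by (simp add: matrix_matrix_mult_def sum.delta)
    qed
    have EM: "(?E ** M) $ x $ y = M $ x $ y + (if x = a then M $ b $ y else 0)" for M x y
    proof -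
      have "(\<Sum>k\<in>UNIV. ?E $ x $ k * M $ k $ y) =
          (\<Sum>k\<in>UNIV. (if k = x then M $ x $ y else 0) + (if k = b then if x = a then M $ b $ y else 0 else 0))"
        using \<open>a \<noteq> b\<close> by (intro sum.cong) auto
      then show ?thesis by (simp add: matrix_matrix_mult_def sum.distrib sum.delta)
    qed
    show "(D ** ?E) $ x $ y = (?E ** ?E ** D) $ x $ y"
      unfolding matrix_mul_assoc[symmetric] EM DM MD using \<open>a \<noteq> b\<close>
      by (cases "x = a"; cases "y = a"; cases "y = b"; cases "x = y") simp_all
  qed
  have "2 * det ?E = det ?E * det ?E * 2"
    using arg_cong[OF comm, of det] by (simp only: det_mul det)
  then have "det ?E = 1" using 5(2) by simp
  have "right_scale TYPE('k) D * right_scale TYPE('k) ?E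
      = right_scale TYPE('k) ?E * right_scale TYPE('k) ?E * right_scale TYPE('k) D"
    using arg_cong[OF comm, of "right_scale TYPE('k)"] 5(2) by (simp add: right_scale_mult det det_mul)
  moreover have "0 < right_scale TYPE('k) ?E" "0 < right_scale TYPE('k) D"
    using 5(2) by (auto intro!: right_scale_pos simp: det)
  ultimately have "right_scale TYPE('k) ?E = 1" by simp
  then show ?case unfolding \<open>det ?E = 1\<close> by simp
qed

lemma nn_integral_right_mult:
  fixes A :: "real ^ 'm ^ 'm" and f :: "real ^ 'm ^ 'k \<Rightarrow> ennreal"
  assumes "det A \<noteq> 0" and [measurable]: "f \<in> borel_measurable borel"
  shows "(\<integral>\<^sup>+x. f x \<partial>lborel) = ennreal (\<bar>det A\<bar> ^ CARD('k)) * (\<integral>\<^sup>+x. f (x ** A) \<partial>lborel)"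
  using assms(1) right_scale[where 'k='k, OF assms]
  by (simp add: right_scale_eq mult.assoc[symmetric] flip: ennreal_mult)

lemma linear_transpose: "linear (transpose :: real ^ 'm ^ 'k \<Rightarrow> _)"
  by (rule linearI) (simp_all add: transpose_def vec_eq_iff)

text \<open>On square matrices transposition is an involution, so its scale squares to 1.\<close>

lemma nn_integral_transpose:
  fixes f :: "real ^ 'm ^ 'm \<Rightarrow> ennreal"
  assumes f: "f \<in> borel_measurable borel"
  shows "(\<integral>\<^sup>+x. f (transpose x) \<partial>lborel) = (\<integral>\<^sup>+x. f x \<partial>lborel)"
proof -
  obtain c where c: "0 < c" "\<And>f :: real ^ 'm ^ 'm \<Rightarrow> ennreal. f \<in> borel_measurable borel \<Longrightarrow>
      (\<integral>\<^sup>+x. f (transpose x) \<partial>lborel) = ennreal c * (\<integral>\<^sup>+y. f y \<partial>lborel)"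
    by (rule nn_integral_lborel_linear_scale[OF linear_transpose[where 'm='m and 'k='m]
          linear_transpose[where 'm='m and 'k='m] transpose_transpose transpose_transpose]) blast
  have "ennreal c * ennreal c = 1"
    using c(2)[of "\<lambda>x. unit_box (transpose x)"] c(2)[of unit_box] by simp
  then have "c = 1" using square_eq_1_pos[OF c(1) ennreal_cancel_pos[OF c(1) c(1)]] by blast
  then show ?thesis using c(2)[OF f] by simp
qed

lemma nn_integral_left_mult:
  fixes A :: "real ^ 'm ^ 'm" and f :: "real ^ 'm ^ 'm \<Rightarrow> ennreal"
  assumes A: "det A \<noteq> 0" and [measurable]: "f \<in> borel_measurable borel"
  shows "(\<integral>\<^sup>+x. f x \<partial>lborel) = ennreal (\<bar>det A\<bar> ^ CARD('m)) * (\<integral>\<^sup>+x. f (A ** x) \<partial>lborel)"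
proof -
  have "(\<integral>\<^sup>+x. f x \<partial>lborel) = (\<integral>\<^sup>+x. f (transpose x) \<partial>lborel)"
    by (simp add: nn_integral_transpose)
  also have "\<dots> = ennreal (\<bar>det A\<bar> ^ CARD('m)) * (\<integral>\<^sup>+x. f (transpose (x ** transpose A)) \<partial>lborel)"
    using nn_integral_right_mult[of "transpose A" "\<lambda>x. f (transpose x)"] A by (simp add: det_transpose)
  also have "(\<integral>\<^sup>+x. f (transpose (x ** transpose A)) \<partial>lborel) = (\<integral>\<^sup>+x. f (A ** x) \<partial>lborel)"
    using nn_integral_transpose[of "\<lambda>x. f (A ** x)"] by (simp add: matrix_transpose_mul)
  finally show ?thesis .
qed

lemma norm_matrix_eq_trace: "(norm x)\<^sup>2 = trace (gram x)" for x :: "real ^ 'm ^ 'n"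
  unfolding power2_norm_eq_inner
  by (simp add: inner_vec_def trace_def matrix_matrix_mult_def transpose_def) (rule sum.swap)

lemma gram_mult: "gram (x ** q) = transpose q ** gram x ** q" for x :: "real ^ 'm ^ 'n"
  by (simp add: matrix_transpose_mul matrix_mul_assoc)

lemma gram_orthogonal_left:
  "orthogonal_matrix g \<Longrightarrow> gram (g ** x) = gram x" for x :: "real ^ 'm ^ 'n"
  by (simp add: orthogonal_matrix gram_mult)

lemma nn_integral_cball_pos:
  "0 < (\<integral>\<^sup>+x. indicator (cball 0 1) (x :: 'a::euclidean_space) \<partial>lborel)"
  "(\<integral>\<^sup>+x. indicator (cball 0 1) (x :: 'a::euclidean_space) \<partial>lborel) < \<infinity>"
proof -
  have "emeasure lborel (ball (0::'a) 1) \<noteq> 0"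
    using content_ball_pos[of 1 "0::'a"] by (auto simp: measure_def)
  then have "0 < emeasure lborel (ball (0::'a) 1)" by (simp add: zero_less_iff_neq_zero)
  also have "\<dots> \<le> emeasure lborel (cball (0::'a) 1)" by (intro emeasure_mono) auto
  finally show "0 < (\<integral>\<^sup>+x. indicator (cball 0 1) (x :: 'a::euclidean_space) \<partial>lborel)" by simp
  show "(\<integral>\<^sup>+x. indicator (cball 0 1) (x :: 'a::euclidean_space) \<partial>lborel) < \<infinity>"
    using emeasure_bounded_finite[of "cball (0::'a) 1"] by simp
qed

lemma norm_orthogonal_left: "orthogonal_matrix g \<Longrightarrow> norm (g ** x) = norm x" for x :: "real ^ 'm ^ 'n"
  using norm_matrix_eq_trace[of x] norm_matrix_eq_trace[of "g ** x"] gram_orthogonal_left[of g x]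
  by (metis norm_ge_zero power2_eq_iff_nonneg)

text \<open>The unit ball is invariant and has positive finite measure, which forces the scale to be
  1.\<close>

lemma nn_integral_orthogonal_left:
  fixes g :: "real ^ 'n ^ 'n" and f :: "real ^ 'm ^ 'n \<Rightarrow> ennreal"
  assumes g: "orthogonal_matrix g" and f: "f \<in> borel_measurable borel"
  shows "(\<integral>\<^sup>+x. f (g ** x) \<partial>lborel) = (\<integral>\<^sup>+x. f x \<partial>lborel)"
proof -
  have gg: "g ** (transpose g ** y) = y" "transpose g ** (g ** y) = y" for y :: "real ^ 'm ^ 'n"
    using g by (simp_all add: matrix_mul_assoc orthogonal_matrix_def)
  obtain c where c: "0 < c" "\<And>f :: real ^ 'm ^ 'n \<Rightarrow> ennreal. f \<in> borel_measurable borel \<Longrightarrow>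
      (\<integral>\<^sup>+x. f (g ** x) \<partial>lborel) = ennreal c * (\<integral>\<^sup>+y. f y \<partial>lborel)"
    by (rule nn_integral_lborel_linear_scale[OF linear_matrix_left[of g] linear_matrix_left[of "transpose g"] gg]) blast
  define I where "I = (\<integral>\<^sup>+x. indicator (cball 0 1) (x :: real ^ 'm ^ 'n) \<partial>lborel)"
  have "I = ennreal c * I"
    using c(2)[OF borel_measurable_indicator[of "cball 0 1"]]
    by (simp add: I_def indicator_def norm_orthogonal_left[OF g] del: nn_integral_indicator)
  moreover have "I \<noteq> 0" "I \<noteq> top"
    using nn_integral_cball_pos[where 'a="real ^ 'm ^ 'n"] by (auto simp: I_def)
  ultimately have "ennreal c = 1"
    by (metis ennreal_mult_cancel_left mult.commute mult_1)
  then show ?thesis using c(2)[OF f] by simp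
qed


subsection \<open>Stacked matrices, resampling and null sets\<close>

lemma stack_nth [simp]: "stack \<omega> t $ Inl a = \<omega> $ a" "stack \<omega> t $ Inr b = t $ b"
  by (simp_all add: stack_def)

lemma borel_measurable_stack [measurable (raw)]:
  fixes f :: "'a \<Rightarrow> real ^ 'm ^ 'k" and g :: "'a \<Rightarrow> real ^ 'm ^ 'l"
  assumes [measurable]: "f \<in> borel_measurable M" "g \<in> borel_measurable M"
  shows "(\<lambda>x. stack (f x) (g x)) \<in> borel_measurable M"
  unfolding stack_def
proof (rule borel_measurable_vec_lambda)
  fix i show "(\<lambda>x. case i of Inl a \<Rightarrow> f x $ a | Inr b \<Rightarrow> g x $ b) \<in> borel_measurable M"
    by (cases i) simp_all
qed

lemma sum_UNIV_Plus: "(\<Sum>i\<in>UNIV. f i) = (\<Sum>a\<in>UNIV. f (Inl a)) + (\<Sum>b\<in>UNIV. f (Inr b))"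
  for f :: "'a::finite + 'b::finite \<Rightarrow> 'c::comm_monoid_add"
  by (subst UNIV_Plus_UNIV[symmetric], subst sum.Plus) simp_all

lemma prod_UNIV_Plus: "(\<Prod>i\<in>UNIV. f i) = (\<Prod>a\<in>UNIV. f (Inl a)) * (\<Prod>b\<in>UNIV. f (Inr b))"
  for f :: "'a::finite + 'b::finite \<Rightarrow> 'c::comm_monoid_mult"
  by (subst UNIV_Plus_UNIV[symmetric], subst prod.Plus) simp_all

lemma gram_stack: "gram (stack \<omega> t) = gram \<omega> + gram t"
  for \<omega> :: "real ^ 'm ^ 'k" and t :: "real ^ 'm ^ 'l"
  by (simp add: vec_eq_iff matrix_matrix_mult_def transpose_def sum_UNIV_Plus)

lemma prod_Basis_matrix:
  "(\<Prod>b\<in>Basis. f b) = (\<Prod>i\<in>UNIV. \<Prod>j\<in>UNIV. f (axis i (axis j 1)))"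
  for f :: "real ^ 'm ^ 'k \<Rightarrow> real"
proof -
  have "(\<Prod>b\<in>Basis. f b) = (\<Prod>(i, j)\<in>UNIV \<times> UNIV. f (axis i (axis j 1)))"
    unfolding Basis_matrix by (subst prod.reindex[OF inj_axis_axis]) (simp add: case_prod_unfold)
  then show ?thesis by (simp only: prod.cartesian_product)
qed

lemma axis_axis_Basis [simp]: "axis i (axis j (1::real)) \<in> Basis"
  by (simp add: axis_in_Basis_iff)

lemma box_matrix: "x \<in> box l u \<longleftrightarrow> (\<forall>i j. l $ i $ j < x $ i $ j \<and> x $ i $ j < u $ i $ j)"
  for x :: "real ^ 'm ^ 'k"
  by (auto simp: box_def Basis_matrix inner_axis)

lemma lborel_stack:
  "distr (lborel \<Otimes>\<^sub>M lborel) borel (\<lambda>(\<omega>, t). stack \<omega> t) = (lborel :: (real ^ 'm ^ ('k::finite + 'l::finite)) measure)"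
proof (rule lborel_eqI[symmetric])
  fix l u :: "real ^ 'm ^ ('k + 'l)" assume le: "\<And>b. b \<in> Basis \<Longrightarrow> l \<bullet> b \<le> u \<bullet> b"
  have le': "l $ i $ j \<le> u $ i $ j" for i j
    using le[of "axis i (axis j 1)"] by (simp add: inner_axis)
  define P where "P v = (\<chi> a. v $ Inl a)" for v :: "real ^ 'm ^ ('k + 'l)"
  define Q where "Q v = (\<chi> a. v $ Inr a)" for v :: "real ^ 'm ^ ('k + 'l)"
  have vim: "(\<lambda>(\<omega>, t). stack \<omega> t) -` box l u = box (P l) (P u) \<times> box (Q l) (Q u)"
    by (auto simp: box_matrix P_def Q_def split_sum_all)
  have eP: "emeasure lborel (box (P l) (P u)) = ennreal (\<Prod>a\<in>UNIV. \<Prod>j\<in>UNIV. u $ Inl a $ j - l $ Inl a $ j)"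
  proof (subst emeasure_lborel_box)
    show "P l \<bullet> b \<le> P u \<bullet> b" if "b \<in> Basis" for b
      using that by (auto simp: Basis_matrix inner_axis P_def le')
  qed (simp add: prod_Basis_matrix inner_axis P_def)
  have eQ: "emeasure lborel (box (Q l) (Q u)) = ennreal (\<Prod>a\<in>UNIV. \<Prod>j\<in>UNIV. u $ Inr a $ j - l $ Inr a $ j)"
  proof (subst emeasure_lborel_box)
    show "Q l \<bullet> b \<le> Q u \<bullet> b" if "b \<in> Basis" for b
      using that by (auto simp: Basis_matrix inner_axis Q_def le')
  qed (simp add: prod_Basis_matrix inner_axis Q_def)
  have "emeasure (distr (lborel \<Otimes>\<^sub>M lborel) borel (\<lambda>(\<omega>, t). stack \<omega> t)) (box l u)
      = emeasure (lborel \<Otimes>\<^sub>M lborel) (box (P l) (P u) \<times> box (Q l) (Q u))"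
    by (subst emeasure_distr) (simp_all add: space_pair_measure vim)
  also have "\<dots> = emeasure lborel (box (P l) (P u)) * emeasure lborel (box (Q l) (Q u))"
    by (rule lborel.emeasure_pair_measure_Times) simp_all
  also have "\<dots> = ennreal ((\<Prod>a\<in>UNIV. \<Prod>j\<in>UNIV. u $ Inl a $ j - l $ Inl a $ j)
      * (\<Prod>a\<in>UNIV. \<Prod>j\<in>UNIV. u $ Inr a $ j - l $ Inr a $ j))"
    unfolding eP eQ by (rule ennreal_mult[symmetric]) (auto intro!: prod_nonneg simp: le')
  finally show "emeasure (distr (lborel \<Otimes>\<^sub>M lborel) borel (\<lambda>(\<omega>, t). stack \<omega> t)) (box l u)
      = ennreal (prod ((\<bullet>) (u - l)) Basis)"
    by (simp add: prod_Basis_matrix inner_axis prod_UNIV_Plus)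
qed simp

lemma nn_integral_stack:
  fixes f :: "real ^ 'm ^ ('k::finite + 'l::finite) \<Rightarrow> ennreal"
  assumes [measurable]: "f \<in> borel_measurable borel"
  shows "(\<integral>\<^sup>+x. f x \<partial>lborel) = (\<integral>\<^sup>+\<omega>. \<integral>\<^sup>+t. f (stack \<omega> t) \<partial>lborel \<partial>lborel)"
proof -
  have "(\<integral>\<^sup>+x. f x \<partial>lborel) = (\<integral>\<^sup>+p. f (stack (fst p) (snd p)) \<partial>(lborel \<Otimes>\<^sub>M lborel))"
    by (subst lborel_stack[symmetric], subst nn_integral_distr) (simp_all add: case_prod_unfold)
  also have "\<dots> = (\<integral>\<^sup>+\<omega>. \<integral>\<^sup>+t. f (stack \<omega> t) \<partial>lborel \<partial>lborel)"
    by (subst lborel.nn_integral_fst[symmetric]) simp_all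
  finally show ?thesis .
qed

text \<open>Resampling one component of \<open>x\<close>: this replaces a decomposition of the integral along that
  component.\<close>

lemma nn_integral_resample:
  fixes p :: "'a::euclidean_space \<Rightarrow> 'b::euclidean_space"
  assumes [measurable]: "f \<in> borel_measurable borel" and p: "linear p" and e: "linear e"
    and pe: "\<And>c. p (e c) = c"
  shows "(\<integral>\<^sup>+x. f x \<partial>lborel) = (\<integral>\<^sup>+x. \<integral>\<^sup>+c. f (x - e (p x) + e c) * unit_box (p x) \<partial>lborel \<partial>lborel)"
proof -
  note [measurable] = borel_measurable_linear[OF p] borel_measurable_linear[OF e]
  have "(\<integral>\<^sup>+x. \<integral>\<^sup>+c. f (x - e (p x) + e c) * unit_box (p x) \<partial>lborel \<partial>lborel)
      = (\<integral>\<^sup>+x. \<integral>\<^sup>+c. f (x + e c) * unit_box (p x) \<partial>lborel \<partial>lborel)"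
  proof (rule nn_integral_cong)
    fix x
    show "(\<integral>\<^sup>+c. f (x - e (p x) + e c) * unit_box (p x) \<partial>lborel) = (\<integral>\<^sup>+c. f (x + e c) * unit_box (p x) \<partial>lborel)"
      using nn_integral_lborel_translate[of "\<lambda>c. f (x - e (p x) + e c) * unit_box (p x)" "p x"]
      by (simp add: linear_add[OF e])
  qed
  also have "\<dots> = (\<integral>\<^sup>+c. \<integral>\<^sup>+x. f (x + e c) * unit_box (p x) \<partial>lborel \<partial>lborel)"
    by (intro nn_integral_lborel_swap) measurable
  also have "\<dots> = (\<integral>\<^sup>+c. \<integral>\<^sup>+x. f x * unit_box (p x - c) \<partial>lborel \<partial>lborel)"
  proof (rule nn_integral_cong)
    fix c
    show "(\<integral>\<^sup>+x. f (x + e c) * unit_box (p x) \<partial>lborel) = (\<integral>\<^sup>+x. f x * unit_box (p x - c) \<partial>lborel)"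
      using nn_integral_lborel_translate[of "\<lambda>x. f x * unit_box (p x - c)" "e c"]
      by (simp add: linear_add[OF p] pe add.commute)
  qed
  also have "\<dots> = (\<integral>\<^sup>+x. \<integral>\<^sup>+c. f x * unit_box (p x - c) \<partial>lborel \<partial>lborel)"
    by (intro nn_integral_lborel_swap) measurable
  also have "\<dots> = (\<integral>\<^sup>+x. f x \<partial>lborel)"
  proof (rule nn_integral_cong)
    fix x
    have "(\<integral>\<^sup>+c. unit_box (p x - c) \<partial>lborel) = 1"
    proof -
      have "lborel = distr lborel borel (\<lambda>c :: 'b. p x + (-1) *\<^sub>R c)"
        using lborel_affine[of "-1" "p x"] by (simp add: density_1)
      then have "(\<integral>\<^sup>+c. unit_box c \<partial>(lborel :: 'b measure)) = (\<integral>\<^sup>+c. unit_box c \<partial>distr lborel borel (\<lambda>c :: 'b. p x + (-1) *\<^sub>R c))"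
        by simp
      then show ?thesis by (simp add: nn_integral_distr)
    qed
    then show "(\<integral>\<^sup>+c. f x * unit_box (p x - c) \<partial>lborel) = f x"
      by (simp add: nn_integral_cmult)
  qed
  finally show ?thesis by simp
qed

section \<open>Singular Gram matrices form a null set\<close>

lemma finite_det_zeros:
  fixes A :: "real \<Rightarrow> real ^ 'm ^ 'm" and P :: "'m \<Rightarrow> 'm \<Rightarrow> real poly"
  assumes P: "\<And>u i j. A u $ i $ j = poly (P i j) u" and nz: "det (A u0) \<noteq> 0"
  shows "finite {u. det (A u) = 0}"
proof -
  define D where "D = (\<Sum>p | p permutes (UNIV :: 'm set). of_int (sign p) * (\<Prod>i\<in>UNIV. P i (p i)))"
  have "det (A u) = poly D u" for u
    by (simp add: det_def D_def P poly_sum poly_prod)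
  moreover from this nz have "D \<noteq> 0" by (metis poly_0)
  ultimately show ?thesis using poly_roots_finite[of D] by simp
qed

text \<open>Along the line \<open>x + u J\<close> the determinant is a nonzero polynomial in \<open>u\<close>.\<close>

lemma AE_det_gram_nonzero:
  fixes J :: "real ^ 'm ^ 'n"
  assumes J: "det (gram J) \<noteq> 0"
  shows "AE x :: real ^ 'm ^ 'n in lborel. det (gram x) \<noteq> 0"
proof -
  define N where "N = {x :: real ^ 'm ^ 'n. det (gram x) = 0}"
  have [measurable]: "N \<in> sets borel" unfolding N_def by measurable
  have fin: "finite {u. det (gram (x + u *\<^sub>R J)) = 0}" for x
  proof -
    \<comment> \<open>The polynomial is reversed: with \<open>v = 1 / u\<close> the matrix
      \<open>x + u *\<^sub>R J\<close> is a multiple of \<open>h v\<close>, and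
      \<open>h 0 = J\<close> has a nonsingular Gram matrix. A nonzero \<open>v\<close> off the
      finitely many roots then shows that the original polynomial does not vanish
      identically.\<close>
    define h where "h v = v *\<^sub>R x + J" for v :: real
    have poly: "gram (x + u *\<^sub>R J) $ i $ j = poly (\<Sum>a\<in>UNIV. [:x $ a $ i, J $ a $ i:] * [:x $ a $ j, J $ a $ j:]) u" for u i j
      by (simp add: matrix_matrix_mult_def transpose_def poly_sum algebra_simps)
    have poly': "gram (h v) $ i $ j = poly (\<Sum>a\<in>UNIV. [:J $ a $ i, x $ a $ i:] * [:J $ a $ j, x $ a $ j:]) v" for v i j
      by (simp add: h_def matrix_matrix_mult_def transpose_def poly_sum algebra_simps)
    have "finite {v. det (gram (h v)) = 0}"
      by (rule finite_det_zeros[OF poly', of 0]) (simp add: h_def J)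
    then obtain v where v: "v \<noteq> 0" "det (gram (h v)) \<noteq> 0"
      using infinite_UNIV_char_0[where 'a=real] by (metis (mono_tags, lifting) UNIV_I ex_new_if_finite finite_insert insertCI mem_Collect_eq)
    have "h v = v *\<^sub>R (x + (1 / v) *\<^sub>R J)" using v(1) by (simp add: h_def scaleR_add_right)
    then have "gram (h v) = (v * v) *\<^sub>R gram (x + (1 / v) *\<^sub>R J)"
      by (simp add: vec_eq_iff matrix_matrix_mult_def transpose_def sum_distrib_left mult_ac)
    then have "det (gram (x + (1 / v) *\<^sub>R J)) \<noteq> 0"
    proof -
      have "(v * v) *\<^sub>R gram (x + (1 / v) *\<^sub>R J) = ((v * v) *\<^sub>R mat 1) ** gram (x + (1 / v) *\<^sub>R J)"
        by (simp add: scalar_matrix_assoc[symmetric])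
      then show ?thesis
        using v(2) unfolding \<open>gram (h v) = _\<close> by (auto simp: det_mul)
    qed
    then show ?thesis by (rule finite_det_zeros[OF poly])
  qed
  \<comment> \<open>Averaging the translates of \<open>N\<close> by \<open>u *\<^sub>R J\<close>,
    with \<open>u\<close> in the unit interval, does not change its measure; for fixed
    \<open>x\<close> only finitely many \<open>u\<close> then contribute.\<close>
  have "(\<integral>\<^sup>+x. indicator N x \<partial>lborel) = (\<integral>\<^sup>+u. \<integral>\<^sup>+x. indicator N (u *\<^sub>R J + x) * unit_box (u::real) \<partial>lborel \<partial>lborel)"
  proof -
    have "(\<integral>\<^sup>+x. indicator N (u *\<^sub>R J + x) * unit_box u \<partial>lborel) = (\<integral>\<^sup>+x. indicator N x \<partial>lborel) * unit_box u" for u :: real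
      using nn_integral_lborel_translate[of "indicator N" "u *\<^sub>R J"] by (simp add: nn_integral_multc)
    then show ?thesis by (simp only: nn_integral_cmult unit_box_measurable) (simp add: nn_integral_cmult)
  qed
  also have "\<dots> = (\<integral>\<^sup>+x. \<integral>\<^sup>+u. indicator N (u *\<^sub>R J + x) * unit_box (u::real) \<partial>lborel \<partial>lborel)"
    by (intro nn_integral_lborel_swap) measurable
  also have "\<dots> = integral\<^sup>N lborel (\<lambda>x :: real ^ 'm ^ 'n. 0)"
  proof (rule nn_integral_cong)
    fix x
    have "AE u in lborel. u \<notin> {u. det (gram (x + u *\<^sub>R J)) = 0}"
      by (rule AE_not_in) (rule finite_imp_null_set_lborel[OF fin])
    then have "AE u in lborel. indicator N (u *\<^sub>R J + x) * unit_box u = (0::ennreal)"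
      by eventually_elim (simp add: N_def add.commute)
    then have "(\<integral>\<^sup>+u. indicator N (u *\<^sub>R J + x) * unit_box (u::real) \<partial>lborel) = (\<integral>\<^sup>+u. 0 \<partial>(lborel :: real measure))"
      by (rule nn_integral_cong_AE)
    then show "(\<integral>\<^sup>+u. indicator N (u *\<^sub>R J + x) * unit_box (u::real) \<partial>lborel) = 0" by simp
  qed
  finally have "emeasure lborel N = 0" by simp
  then show ?thesis
    by (intro AE_I[of _ _ N]) (auto simp: N_def)
qed

lemma AE_det_nonzero: "AE h in lborel. det (h :: real ^ 'm ^ 'm) \<noteq> 0"
proof -
  have "AE h in lborel. det (gram (h :: real ^ 'm ^ 'm)) \<noteq> 0"
    by (rule AE_det_gram_nonzero[of "mat 1"]) simp
  then show ?thesis by eventually_elim (simp add: det_mul)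
qed

lemma nn_integral_matrix_pos:
  fixes f :: "real ^ 'm ^ 'm \<Rightarrow> ennreal"
  assumes [measurable]: "f \<in> borel_measurable borel" and pos: "\<And>h. det h \<noteq> 0 \<Longrightarrow> norm h \<le> 1 \<Longrightarrow> 0 < f h"
  shows "0 < (\<integral>\<^sup>+h. f h \<partial>lborel)"
proof (rule ccontr)
  assume "\<not> ?thesis"
  then have "AE h in lborel. f h = 0" by (simp add: nn_integral_0_iff_AE)
  with AE_det_nonzero have "AE h :: real ^ 'm ^ 'm in lborel. indicator (cball 0 1) h = (0::ennreal)"
    by eventually_elim (use pos in \<open>force simp: indicator_def\<close>)
  then have "(\<integral>\<^sup>+h. indicator (cball 0 1) (h :: real ^ 'm ^ 'm) \<partial>lborel) = 0"
    by (subst nn_integral_0_iff_AE) (auto intro!: borel_measurable_indicator)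
  then show False using nn_integral_cball_pos(1)[where 'a="real ^ 'm ^ 'm"] by simp
qed


subsection \<open>Polar decomposition\<close>

definition unit_ball :: "'a::euclidean_space \<Rightarrow> ennreal" where
  "unit_ball x = (if norm x \<le> 1 then 1 else 0)"

lemma unit_ball_measurable [measurable]: "unit_ball \<in> borel_measurable borel"
  unfolding unit_ball_def[abs_def] by measurable

lemma nn_integral_unit_ball:
  "0 < (\<integral>\<^sup>+x. unit_ball (x :: 'a::euclidean_space) \<partial>lborel)"
  "(\<integral>\<^sup>+x. unit_ball (x :: 'a::euclidean_space) \<partial>lborel) < \<infinity>"
proof -
  have "unit_ball = (indicator (cball 0 1) :: 'a \<Rightarrow> ennreal)"
    by (auto simp: unit_ball_def indicator_def)
  then show "0 < (\<integral>\<^sup>+x. unit_ball (x :: 'a::euclidean_space) \<partial>lborel)"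
    "(\<integral>\<^sup>+x. unit_ball (x :: 'a::euclidean_space) \<partial>lborel) < \<infinity>"
    using nn_integral_cball_pos[where 'a='a] by simp_all
qed

text \<open>A Borel choice of an inverse square root, unspecified outside the cone.\<close>

definition inv_root :: "real ^ 'm ^ 'm \<Rightarrow> real ^ 'm ^ 'm" where
  "inv_root = (SOME q. q \<in> borel_measurable borel \<and> (\<forall>s. posdef s \<longrightarrow> transpose (q s) ** s ** q s = mat 1))"

lemma inv_root_some:
  "(inv_root :: real ^ 'm ^ 'm \<Rightarrow> _) \<in> borel_measurable borel \<and>
    (\<forall>s :: real ^ 'm ^ 'm. posdef s \<longrightarrow> transpose (inv_root s) ** s ** inv_root s = mat 1)"
proof -
  obtain q :: "real ^ 'm ^ 'm \<Rightarrow> real ^ 'm ^ 'm" where "q \<in> borel_measurable borel"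
    "\<And>s. posdef s \<Longrightarrow> transpose (q s) ** s ** q s = mat 1"
    by (rule borel_Cholesky[where 'm='m]) (erule that, simp)
  then have "\<exists>q :: real ^ 'm ^ 'm \<Rightarrow> real ^ 'm ^ 'm. q \<in> borel_measurable borel \<and>
      (\<forall>s :: real ^ 'm ^ 'm. posdef s \<longrightarrow> transpose (q s) ** s ** q s = mat 1)"
    by (intro exI[of _ q]) simp
  then show ?thesis unfolding inv_root_def by (rule someI_ex)
qed

lemma inv_root_measurable [measurable]: "inv_root \<in> borel_measurable borel"
  using inv_root_some by blast

lemma inv_root: "posdef s \<Longrightarrow> transpose (inv_root s) ** s ** inv_root s = mat 1"
  using inv_root_some by blast

lemma inv_root_inverse:
  fixes s :: "real ^ 'm ^ 'm"
  assumes "posdef s"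
  shows "inv_root s ** transpose (inv_root s) ** s = mat 1" "s ** (inv_root s ** transpose (inv_root s)) = mat 1"
proof -
  have "inv_root s ** (transpose (inv_root s) ** s) = mat 1"
    using inv_root[OF assms] matrix_left_right_inverse[of "transpose (inv_root s) ** s" "inv_root s"] by simp
  then show *: "inv_root s ** transpose (inv_root s) ** s = mat 1" by (simp add: matrix_mul_assoc)
  then show "s ** (inv_root s ** transpose (inv_root s)) = mat 1"
    by (simp add: matrix_left_right_inverse)
qed

text \<open>The root itself is an arbitrary choice, but its product with its own transpose is the
  inverse of \<open>s\<close>. Canonical statements about the root go through this product.\<close>

lemma inv_root_unique:
  fixes s B :: "real ^ 'm ^ 'm"
  assumes "posdef s" "s ** B = mat 1"
  shows "inv_root s ** transpose (inv_root s) = B"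
proof -
  have "inv_root s ** transpose (inv_root s) = inv_root s ** transpose (inv_root s) ** (s ** B)"
    by (simp add: assms(2))
  also have "\<dots> = B" unfolding matrix_mul_assoc inv_root_inverse(1)[OF assms(1)] by simp
  finally show ?thesis .
qed

lemma det_inv_root:
  fixes s :: "real ^ 'm ^ 'm"
  assumes "posdef s"
  shows "det (inv_root s) \<noteq> 0" "(det (inv_root s))\<^sup>2 = 1 / det s"
proof -
  have "det (transpose (inv_root s) ** s ** inv_root s) = 1" by (simp only: inv_root[OF assms] det_I)
  then have *: "(det (inv_root s))\<^sup>2 * det s = 1" by (simp add: det_mul det_transpose power2_eq_square mult_ac)
  then show "det (inv_root s) \<noteq> 0" "(det (inv_root s))\<^sup>2 = 1 / det s"
    using posdef_det_pos[OF assms] by (auto simp: field_simps)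
qed

lemma norm_transpose [simp]: "norm (transpose x) = norm x" for x :: "real ^ 'm ^ 'n"
proof -
  have "(norm (transpose x))\<^sup>2 = (norm x)\<^sup>2"
    unfolding power2_norm_eq_inner by (simp add: inner_vec_def transpose_def) (rule sum.swap)
  then show ?thesis by simp
qed

lemma norm_eq_gram_transpose: "x ** transpose x = y ** transpose y \<Longrightarrow> norm x = norm y"
  for x :: "real ^ 'm ^ 'k" and y :: "real ^ 'n ^ 'k"
  using norm_matrix_eq_trace[of "transpose x"] norm_matrix_eq_trace[of "transpose y"]
  by (metis norm_ge_zero norm_transpose power2_eq_iff_nonneg transpose_transpose)

text \<open>The choice of a root need not be equivariant, but \<open>h ** inv_root s'\<close> and
  \<open>inv_root s\<close> have the same product with their transposes, namely the inverse of
  \<open>s\<close>. This product determines the norm and the absolute determinant, which is all that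
  an average over a ball sees.\<close>

lemma inv_root_conj:
  fixes h s :: "real ^ 'm ^ 'm"
  assumes s: "posdef s" and h: "det h \<noteq> 0"
  defines "s' \<equiv> transpose h ** s ** h"
  shows "norm (h ** inv_root s') = norm (inv_root s)" "\<bar>det (inv_root s')\<bar> = \<bar>det (inv_root s)\<bar> / \<bar>det h\<bar>"
proof -
  have s': "posdef s'" unfolding s'_def by (rule posdef_conj[OF s h])
  obtain g where g: "h ** g = mat 1" "g ** h = mat 1" using h by (rule matrix_inverse_obtain)
  have gh: "transpose h ** transpose g = mat 1"
    using g by (metis matrix_transpose_mul transpose_mat)
  have "s' ** (g ** (inv_root s ** transpose (inv_root s)) ** transpose g)
      = transpose h ** (s ** (h ** g) ** (inv_root s ** transpose (inv_root s))) ** transpose g"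
    by (simp add: s'_def matrix_mul_assoc)
  also have "\<dots> = mat 1" by (simp add: g gh inv_root_inverse(2)[OF s])
  finally have eq: "inv_root s' ** transpose (inv_root s') = g ** (inv_root s ** transpose (inv_root s)) ** transpose g"
    by (rule inv_root_unique[OF s'])
  have "(h ** inv_root s') ** transpose (h ** inv_root s') = h ** (inv_root s' ** transpose (inv_root s')) ** transpose h"
    by (simp add: matrix_transpose_mul matrix_mul_assoc)
  also have "\<dots> = (h ** g) ** (inv_root s ** transpose (inv_root s)) ** transpose (h ** g)"
    unfolding eq by (simp add: matrix_transpose_mul matrix_mul_assoc)
  finally show "norm (h ** inv_root s') = norm (inv_root s)"
    by (intro norm_eq_gram_transpose) (simp add: g transpose_mat)
  have "(det (inv_root s'))\<^sup>2 = (det (inv_root s) / det h)\<^sup>2"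
    using posdef_det_pos[OF s] h by (simp add: det_inv_root(2)[OF s] det_inv_root(2)[OF s'] power_divide)
      (simp add: s'_def det_mul det_transpose power2_eq_square mult_ac)
  then have "sqrt ((det (inv_root s'))\<^sup>2) = sqrt ((det (inv_root s) / det h)\<^sup>2)" by simp
  then show "\<bar>det (inv_root s')\<bar> = \<bar>det (inv_root s)\<bar> / \<bar>det h\<bar>"
    by (simp only: real_sqrt_abs abs_divide)
qed

lemma card_le_obtain_isometry:
  assumes "CARD('m::finite) \<le> CARD('n::finite)"
  obtains J :: "real ^ 'm ^ 'n" where "gram J = mat 1"
proof -
  obtain e :: "'m \<Rightarrow> 'n" where e: "inj e"
    using assms card_le_inj[of "UNIV :: 'm set" "UNIV :: 'n set"] by auto
  define J :: "real ^ 'm ^ 'n" where "J = (\<chi> a j. of_bool (a = e j))"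
  have "gram J $ i $ j = mat 1 $ i $ j" for i j
  proof -
    have "gram J $ i $ j = (\<Sum>a\<in>UNIV. if a = e i then of_bool (e i = e j) else 0)"
      unfolding matrix_matrix_mult_def transpose_def by (auto simp: J_def intro!: sum.cong)
    then show ?thesis using e by (simp add: mat_def sum.delta inj_eq)
  qed
  then have "gram J = mat 1" by (simp add: vec_eq_iff)
  then show ?thesis by (rule that)
qed

lemma AE_posdef_gram:
  assumes "CARD('m::finite) \<le> CARD('n::finite)"
  shows "AE x :: real ^ 'm ^ 'n in lborel. posdef (gram x)"
proof -
  obtain J :: "real ^ 'm ^ 'n" where "gram J = mat 1"
    using assms by (rule card_le_obtain_isometry)
  then have "AE x :: real ^ 'm ^ 'n in lborel. det (gram x) \<noteq> 0"
    by (intro AE_det_gram_nonzero[of J]) simp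
  then show ?thesis by (simp add: posdef_gram_iff)
qed

text \<open>Both sides are, as measures of \<open>gram t\<close>, relatively invariant under \<open>s \<mapsto> h ** s ** transpose h\<close>.
  Integrate \<open>G (h ** gram t ** transpose h)\<close> over \<open>t\<close> and over \<open>h\<close> in a ball in both orders.\<close>

lemma nn_integral_polar:
  assumes ml: "CARD('m::finite) \<le> CARD('l::finite)"
  obtains C :: ennreal where
    "\<And>G :: real ^ 'm ^ 'm \<Rightarrow> ennreal. G \<in> borel_measurable borel \<Longrightarrow>
      (\<integral>\<^sup>+t. G (gram (t :: real ^ 'm ^ 'l)) \<partial>lborel) =
      C * (\<integral>\<^sup>+h. G (gram h) * ennreal (\<bar>det h\<bar> ^ (CARD('l) - CARD('m))) \<partial>lborel)"
proof -
  define m where "m = CARD('m)"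
  define l where "l = CARD('l)"
  define c where "c = (\<integral>\<^sup>+h. unit_ball (h :: real ^ 'm ^ 'm) \<partial>lborel)"
  \<comment> \<open>The exponent collects \<open>m\<close> from a substitution in the m x m matrix
    \<open>h\<close> and \<open>l\<close> from the weight
    \<open>\<bar>det h\<bar> ^ l\<close>.\<close>
  define w where "w q = ennreal (\<bar>det q\<bar> ^ (m + l))" for q :: "real ^ 'm ^ 'm"
  have [measurable]: "w \<in> borel_measurable borel" unfolding w_def by measurable
  define c' where "c' = (\<integral>\<^sup>+t. w (inv_root (gram (t :: real ^ 'm ^ 'l))) * unit_ball (inv_root (gram (t :: real ^ 'm ^ 'l))) \<partial>lborel)"
  have main: "c * (\<integral>\<^sup>+t. G (gram (t :: real ^ 'm ^ 'l)) \<partial>lborel)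
      = c' * (\<integral>\<^sup>+h. G (gram h) * ennreal (\<bar>det h\<bar> ^ (l - m)) \<partial>lborel)"
    if [measurable]: "G \<in> borel_measurable borel" for G :: "real ^ 'm ^ 'm \<Rightarrow> ennreal"
  proof -
    define I where "I = (\<integral>\<^sup>+h. \<integral>\<^sup>+t.
        G (h ** gram (t :: real ^ 'm ^ 'l) ** transpose h) * (ennreal (\<bar>det h\<bar> ^ l) * unit_ball h) \<partial>lborel \<partial>lborel)"
    have "I = (\<integral>\<^sup>+h. unit_ball (h :: real ^ 'm ^ 'm) * (\<integral>\<^sup>+t. G (gram (t :: real ^ 'm ^ 'l)) \<partial>lborel) \<partial>lborel)"
      unfolding I_def
    proof (rule nn_integral_cong_AE)
      show "AE h :: real ^ 'm ^ 'm in lborel. (\<integral>\<^sup>+t.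
        G (h ** gram (t :: real ^ 'm ^ 'l) ** transpose h) * (ennreal (\<bar>det h\<bar> ^ l) * unit_ball h) \<partial>lborel)
        = unit_ball h * (\<integral>\<^sup>+t. G (gram (t :: real ^ 'm ^ 'l)) \<partial>lborel)"
        using AE_det_nonzero
      proof eventually_elim
        case (elim h)
        have "(\<integral>\<^sup>+t. G (gram (t :: real ^ 'm ^ 'l)) \<partial>lborel)
            = ennreal (\<bar>det h\<bar> ^ l) * (\<integral>\<^sup>+t. G (h ** gram (t :: real ^ 'm ^ 'l) ** transpose h) \<partial>lborel)"
          using nn_integral_right_mult[of "transpose h" "\<lambda>t :: real ^ 'm ^ 'l. G (gram (t :: real ^ 'm ^ 'l))"] elim
          by (simp add: det_transpose gram_mult l_def)
        then show ?case by (subst nn_integral_multc) (simp_all add: mult_ac)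
      qed
    qed
    then have I1: "I = c * (\<integral>\<^sup>+t. G (gram (t :: real ^ 'm ^ 'l)) \<partial>lborel)"
      unfolding c_def by (subst (asm) nn_integral_multc) simp_all
    have "I = (\<integral>\<^sup>+t. \<integral>\<^sup>+h.
        G (h ** gram (t :: real ^ 'm ^ 'l) ** transpose h) * (ennreal (\<bar>det h\<bar> ^ l) * unit_ball h) \<partial>lborel \<partial>lborel)"
      unfolding I_def by (intro nn_integral_lborel_swap) measurable
    also have "\<dots> = (\<integral>\<^sup>+t. \<integral>\<^sup>+h.
        G (h ** transpose h) * ennreal (\<bar>det h\<bar> ^ l) * (w (inv_root (gram (t :: real ^ 'm ^ 'l))) * unit_ball (h ** inv_root (gram (t :: real ^ 'm ^ 'l)))) \<partial>lborel \<partial>lborel)"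
    proof (rule nn_integral_cong_AE)
      show "AE t :: real ^ 'm ^ 'l in lborel. (\<integral>\<^sup>+h.
        G (h ** gram (t :: real ^ 'm ^ 'l) ** transpose h) * (ennreal (\<bar>det h\<bar> ^ l) * unit_ball h) \<partial>lborel) =
        (\<integral>\<^sup>+h.
        G (h ** transpose h) * ennreal (\<bar>det h\<bar> ^ l) * (w (inv_root (gram (t :: real ^ 'm ^ 'l))) * unit_ball (h ** inv_root (gram (t :: real ^ 'm ^ 'l)))) \<partial>lborel)"
        using AE_posdef_gram[OF ml]
      proof eventually_elim
        case (elim t)
        define q where "q = inv_root (gram (t :: real ^ 'm ^ 'l))"
        have q: "transpose q ** gram (t :: real ^ 'm ^ 'l) ** q = mat 1" "det q \<noteq> 0"
          using inv_root[OF elim] det_inv_root(1)[OF elim] by (simp_all add: q_def)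
        \<comment> \<open>The transpose of \<open>q\<close> already normalises
          \<open>gram t\<close>, but its product with its own transpose is \<open>gram q\<close>,
          which depends on the choice of root. The rotation \<open>g\<close> replaces it by
          \<open>q ** transpose q\<close>, the inverse of \<open>gram t\<close>, so that the ball
          condition can be written with \<open>h ** q\<close> and \<open>inv_root_conj\<close>
          applies later.\<close>
        obtain g where g: "orthogonal_matrix g" "transpose g ** gram q ** g = q ** transpose q"
          by (rule gram_orthogonally_similar)
        define A where "A = transpose g ** transpose q"
        have dg: "\<bar>det g\<bar> = 1" using det_orthogonal_matrix[OF g(1)] by auto
        have dA: "\<bar>det A\<bar> = \<bar>det q\<bar>" by (simp add: A_def det_mul det_transpose abs_mult dg)
        have "A ** gram (t :: real ^ 'm ^ 'l) ** transpose A = transpose g ** (transpose q ** gram (t :: real ^ 'm ^ 'l) ** q) ** g"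
          by (simp add: A_def matrix_transpose_mul matrix_mul_assoc)
        then have A1: "A ** gram (t :: real ^ 'm ^ 'l) ** transpose A = mat 1"
          using g(1) by (simp add: q(1) orthogonal_matrix)
        have A2: "A ** transpose A = q ** transpose q"
          unfolding g(2)[symmetric] by (simp add: A_def matrix_transpose_mul matrix_mul_assoc)
        have nA: "norm (h ** A) = norm (h ** q)" for h :: "real ^ 'm ^ 'm"
        proof (rule norm_eq_gram_transpose)
          show "(h ** A) ** transpose (h ** A) = (h ** q) ** transpose (h ** q)"
            using arg_cong[OF A2, of "\<lambda>B. h ** B ** transpose h"]
            by (simp add: matrix_transpose_mul matrix_mul_assoc)
        qed
        have hA: "(h ** A) ** gram (t :: real ^ 'm ^ 'l) ** transpose (h ** A) = h ** transpose h" for h :: "real ^ 'm ^ 'm"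
          using arg_cong[OF A1, of "\<lambda>B. h ** B ** transpose h"]
          by (simp add: matrix_transpose_mul matrix_mul_assoc)
        have "(\<integral>\<^sup>+h.
          G (h ** gram (t :: real ^ 'm ^ 'l) ** transpose h) * (ennreal (\<bar>det h\<bar> ^ l) * unit_ball h) \<partial>lborel)
          = ennreal (\<bar>det A\<bar> ^ m) * (\<integral>\<^sup>+h. G ((h ** A) ** gram (t :: real ^ 'm ^ 'l) ** transpose (h ** A))
            * (ennreal (\<bar>det (h ** A)\<bar> ^ l) * unit_ball (h ** A)) \<partial>lborel)"
          using q(2) dA unfolding m_def by (intro nn_integral_right_mult) (auto, measurable)
        also have "\<dots> = (\<integral>\<^sup>+h. G (h ** transpose h) * ennreal (\<bar>det h\<bar> ^ l)
            * (w q * unit_ball (h ** q)) \<partial>lborel)"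
          unfolding hA
          by (subst nn_integral_cmult[symmetric]) (simp, simp add: det_mul dA abs_mult w_def power_mult_distrib
              power_add ennreal_mult' nA unit_ball_def mult_ac)
        finally show ?case by (simp add: q_def)
      qed
    qed
    also have "\<dots> = (\<integral>\<^sup>+h. \<integral>\<^sup>+t.
        G (h ** transpose h) * ennreal (\<bar>det h\<bar> ^ l) * (w (inv_root (gram (t :: real ^ 'm ^ 'l))) * unit_ball (h ** inv_root (gram (t :: real ^ 'm ^ 'l)))) \<partial>lborel \<partial>lborel)"
      by (intro nn_integral_lborel_swap) measurable
    also have "\<dots> = (\<integral>\<^sup>+h. G (h ** transpose h) * ennreal (\<bar>det h\<bar> ^ (l - m)) * c' \<partial>lborel)"
    proof (rule nn_integral_cong_AE)
      show "AE h :: real ^ 'm ^ 'm in lborel. (\<integral>\<^sup>+t.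
        G (h ** transpose h) * ennreal (\<bar>det h\<bar> ^ l) * (w (inv_root (gram (t :: real ^ 'm ^ 'l))) * unit_ball (h ** inv_root (gram (t :: real ^ 'm ^ 'l)))) \<partial>lborel)
        = G (h ** transpose h) * ennreal (\<bar>det h\<bar> ^ (l - m)) * c'"
        using AE_det_nonzero
      proof eventually_elim
        case (elim h)
        have "(\<integral>\<^sup>+t. w (inv_root (gram (t :: real ^ 'm ^ 'l))) * unit_ball (h ** inv_root (gram (t :: real ^ 'm ^ 'l))) \<partial>lborel)
          = ennreal (\<bar>det h\<bar> ^ l) * (\<integral>\<^sup>+t. w (inv_root (gram ((t :: real ^ 'm ^ 'l) ** h)))
              * unit_ball (h ** inv_root (gram ((t :: real ^ 'm ^ 'l) ** h))) \<partial>lborel)"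
          using elim unfolding l_def by (intro nn_integral_right_mult) (auto, measurable)
        also have "(\<integral>\<^sup>+t. w (inv_root (gram ((t :: real ^ 'm ^ 'l) ** h)))
              * unit_ball (h ** inv_root (gram ((t :: real ^ 'm ^ 'l) ** h))) \<partial>lborel)
          = (\<integral>\<^sup>+t. ennreal (1 / \<bar>det h\<bar> ^ (m + l)) * (w (inv_root (gram (t :: real ^ 'm ^ 'l))) * unit_ball (inv_root (gram (t :: real ^ 'm ^ 'l)))) \<partial>lborel)"
        proof (rule nn_integral_cong_AE)
          show "AE t :: real ^ 'm ^ 'l in lborel. w (inv_root (gram ((t :: real ^ 'm ^ 'l) ** h)))
              * unit_ball (h ** inv_root (gram ((t :: real ^ 'm ^ 'l) ** h)))
            = ennreal (1 / \<bar>det h\<bar> ^ (m + l)) * (w (inv_root (gram (t :: real ^ 'm ^ 'l))) * unit_ball (inv_root (gram (t :: real ^ 'm ^ 'l))))"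
            using AE_posdef_gram[OF ml]
          proof eventually_elim
            case t: (elim t)
            show ?case
              using inv_root_conj[OF t elim]
              by (simp add: gram_mult w_def unit_ball_def power_divide flip: ennreal_mult')
          qed
        qed
        also have "\<dots> = ennreal (1 / \<bar>det h\<bar> ^ (m + l)) * c'"
          unfolding c'_def by (rule nn_integral_cmult) measurable
        finally have "(\<integral>\<^sup>+t. w (inv_root (gram (t :: real ^ 'm ^ 'l))) * unit_ball (h ** inv_root (gram (t :: real ^ 'm ^ 'l))) \<partial>lborel)
          = ennreal (\<bar>det h\<bar> ^ l) * (ennreal (1 / \<bar>det h\<bar> ^ (m + l)) * c')" .
        \<comment> \<open>One factor \<open>\<bar>det h\<bar> ^ l\<close> is the weight, the other
          comes from \<open>t ** h\<close>, and \<open>inv_root_conj\<close> divides by the power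
          \<open>m + l\<close>. The natural subtraction is exact because \<open>m\<close> is at most
          \<open>l\<close>.\<close>
        moreover have "ennreal (\<bar>det h\<bar> ^ l) * (ennreal (\<bar>det h\<bar> ^ l) * ennreal (1 / \<bar>det h\<bar> ^ (m + l))) = ennreal (\<bar>det h\<bar> ^ (l - m))"
        proof -
          have "\<bar>det h\<bar> ^ l = \<bar>det h\<bar> ^ (l - m) * \<bar>det h\<bar> ^ m"
            using ml by (simp add: l_def m_def flip: power_add)
          then show ?thesis using elim by (simp add: power_add flip: ennreal_mult')
        qed
        ultimately show ?case
          by (subst nn_integral_cmult) (simp_all add: mult_ac)
      qed
    qed
    also have "\<dots> = (\<integral>\<^sup>+h. G (h ** transpose h) * ennreal (\<bar>det h\<bar> ^ (l - m)) \<partial>lborel) * c'"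
      by (rule nn_integral_multc) measurable
    also have "(\<integral>\<^sup>+h. G (h ** transpose h) * ennreal (\<bar>det h\<bar> ^ (l - m)) \<partial>lborel)
        = (\<integral>\<^sup>+h. G (gram h) * ennreal (\<bar>det h\<bar> ^ (l - m)) \<partial>lborel)"
      using nn_integral_transpose[of "\<lambda>h. G (gram h) * ennreal (\<bar>det h\<bar> ^ (l - m))"] by (simp add: det_transpose)
    finally show ?thesis using I1 by (simp add: mult.commute)
  qed
  have c: "c \<noteq> 0" "c \<noteq> top"
    using nn_integral_unit_ball[where 'a="real ^ 'm ^ 'm"] unfolding c_def by auto
  show ?thesis
  \<comment> \<open>Only \<open>c\<close> is inverted, so \<open>C\<close> may still be infinite
    here. In \<open>gram_law_frame\<close> the total masses show that its multiple \<open>C'\<close>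
    is neither 0 nor infinite.\<close>
  proof (rule that[of "inverse c * c'"])
    fix G :: "real ^ 'm ^ 'm \<Rightarrow> ennreal" assume "G \<in> borel_measurable borel"
    from main[OF this] have "inverse c * (c * (\<integral>\<^sup>+t. G (gram (t :: real ^ 'm ^ 'l)) \<partial>lborel))
      = inverse c * (c' * (\<integral>\<^sup>+h. G (gram h) * ennreal (\<bar>det h\<bar> ^ (l - m)) \<partial>lborel))" by simp
    moreover have "inverse c * c = 1"
      using c ennreal_divide_self[of c] by (simp add: divide_ennreal_def mult.commute less_top[symmetric])
    ultimately show "(\<integral>\<^sup>+t. G (gram (t :: real ^ 'm ^ 'l)) \<partial>lborel) =
      inverse c * c' * (\<integral>\<^sup>+h. G (gram h) * ennreal (\<bar>det h\<bar> ^ (CARD('l) - CARD('m))) \<partial>lborel)"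
      unfolding m_def l_def by (simp add: mult.assoc[symmetric])
  qed
qed


subsection \<open>Translation by a Gram matrix\<close>

lemma singular_obtain_kernel:
  fixes A :: "real ^ 'm ^ 'm"
  assumes "det A = 0"
  obtains z where "z \<noteq> 0" "A *v z = 0"
  using assms invertible_det_nz[of A] invertible_left_inverse[of A] matrix_left_invertible_ker[of A] by blast

definition outer :: "real ^ 'm \<Rightarrow> real ^ 'm ^ 'm" where
  "outer y = (\<chi> i j. y $ i * y $ j)"

lemma outer_measurable [measurable]: "outer \<in> borel_measurable borel"
  unfolding outer_def[abs_def] by measurable

lemma inner_outer: "z \<bullet> (outer y *v z) = (y \<bullet> z)\<^sup>2"
  by (simp add: outer_def inner_vec_def matrix_vector_mult_def power2_eq_square sum_product
      sum_distrib_left mult_ac)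

lemma transpose_outer [simp]: "transpose (outer y) = outer y"
  by (simp add: outer_def transpose_def vec_eq_iff mult.commute)

lemma outer_conj: "transpose p ** outer y ** p = outer (transpose p *v y)" for p :: "real ^ 'm ^ 'm"
  by (simp add: outer_def vec_eq_iff matrix_matrix_mult_def matrix_vector_mult_def transpose_def
      sum_product sum_distrib_right sum_distrib_left mult_ac)

text \<open>This describes the cone by one equation for a Borel map, whence
  \<open>posdef_measurable\<close>. Outside the cone the value of \<open>inv_root\<close> is
  arbitrary, but the equation itself would force definiteness.\<close>

lemma posdef_iff_inv_root: "posdef s \<longleftrightarrow> transpose (inv_root s) ** s ** inv_root s = mat 1"
  for s :: "real ^ 'm ^ 'm"
proof
  define q where "q = inv_root s"
  assume "transpose (inv_root s) ** s ** inv_root s = mat 1"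
  then have q: "transpose q ** s ** q = mat 1" by (simp add: q_def)
  then have "det (transpose q ** s ** q) = 1" by simp
  then have "det q \<noteq> 0" by (auto simp: det_mul)
  then show "posdef s" using posdef_conj_iff[of q s] posdef_mat_1[where 'm='m] by (simp add: q)
qed (rule inv_root)

lemma posdef_measurable [measurable]: "Measurable.pred borel (posdef :: real ^ 'm ^ 'm \<Rightarrow> bool)"
proof -
  have "posdef = (\<lambda>s :: real ^ 'm ^ 'm. transpose (inv_root s) ** s ** inv_root s = mat 1)"
    by (simp add: fun_eq_iff posdef_iff_inv_root)
  moreover have "(\<lambda>s :: real ^ 'm ^ 'm. transpose (inv_root s) ** s ** inv_root s) \<in> borel_measurable borel"
    by measurable
  from measurable_sets_borel[OF this, of "{mat 1}"]
  have "Measurable.pred borel (\<lambda>s :: real ^ 'm ^ 'm. transpose (inv_root s) ** s ** inv_root s = mat 1)"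
    by (simp add: pred_def vimage_def)
  ultimately show ?thesis by (simp only:)
qed

text \<open>The case m = 1 of the translation invariance: under u = a^2 each half-line turns |a| da
  into du / 2, and adding 1 to a^2 is a translation of u.\<close>

lemma nn_integral_square_substitution:
  assumes [measurable]: "G \<in> borel_measurable borel"
  shows "(\<integral>\<^sup>+a. ennreal \<bar>a\<bar> * G (a\<^sup>2 + 1) \<partial>lborel)
    = (\<integral>\<^sup>+a. ennreal \<bar>a\<bar> * (G (a\<^sup>2) * of_bool (1 < a\<^sup>2)) \<partial>lborel)"
proof -
  have half: "(\<integral>\<^sup>+a. ennreal \<bar>a\<bar> * K (a\<^sup>2) * indicator {0..} a \<partial>lborel)
      = (\<integral>\<^sup>+u. K u * ennreal (1/2) * indicator {0..} u \<partial>lborel)"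
    if [measurable]: "K \<in> borel_measurable borel" for K :: "real \<Rightarrow> ennreal"
  proof -
    \<comment> \<open>The substitution is made on bounded intervals and extended by monotone limits;
      \<open>Suc n\<close> keeps the intervals nondegenerate.\<close>
    have seg: "(\<integral>\<^sup>+a. ennreal \<bar>a\<bar> * K (a\<^sup>2) * indicator {0..real (Suc n)} a \<partial>lborel)
      = (\<integral>\<^sup>+u. K u * ennreal (1/2) * indicator {0..(real (Suc n))\<^sup>2} u \<partial>lborel)" for n
    proof -
      have "(\<integral>\<^sup>+u. (K u * ennreal (1/2)) * indicator {0\<^sup>2..(real (Suc n))\<^sup>2} u \<partial>lborel)
        = (\<integral>\<^sup>+a. (K (a\<^sup>2) * ennreal (1/2)) * ennreal (2 * a) * indicator {0..real (Suc n)} a \<partial>lborel)"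
        by (rule nn_integral_substitution_aux) (auto intro!: derivative_eq_intros continuous_intros)
      also have "\<dots> = (\<integral>\<^sup>+a. ennreal \<bar>a\<bar> * K (a\<^sup>2) * indicator {0..real (Suc n)} a \<partial>lborel)"
      proof (rule nn_integral_cong)
        fix a :: real
        have "ennreal (1/2) * ennreal (2 * a) = ennreal \<bar>a\<bar>" if "0 \<le> a"
          using that ennreal_mult[of "1/2" "2 * a"] by simp
        then show "(K (a\<^sup>2) * ennreal (1/2)) * ennreal (2 * a) * indicator {0..real (Suc n)} a
          = ennreal \<bar>a\<bar> * K (a\<^sup>2) * indicator {0..real (Suc n)} a"
          by (auto simp: indicator_def mult.assoc) (metis mult.commute)
      qed
      finally show ?thesis by simp
    qed
    have S1: "(\<integral>\<^sup>+a. ennreal \<bar>a\<bar> * K (a\<^sup>2) * indicator {0..} a \<partial>lborel)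
        = (SUP n. \<integral>\<^sup>+a. ennreal \<bar>a\<bar> * K (a\<^sup>2) * indicator {0..real (Suc n)} a \<partial>lborel)"
    proof (subst nn_integral_monotone_convergence_SUP[symmetric])
      show "incseq (\<lambda>n a. ennreal \<bar>a\<bar> * K (a\<^sup>2) * indicator {0..real (Suc n)} a)"
        by (auto simp: incseq_def le_fun_def indicator_def intro!: mult_left_mono)
      have "(SUP n. ennreal \<bar>a\<bar> * K (a\<^sup>2) * indicator {0..real (Suc n)} a) = ennreal \<bar>a\<bar> * K (a\<^sup>2) * indicator {0..} a" for a :: real
      proof -
        obtain N where N: "a \<le> real N" using real_arch_simple by blast
        show ?thesis
          by (rule antisym, rule SUP_least, force simp: indicator_def,
              rule SUP_upper2[of N]) (use N in \<open>auto simp: indicator_def\<close>)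
      qed
      then show "(\<integral>\<^sup>+a. ennreal \<bar>a\<bar> * K (a\<^sup>2) * indicator {0..} a \<partial>lborel)
        = (\<integral>\<^sup>+a. (SUP n. ennreal \<bar>a\<bar> * K (a\<^sup>2) * indicator {0..real (Suc n)} a) \<partial>lborel)" by simp
    qed measurable
    have S2: "(\<integral>\<^sup>+u. K u * ennreal (1/2) * indicator {0..} u \<partial>lborel)
        = (SUP n. \<integral>\<^sup>+u. K u * ennreal (1/2) * indicator {0..(real (Suc n))\<^sup>2} u \<partial>lborel)"
    proof (subst nn_integral_monotone_convergence_SUP[symmetric])
      have "(real (Suc i))\<^sup>2 \<le> (real (Suc j))\<^sup>2" if "i \<le> j" for i j
        using that by (intro power_mono) auto
      then show "incseq (\<lambda>n u. K u * ennreal (1/2) * indicator {0..(real (Suc n))\<^sup>2} u)"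
        unfolding incseq_def le_fun_def
        by (intro allI impI mult_left_mono) (auto simp: indicator_def intro: order_trans)
      have "(SUP n. K u * ennreal (1/2) * indicator {0..(real (Suc n))\<^sup>2} u) = K u * ennreal (1/2) * indicator {0..} u" for u :: real
      proof -
        obtain N where "u \<le> real N" using real_arch_simple by blast
        also have "real N \<le> (real (Suc N))\<^sup>2" by (simp add: power2_eq_square algebra_simps)
        finally show ?thesis
          by (intro antisym SUP_least SUP_upper2[of N]) (auto simp: indicator_def)
      qed
      then show "(\<integral>\<^sup>+u. K u * ennreal (1/2) * indicator {0..} u \<partial>lborel)
        = (\<integral>\<^sup>+u. (SUP n. K u * ennreal (1/2) * indicator {0..(real (Suc n))\<^sup>2} u) \<partial>lborel)" by simp
    qed measurable
    show ?thesis unfolding S1 S2 seg ..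
  qed
  have full: "(\<integral>\<^sup>+a. ennreal \<bar>a\<bar> * K (a\<^sup>2) \<partial>lborel) = 2 * (\<integral>\<^sup>+u. K u * ennreal (1/2) * indicator {0..} u \<partial>lborel)"
    if [measurable]: "K \<in> borel_measurable borel" for K :: "real \<Rightarrow> ennreal"
  proof -
    have "(\<integral>\<^sup>+a. ennreal \<bar>a\<bar> * K (a\<^sup>2) \<partial>lborel) = (\<integral>\<^sup>+a. ennreal \<bar>a\<bar> * K (a\<^sup>2) * indicator {0..} a
        + ennreal \<bar>a\<bar> * K (a\<^sup>2) * indicator {0..} (- a) \<partial>lborel)"
      by (intro nn_integral_cong) (auto simp: indicator_def)
    also have "\<dots> = (\<integral>\<^sup>+a. ennreal \<bar>a\<bar> * K (a\<^sup>2) * indicator {0..} a \<partial>lborel)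
        + (\<integral>\<^sup>+a. ennreal \<bar>a\<bar> * K (a\<^sup>2) * indicator {0..} (- a) \<partial>lborel)"
      by (rule nn_integral_add) measurable
    also have "(\<integral>\<^sup>+a. ennreal \<bar>a\<bar> * K (a\<^sup>2) * indicator {0..} (- a) \<partial>lborel)
        = (\<integral>\<^sup>+a. ennreal \<bar>a\<bar> * K (a\<^sup>2) * indicator {0..} a \<partial>lborel)"
      by (subst nn_integral_real_affine[where c="-1" and t=0]) simp_all
    finally show ?thesis unfolding half[OF that] by (simp add: mult_2)
  qed
  have "(\<integral>\<^sup>+u. G (u + 1) * ennreal (1/2) * indicator {0..} u \<partial>lborel)
      = (\<integral>\<^sup>+u. (G u * of_bool (1 < u)) * ennreal (1/2) * indicator {0..} u \<partial>lborel)"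
  proof -
    have "(\<integral>\<^sup>+u. G u * of_bool (1 < u) * ennreal (1/2) * indicator {0..} u \<partial>lborel)
        = (\<integral>\<^sup>+u. G (1 + u) * of_bool (1 < 1 + u) * ennreal (1/2) * indicator {0..} (1 + u) \<partial>lborel)"
      by (rule nn_integral_lborel_translate[symmetric]) measurable
    also have "\<dots> = (\<integral>\<^sup>+u. G (u + 1) * ennreal (1/2) * indicator {0..} u \<partial>lborel)"
    proof (rule nn_integral_cong_AE)
      \<comment> \<open>The strict inequality and the closed half-line disagree at
        \<open>u = 0\<close> alone.\<close>
      have "AE u :: real in lborel. u \<noteq> 0" by (rule AE_lborel_singleton)
      then show "AE u in lborel. G (1 + u) * of_bool (1 < 1 + u) * ennreal (1/2) * indicator {0..} (1 + u)
          = G (u + 1) * ennreal (1/2) * indicator {0..} u"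
        by eventually_elim (auto simp: indicator_def add.commute)
    qed
    finally show ?thesis by simp
  qed
  then show ?thesis
    using full[of "\<lambda>u. G (u + 1)"] full[of "\<lambda>u. G u * of_bool (1 < u)"] by simp
qed

definition set_row :: "'m \<Rightarrow> real ^ 'm ^ 'm \<Rightarrow> real ^ 'm \<Rightarrow> real ^ 'm ^ 'm" where
  "set_row i h c = (\<chi> a. if a = i then c else h $ a)"

text \<open>Split row \<open>i\<close> as \<open>c + a *\<^sub>R \<nu>\<close> with \<open>\<nu>\<close> a unit normal to the other rows and to \<open>c\<close>: then
  \<open>h ** transpose h\<close> depends on \<open>a\<close> through its \<open>(i, i)\<close> entry only, where it is \<open>a\<^sup>2\<close> plus a
  constant, and \<open>\<bar>det h\<bar>\<close> is proportional to \<open>\<bar>a\<bar>\<close>.\<close>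

lemma row_shift:
  fixes h :: "real ^ 'm ^ 'm" and F :: "real ^ 'm ^ 'm \<Rightarrow> ennreal"
  assumes \<nu>: "norm \<nu> = 1" "\<And>a. a \<noteq> i \<Longrightarrow> h $ a \<bullet> \<nu> = 0" and c: "c \<bullet> \<nu> = 0"
    and [measurable]: "F \<in> borel_measurable borel"
  defines "X \<equiv> \<lambda>a. set_row i h (c + a *\<^sub>R \<nu>)" and "E \<equiv> outer (axis i 1)"
  shows "(\<integral>\<^sup>+a. F (X a ** transpose (X a) + E) * ennreal \<bar>det (X a)\<bar> \<partial>lborel)
    = (\<integral>\<^sup>+a. F (X a ** transpose (X a)) * of_bool (posdef (X a ** transpose (X a) - E)) * ennreal \<bar>det (X a)\<bar> \<partial>lborel)"
proof -
  define K where "K = \<bar>det (set_row i h \<nu>)\<bar>"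
  have K0 [simp]: "0 \<le> K" by (simp add: K_def)
  define N where "N = X 0 ** transpose (X 0)"
  have X0\<nu>: "X 0 *v \<nu> = 0"
    using \<nu>(2) c by (simp add: X_def set_row_def vec_eq_iff matrix_vector_mult_def inner_vec_def)
  have d0: "det (X 0) = 0"
  proof (rule ccontr)
    assume "det (X 0) \<noteq> 0"
    then have "\<nu> = 0"
      using X0\<nu> invertible_det_nz[of "X 0"] invertible_left_inverse[of "X 0"] matrix_left_invertible_ker[of "X 0"] by blast
    then show False using \<nu>(1) by simp
  qed
  have X0: "X 0 = set_row i h c" by (simp add: X_def)
  \<comment> \<open>The determinant is affine in \<open>a\<close>. Its constant term vanishes
    because \<open>\<nu>\<close> is orthogonal to every row of \<open>X 0\<close>.\<close>
  have dX: "\<bar>det (X a)\<bar> = \<bar>a\<bar> * K" for a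
  proof -
    have "det (X a) = det (X 0) + a * det (set_row i h \<nu>)"
      using det_row_add[of i "\<lambda>_. c" "\<lambda>_. a *\<^sub>R \<nu>" "\<lambda>b. h $ b"]
        det_row_mul[of i a "\<lambda>_. \<nu>" "\<lambda>b. h $ b", unfolded scalar_mult_eq_scaleR]
      unfolding X0 by (simp add: X_def set_row_def)
    then show ?thesis by (simp add: d0 K_def abs_mult)
  qed
  have XX: "X a ** transpose (X a) = N + a\<^sup>2 *\<^sub>R E" for a
  proof -
    have ip: "(X a ** transpose (X a)) $ x $ y = X a $ x \<bullet> X a $ y" for x y a
      by (simp add: matrix_matrix_mult_def transpose_def inner_vec_def)
    have "X a $ x \<bullet> X a $ y = X 0 $ x \<bullet> X 0 $ y + a\<^sup>2 * (E $ x $ y)" for x y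
    proof -
      have "\<nu> \<bullet> \<nu> = 1" "c \<bullet> \<nu> = 0" "\<nu> \<bullet> c = 0" using \<nu>(1) c by (simp_all add: norm_eq_1 inner_commute)
      moreover have "h $ b \<bullet> \<nu> = 0" "\<nu> \<bullet> h $ b = 0" if "b \<noteq> i" for b
        using \<nu>(2)[OF that] by (simp_all add: inner_commute)
      ultimately show ?thesis
        by (cases "x = i"; cases "y = i")
          (simp_all add: X_def set_row_def E_def outer_def axis_def inner_add_left inner_add_right power2_eq_square)
    qed
    then show ?thesis by (simp add: vec_eq_iff ip N_def)
  qed
  have EE: "z \<bullet> (E *v z) = (z $ i)\<^sup>2" for z
    by (simp add: E_def inner_outer inner_axis')
  have pd: "posdef (X a ** transpose (X a) - E) \<longleftrightarrow> 1 < a\<^sup>2" if "K \<noteq> 0" for a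
  proof
    assume a: "1 < a\<^sup>2"
    define b where "b = sqrt (a\<^sup>2 - 1)"
    have "X a ** transpose (X a) - E = X b ** transpose (X b)"
      using a by (simp add: XX b_def scaleR_diff_left)
    moreover have "det (X b) \<noteq> 0" using dX[of b] a that by (auto simp: b_def)
    then have "posdef (X b ** transpose (X b))"
      using posdef_gram_iff[of "transpose (X b)"] by (simp add: det_mul)
    ultimately show "posdef (X a ** transpose (X a) - E)" by simp
  next
    assume p: "posdef (X a ** transpose (X a) - E)"
    \<comment> \<open>On a vector in the left kernel of \<open>X 0\<close> the form of
      \<open>N\<close> vanishes, so positivity there can come only from the coefficient of
      \<open>E\<close>.\<close>
    obtain z where z: "z \<noteq> 0" "transpose (X 0) *v z = 0"
      using singular_obtain_kernel[of "transpose (X 0)"] d0 by auto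
    have "z \<bullet> (N *v z) = 0"
      using inner_gram[of z "transpose (X 0)"] z(2) by (simp add: N_def del: transpose_matrix_vector)
    moreover have "0 < z \<bullet> ((N + a\<^sup>2 *\<^sub>R E - E) *v z)"
      using p z(1) by (simp add: posdef_def XX)
    ultimately have "0 < (a\<^sup>2 - 1) * (z $ i)\<^sup>2"
      by (simp add: matrix_vector_mult_add_rdistrib matrix_vector_mult_diff_rdistrib
          scaleR_matrix_vector_assoc[symmetric] inner_add_right inner_diff_right EE algebra_simps)
    then show "1 < a\<^sup>2" by (simp add: zero_less_mult_iff)
  qed
  show ?thesis
  proof (cases "K = 0")
    case True
    then show ?thesis by (simp add: dX)
  next
    case False
    have "(\<integral>\<^sup>+a. F (X a ** transpose (X a) + E) * ennreal \<bar>det (X a)\<bar> \<partial>lborel)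
      = (\<integral>\<^sup>+a. ennreal K * (ennreal \<bar>a\<bar> * F (N + (a\<^sup>2 + 1) *\<^sub>R E)) \<partial>lborel)"
      by (intro nn_integral_cong) (simp add: XX dX ennreal_mult scaleR_add_left mult_ac add_ac)
    also have "\<dots> = ennreal K * (\<integral>\<^sup>+a. ennreal \<bar>a\<bar> * F (N + (a\<^sup>2 + 1) *\<^sub>R E) \<partial>lborel)"
      by (rule nn_integral_cmult) measurable
    also have "\<dots> = ennreal K * (\<integral>\<^sup>+a. ennreal \<bar>a\<bar> * (F (N + a\<^sup>2 *\<^sub>R E) * of_bool (1 < a\<^sup>2)) \<partial>lborel)"
      using nn_integral_square_substitution[of "\<lambda>u. F (N + u *\<^sub>R E)"] by simp
    also have "\<dots> = (\<integral>\<^sup>+a. ennreal K * (ennreal \<bar>a\<bar> * (F (N + a\<^sup>2 *\<^sub>R E) * of_bool (1 < a\<^sup>2))) \<partial>lborel)"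
      by (rule nn_integral_cmult[symmetric]) measurable
    also have "\<dots> = (\<integral>\<^sup>+a. F (X a ** transpose (X a)) * of_bool (posdef (X a ** transpose (X a) - E)) * ennreal \<bar>det (X a)\<bar> \<partial>lborel)"
      by (intro nn_integral_cong) (simp add: pd[OF False, unfolded XX] dX ennreal_mult XX mult_ac)
    finally show ?thesis .
  qed
qed

lemma set_row_measurable [measurable (raw)]:
  assumes [measurable]: "f \<in> borel_measurable M" "g \<in> borel_measurable M"
  shows "(\<lambda>x. set_row i (f x) (g x)) \<in> borel_measurable M"
  unfolding set_row_def
proof (rule borel_measurable_vec_lambda)
  fix a show "(\<lambda>x. if a = i then g x else f x $ a) \<in> borel_measurable M" by (cases "a = i") simp_all
qed

text \<open>Resampling twice, first row \<open>i\<close> and then its component along a normal of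
  the other rows, leaves a one-dimensional integral to which \<open>row_shift\<close>
  applies.\<close>

lemma shift_axis:
  fixes F :: "real ^ 'm ^ 'm \<Rightarrow> ennreal" and i :: 'm
  assumes [measurable]: "F \<in> borel_measurable borel"
  defines "E \<equiv> outer (axis i 1)"
  shows "(\<integral>\<^sup>+h. F (h ** transpose h + E) * ennreal \<bar>det h\<bar> \<partial>lborel)
    = (\<integral>\<^sup>+h. F (h ** transpose h) * of_bool (posdef (h ** transpose h - E)) * ennreal \<bar>det h\<bar> \<partial>lborel)"
proof -
  define p where "p h = h $ i" for h :: "real ^ 'm ^ 'm"
  define e where "e c = set_row i 0 c" for c :: "real ^ 'm"
  have lin: "linear p" "linear e"
    by (auto intro!: linearI simp: p_def e_def set_row_def vec_eq_iff)
  have pe: "p (e c) = c" for c by (simp add: p_def e_def set_row_def)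
  have sr: "h - e (p h) + e c = set_row i h c" for h c
    by (auto simp: p_def e_def set_row_def vec_eq_iff)
  have [measurable]: "p \<in> borel_measurable borel" "e \<in> borel_measurable borel"
    using lin by (auto intro: borel_measurable_linear)
  define L where "L x = F (x ** transpose x + E) * ennreal \<bar>det x\<bar>" for x
  define R where "R x = F (x ** transpose x) * of_bool (posdef (x ** transpose x - E)) * ennreal \<bar>det x\<bar>" for x
  have [measurable]: "L \<in> borel_measurable borel" "R \<in> borel_measurable borel"
    unfolding L_def R_def by measurable
  have inner: "(\<integral>\<^sup>+c. L (set_row i h c) \<partial>lborel) = (\<integral>\<^sup>+c. R (set_row i h c) \<partial>lborel)" for h
  proof -
    \<comment> \<open>With row \<open>i\<close> erased the matrix is singular, and a kernel vector
      is a normal to the remaining rows.\<close>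
    have "det (set_row i h 0) = 0"
      by (rule det_zero_row(1)[of i]) (simp add: row_def set_row_def vec_eq_iff)
    then obtain v where v: "v \<noteq> 0" "set_row i h 0 *v v = 0" by (rule singular_obtain_kernel)
    define \<nu> where "\<nu> = (1 / norm v) *\<^sub>R v"
    have \<nu>: "norm \<nu> = 1" using v(1) by (simp add: \<nu>_def)
    have h\<nu>: "h $ a \<bullet> \<nu> = 0" if "a \<noteq> i" for a
    proof -
      have "(set_row i h 0 *v v) $ a = 0" using v(2) by simp
      then have "h $ a \<bullet> v = 0"
        using that by (simp add: set_row_def matrix_vector_mult_def inner_vec_def)
      then show ?thesis by (simp add: \<nu>_def)
    qed
    have l1: "linear (\<lambda>c. c \<bullet> \<nu>)" "linear (\<lambda>a. a *\<^sub>R \<nu>)"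
      by (auto intro!: linearI simp: inner_add_left scaleR_add_left)
    have pe1: "(a *\<^sub>R \<nu>) \<bullet> \<nu> = a" for a
      using \<nu> by (simp add: norm_eq_1)
    note res = nn_integral_resample[OF _ l1 pe1]
    have "(\<integral>\<^sup>+c. L (set_row i h c) \<partial>lborel)
      = (\<integral>\<^sup>+c. \<integral>\<^sup>+a. L (set_row i h (c - (c \<bullet> \<nu>) *\<^sub>R \<nu> + a *\<^sub>R \<nu>)) * unit_box (c \<bullet> \<nu>) \<partial>lborel \<partial>lborel)"
      by (rule res) measurable
    also have "\<dots> = (\<integral>\<^sup>+c. (\<integral>\<^sup>+a. L (set_row i h (c - (c \<bullet> \<nu>) *\<^sub>R \<nu> + a *\<^sub>R \<nu>)) \<partial>lborel) * unit_box (c \<bullet> \<nu>) \<partial>lborel)"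
      by (intro nn_integral_cong nn_integral_multc) measurable
    also have "\<dots> = (\<integral>\<^sup>+c. (\<integral>\<^sup>+a. R (set_row i h (c - (c \<bullet> \<nu>) *\<^sub>R \<nu> + a *\<^sub>R \<nu>)) \<partial>lborel) * unit_box (c \<bullet> \<nu>) \<partial>lborel)"
    proof (rule nn_integral_cong)
      fix c
      have "(c - (c \<bullet> \<nu>) *\<^sub>R \<nu>) \<bullet> \<nu> = 0" using \<nu> by (simp add: inner_diff_left norm_eq_1)
      from row_shift[OF \<nu> h\<nu> this assms(1)]
      show "(\<integral>\<^sup>+a. L (set_row i h (c - (c \<bullet> \<nu>) *\<^sub>R \<nu> + a *\<^sub>R \<nu>)) \<partial>lborel) * unit_box (c \<bullet> \<nu>)
        = (\<integral>\<^sup>+a. R (set_row i h (c - (c \<bullet> \<nu>) *\<^sub>R \<nu> + a *\<^sub>R \<nu>)) \<partial>lborel) * unit_box (c \<bullet> \<nu>)"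
        unfolding L_def R_def E_def by simp
    qed
    also have "\<dots> = (\<integral>\<^sup>+c. \<integral>\<^sup>+a. R (set_row i h (c - (c \<bullet> \<nu>) *\<^sub>R \<nu> + a *\<^sub>R \<nu>)) * unit_box (c \<bullet> \<nu>) \<partial>lborel \<partial>lborel)"
      by (intro nn_integral_cong nn_integral_multc[symmetric]) measurable
    also have "\<dots> = (\<integral>\<^sup>+c. R (set_row i h c) \<partial>lborel)"
      by (rule res[symmetric]) measurable
    finally show ?thesis .
  qed
  have "(\<integral>\<^sup>+h. L h \<partial>lborel) = (\<integral>\<^sup>+h. \<integral>\<^sup>+c. L (h - e (p h) + e c) * unit_box (p h) \<partial>lborel \<partial>lborel)"
    by (rule nn_integral_resample[OF _ lin pe]) measurable
  also have "\<dots> = (\<integral>\<^sup>+h. (\<integral>\<^sup>+c. L (set_row i h c) \<partial>lborel) * unit_box (p h) \<partial>lborel)"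
    unfolding sr by (intro nn_integral_cong nn_integral_multc) measurable
  also have "\<dots> = (\<integral>\<^sup>+h. \<integral>\<^sup>+c. R (h - e (p h) + e c) * unit_box (p h) \<partial>lborel \<partial>lborel)"
    unfolding sr inner by (intro nn_integral_cong nn_integral_multc[symmetric]) measurable
  also have "\<dots> = (\<integral>\<^sup>+h. R h \<partial>lborel)"
    by (rule nn_integral_resample[OF _ lin pe, symmetric]) measurable
  finally show ?thesis unfolding L_def R_def .
qed

text \<open>A nonzero \<open>y\<close> is the image of a basis vector under
  \<open>transpose p\<close> with \<open>p\<close> invertible, and \<open>h ** p\<close> carries the
  axis translation to the one by \<open>outer y\<close>. Substitution and weight contribute the same
  powers of \<open>\<bar>det p\<bar>\<close> on both sides.\<close>

lemma shift_outer:
  fixes F :: "real ^ 'm ^ 'm \<Rightarrow> ennreal" and y :: "real ^ 'm"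
  assumes [measurable]: "F \<in> borel_measurable borel"
  shows "(\<integral>\<^sup>+h. F (gram h + outer y) * ennreal \<bar>det h\<bar> \<partial>lborel)
    = (\<integral>\<^sup>+h. F (gram h) * of_bool (posdef (gram h - outer y)) * ennreal \<bar>det h\<bar> \<partial>lborel)"
proof (cases "y = 0")
  case True
  \<comment> \<open>Where the indicator is 0 the matrix \<open>h\<close> is singular, and the weight
    vanishes as well.\<close>
  have "(\<integral>\<^sup>+h. F (gram h) * ennreal \<bar>det h\<bar> \<partial>lborel) = (\<integral>\<^sup>+h. F (gram h) * of_bool (posdef (gram h)) * ennreal \<bar>det h\<bar> \<partial>lborel)"
    by (rule nn_integral_cong) (auto simp: posdef_gram_iff det_mul)
  moreover have "outer y = 0" using True by (simp add: outer_def vec_eq_iff)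
  ultimately show ?thesis by simp
next
  case False
  define i :: 'm where "i = undefined"
  define u where "u = (1 / norm y) *\<^sub>R y"
  have "norm u = 1" using False by (simp add: u_def)
  then obtain g where g: "orthogonal_matrix g" "g *v axis i 1 = u"
    by (rule orthogonal_matrix_exists_basis)
  define p where "p = norm y *\<^sub>R transpose g"
  have "p = norm y *\<^sub>R mat 1 ** transpose g" by (simp add: p_def scalar_matrix_assoc[symmetric])
  moreover have "det (norm y *\<^sub>R mat 1 :: real ^ 'm ^ 'm) \<noteq> 0"
    using False by (subst det_diagonal) (auto simp: mat_def)
  moreover have "det g \<noteq> 0" using det_orthogonal_matrix[OF g(1)] by auto
  ultimately have p: "det p \<noteq> 0" by (simp add: det_mul)
  have "transpose p = norm y *\<^sub>R g" by (simp add: p_def transpose_scalar)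
  then have "transpose p *v axis i 1 = y"
    using g(2) False by (simp add: u_def scaleR_matrix_vector_assoc[symmetric] del: transpose_matrix_vector)
  then have py: "transpose p ** outer (axis i 1) ** p = outer y" by (simp only: outer_conj)
  let ?E = "outer (axis i 1) :: real ^ 'm ^ 'm"
  define F' where "F' s = F (transpose p ** s ** p)" for s
  have [measurable]: "F' \<in> borel_measurable borel" unfolding F'_def by measurable
  have tr: "(\<integral>\<^sup>+h. K (gram h) * ennreal \<bar>det h\<bar> \<partial>lborel) = (\<integral>\<^sup>+h. K (h ** transpose h) * ennreal \<bar>det h\<bar> \<partial>lborel)"
    if [measurable]: "K \<in> borel_measurable borel" for K :: "real ^ 'm ^ 'm \<Rightarrow> ennreal"
    using nn_integral_transpose[of "\<lambda>h. K (gram h) * ennreal \<bar>det h\<bar>"] by simp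
  have sub: "(\<integral>\<^sup>+h. K (gram h) * ennreal \<bar>det h\<bar> \<partial>lborel) = ennreal (\<bar>det p\<bar> ^ CARD('m)) *
      (\<integral>\<^sup>+h. K (transpose p ** gram h ** p) * ennreal \<bar>det h\<bar> * ennreal \<bar>det p\<bar> \<partial>lborel)"
    if [measurable]: "K \<in> borel_measurable borel" for K :: "real ^ 'm ^ 'm \<Rightarrow> ennreal"
    using nn_integral_right_mult[OF p, of "\<lambda>h. K (gram h) * ennreal \<bar>det h\<bar>"]
    by (simp add: gram_mult det_mul abs_mult ennreal_mult' mult_ac)
  have e1: "transpose p ** s ** p + outer y = transpose p ** (s + ?E) ** p" for s
    by (simp add: py[symmetric] matrix_add_ldistrib matrix_add_rdistrib)
  have e2: "transpose p ** s ** p - outer y = transpose p ** (s - ?E) ** p" for s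
    by (simp add: py[symmetric] matrix_diff_ldistrib matrix_diff_rdistrib)
  have "(\<integral>\<^sup>+h. F (gram h + outer y) * ennreal \<bar>det h\<bar> \<partial>lborel)
    = ennreal (\<bar>det p\<bar> ^ CARD('m)) * ((\<integral>\<^sup>+h. F' (gram h + ?E) * ennreal \<bar>det h\<bar> \<partial>lborel) * ennreal \<bar>det p\<bar>)"
    by (subst sub[of "\<lambda>s. F (s + outer y)"], measurable) (subst nn_integral_multc, simp_all add: e1 F'_def)
  also have "(\<integral>\<^sup>+h. F' (gram h + ?E) * ennreal \<bar>det h\<bar> \<partial>lborel)
    = (\<integral>\<^sup>+h. F' (h ** transpose h + ?E) * ennreal \<bar>det h\<bar> \<partial>lborel)"
    by (rule tr[of "\<lambda>s. F' (s + ?E)"]) measurable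
  also have "\<dots> = (\<integral>\<^sup>+h. F' (h ** transpose h) * of_bool (posdef (h ** transpose h - ?E)) * ennreal \<bar>det h\<bar> \<partial>lborel)"
    by (rule shift_axis) measurable
  also have "\<dots> = (\<integral>\<^sup>+h. F' (gram h) * of_bool (posdef (gram h - ?E)) * ennreal \<bar>det h\<bar> \<partial>lborel)"
    by (rule tr[of "\<lambda>s. F' s * of_bool (posdef (s - ?E))", symmetric]) measurable
  also have "ennreal (\<bar>det p\<bar> ^ CARD('m)) * ((\<integral>\<^sup>+h. F' (gram h) * of_bool (posdef (gram h - ?E)) * ennreal \<bar>det h\<bar> \<partial>lborel) * ennreal \<bar>det p\<bar>)
    = (\<integral>\<^sup>+h. F (gram h) * of_bool (posdef (gram h - outer y)) * ennreal \<bar>det h\<bar> \<partial>lborel)"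
    by (subst sub[of "\<lambda>s. F s * of_bool (posdef (s - outer y))"], measurable)
      (subst nn_integral_multc, simp_all add: e2 F'_def posdef_conj_iff[OF p])
  finally show ?thesis .
qed

lemma gram_eq_sum_outer: "gram \<omega> = (\<Sum>a\<in>UNIV. outer (\<omega> $ a))" for \<omega> :: "real ^ 'm ^ 'k"
  by (simp add: vec_eq_iff outer_def matrix_matrix_mult_def transpose_def)

text \<open>A Gram matrix is the sum of the outer products of the rows, which are translated away
  one at a time. The induction is over all \<open>F\<close>, since a pending translation is absorbed
  into \<open>F\<close>. The remaining sum \<open>B\<close> is semidefinite, so each intermediate
  indicator is implied by the final one.\<close>

lemma shift_gram:
  fixes F :: "real ^ 'm ^ 'm \<Rightarrow> ennreal" and \<omega> :: "real ^ 'm ^ 'k"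
  assumes "F \<in> borel_measurable borel"
  shows "(\<integral>\<^sup>+h. F (gram h + gram \<omega>) * ennreal \<bar>det h\<bar> \<partial>lborel)
    = (\<integral>\<^sup>+h. F (gram h) * of_bool (posdef (gram h - gram \<omega>)) * ennreal \<bar>det h\<bar> \<partial>lborel)"
proof -
  have "(\<integral>\<^sup>+h. F (gram h + (\<Sum>a\<in>S. outer (\<omega> $ a))) * ennreal \<bar>det h\<bar> \<partial>lborel)
    = (\<integral>\<^sup>+h. F (gram h) * of_bool (posdef (gram h - (\<Sum>a\<in>S. outer (\<omega> $ a)))) * ennreal \<bar>det h\<bar> \<partial>lborel)" for S
    using assms
  proof (induction S arbitrary: F rule: finite_induct[OF finite])
    case 1
    show ?case
      by (rule nn_integral_cong) (auto simp: posdef_gram_iff det_mul)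
  next
    case (2 a S)
    note [measurable] = 2(4)
    define B where "B = (\<Sum>a\<in>S. outer (\<omega> $ a))"
    define y where "y = \<omega> $ a"
    have ins: "(\<Sum>a\<in>insert a S. outer (\<omega> $ a)) = outer y + B"
      using 2(1,2) by (simp add: B_def y_def)
    have B: "0 \<le> z \<bullet> (B *v z)" for z
    proof -
      have "z \<bullet> (B *v z) = (\<Sum>a\<in>S. z \<bullet> (outer (\<omega> $ a) *v z))"
        unfolding B_def using 2(1) by (induction S rule: finite_induct)
          (simp_all add: matrix_vector_mult_add_rdistrib inner_add_right)
      then show ?thesis by (simp add: inner_outer sum_nonneg)
    qed
    have tB: "transpose B = B"
      unfolding B_def using 2(1) by (induction S rule: finite_induct)
        (simp_all add: transpose_add, simp add: transpose_def vec_eq_iff)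
    have pd: "posdef (s - outer y)" if "posdef (s - (outer y + B))" for s
      unfolding posdef_def
    proof (intro conjI allI impI)
      have "transpose (s - (outer y + B)) = s - (outer y + B)" using that by (simp add: posdef_def)
      then show "transpose (s - outer y) = s - outer y" by (simp add: transpose_diff transpose_add tB)
      fix z :: "real ^ 'm" assume "z \<noteq> 0"
      then have "0 < z \<bullet> ((s - (outer y + B)) *v z)" using that by (simp add: posdef_def)
      then show "0 < z \<bullet> ((s - outer y) *v z)"
        using B[of z] by (simp add: matrix_vector_mult_diff_rdistrib matrix_vector_mult_add_rdistrib
            inner_diff_right inner_add_right)
    qed
    have "(\<integral>\<^sup>+h. F (gram h + (outer y + B)) * ennreal \<bar>det h\<bar> \<partial>lborel)
      = (\<integral>\<^sup>+h. F (gram h + B + outer y) * ennreal \<bar>det h\<bar> \<partial>lborel)"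
      by (simp add: add_ac)
    also have "\<dots> = (\<integral>\<^sup>+h. F (gram h + outer y) * of_bool (posdef (gram h - B)) * ennreal \<bar>det h\<bar> \<partial>lborel)"
      using 2(3)[of "\<lambda>s. F (s + outer y)"] by (simp add: B_def)
    also have "\<dots> = (\<integral>\<^sup>+h. (F (gram h + outer y) * of_bool (posdef (gram h + outer y - (outer y + B)))) * ennreal \<bar>det h\<bar> \<partial>lborel)"
      by (simp add: algebra_simps)
    also have "\<dots> = (\<integral>\<^sup>+h. (F (gram h) * of_bool (posdef (gram h - (outer y + B)))) * of_bool (posdef (gram h - outer y)) * ennreal \<bar>det h\<bar> \<partial>lborel)"
      by (rule shift_outer[of "\<lambda>s. F s * of_bool (posdef (s - (outer y + B)))"]) measurable
    also have "\<dots> = (\<integral>\<^sup>+h. F (gram h) * of_bool (posdef (gram h - (outer y + B))) * ennreal \<bar>det h\<bar> \<partial>lborel)"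
      by (intro nn_integral_cong) (auto dest: pd)
    finally show ?case unfolding ins .
  qed
  then show ?thesis unfolding gram_eq_sum_outer[of \<omega>] .
qed


subsection \<open>The chart of the Stiefel manifold\<close>

lemma posdef_one_add_gram: "posdef (mat 1 + gram \<tau>)" for \<tau> :: "real ^ 'm ^ 'k"
  by (rule posdef_add_gram[OF posdef_mat_1])

text \<open>The matrix \<open>R\<close> of the overview, the inverse of
  \<open>mat 1 + gram \<tau>\<close>, in a form that is visibly Borel in
  \<open>\<tau>\<close>.\<close>

definition inv_gram :: "real ^ 'm ^ 'k \<Rightarrow> real ^ 'm ^ 'm" where
  "inv_gram \<tau> = inv_root (mat 1 + gram \<tau>) ** transpose (inv_root (mat 1 + gram \<tau>))"

lemma inv_gram_measurable [measurable]: "inv_gram \<in> borel_measurable borel"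
  unfolding inv_gram_def[abs_def] by measurable

lemma inv_gram: "(mat 1 + gram \<tau>) ** inv_gram \<tau> = mat 1" "inv_gram \<tau> ** (mat 1 + gram \<tau>) = mat 1"
  for \<tau> :: "real ^ 'm ^ 'k"
  unfolding inv_gram_def using inv_root_inverse[OF posdef_one_add_gram[of \<tau>]] by simp_all

lemma inv_gram_unique: "(mat 1 + gram \<tau>) ** B = mat 1 \<Longrightarrow> inv_gram \<tau> = B" for \<tau> :: "real ^ 'm ^ 'k"
  unfolding inv_gram_def by (rule inv_root_unique[OF posdef_one_add_gram])

lemma inv_gram_orthogonal:
  fixes \<tau> :: "real ^ 'm ^ 'k"
  assumes u: "orthogonal_matrix u"
  shows "inv_gram (\<tau> ** u) = transpose u ** inv_gram \<tau> ** u"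
proof (rule inv_gram_unique)
  have uu: "transpose u ** u = mat 1" "u ** transpose u = mat 1"
    using u by (auto simp: orthogonal_matrix_def)
  have "mat 1 + gram (\<tau> ** u) = transpose u ** (mat 1 + gram \<tau>) ** u"
    by (simp add: gram_mult matrix_add_ldistrib matrix_add_rdistrib uu)
  then have "(mat 1 + gram (\<tau> ** u)) ** (transpose u ** inv_gram \<tau> ** u)
      = transpose u ** ((mat 1 + gram \<tau>) ** (u ** transpose u) ** inv_gram \<tau>) ** u"
    by (simp add: matrix_mul_assoc)
  then show "(mat 1 + gram (\<tau> ** u)) ** (transpose u ** inv_gram \<tau> ** u) = mat 1"
    by (simp add: uu inv_gram)
qed

lemma det_one_add_gram_pos: "0 < det (mat 1 + gram \<tau>)" for \<tau> :: "real ^ 'm ^ 'k"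
  by (rule posdef_det_pos[OF posdef_one_add_gram])

lemma det_inv_gram: "det (inv_gram \<tau>) = 1 / det (mat 1 + gram \<tau>)" for \<tau> :: "real ^ 'm ^ 'k"
proof -
  have "det (mat 1 + gram \<tau>) * det (inv_gram \<tau>) = 1"
    using arg_cong[OF inv_gram(1), of det] by (simp only: det_mul det_I)
  then show ?thesis using det_one_add_gram_pos[of \<tau>] by (simp add: field_simps)
qed

lemma det_one_add_gram_orthogonal:
  fixes \<tau> :: "real ^ 'm ^ 'k"
  assumes u: "orthogonal_matrix u"
  shows "det (mat 1 + gram (\<tau> ** u)) = det (mat 1 + gram \<tau>)"
proof -
  have uu: "transpose u ** u = mat 1" using u by (auto simp: orthogonal_matrix_def)
  have "mat 1 + gram (\<tau> ** u) = transpose u ** (mat 1 + gram \<tau>) ** u"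
    by (simp add: gram_mult matrix_add_ldistrib matrix_add_rdistrib uu)
  then have "det (mat 1 + gram (\<tau> ** u)) = det u * det u * det (mat 1 + gram \<tau>)" by (simp add: det_mul)
  also have "det u * det u = 1" using det_orthogonal_matrix[OF u] by auto
  finally show ?thesis by simp
qed

text \<open>The chosen root \<open>q\<close> has \<open>q ** transpose q\<close> equal to the
  inverse. Since \<open>p\<close> will multiply \<open>h\<close> from the left,
  \<open>gram p\<close> has to be the inverse instead, with the normalisation preserved;
  \<open>gram_orthogonally_similar\<close> supplies the rotation.\<close>

lemma inv_gram_root_obtain:
  fixes \<tau> :: "real ^ 'm ^ 'k"
  obtains p :: "real ^ 'm ^ 'm" where "transpose p ** (mat 1 + gram \<tau>) ** p = mat 1"
    "gram p = inv_gram \<tau>" "(det p)\<^sup>2 = 1 / det (mat 1 + gram \<tau>)"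
proof -
  define q where "q = inv_root (mat 1 + gram \<tau>)"
  obtain g where g: "orthogonal_matrix g" "transpose g ** gram q ** g = q ** transpose q"
    by (rule gram_orthogonally_similar)
  have q: "transpose q ** (mat 1 + gram \<tau>) ** q = mat 1"
    unfolding q_def by (rule inv_root[OF posdef_one_add_gram])
  have "transpose (q ** g) ** (mat 1 + gram \<tau>) ** (q ** g) = transpose g ** (transpose q ** (mat 1 + gram \<tau>) ** q) ** g"
    by (simp add: matrix_transpose_mul matrix_mul_assoc)
  then have 1: "transpose (q ** g) ** (mat 1 + gram \<tau>) ** (q ** g) = mat 1"
    using g(1) unfolding q by (simp add: orthogonal_matrix)
  have 2: "gram (q ** g) = inv_gram \<tau>"
    unfolding gram_mult g(2) by (simp add: q_def inv_gram_def)
  have "(det (q ** g))\<^sup>2 = det (gram (q ** g))" by (simp add: det_mul power2_eq_square)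
  then have "(det (q ** g))\<^sup>2 = 1 / det (mat 1 + gram \<tau>)" unfolding 2 by (simp add: det_inv_gram)
  with 1 2 show ?thesis by (rule that)
qed

lemma abs_power_eq_powr:
  assumes "(p::real)\<^sup>2 = 1 / D" "0 < D"
  shows "\<bar>p\<bar> ^ N = D powr (- real N / 2)"
proof -
  have "\<bar>p\<bar> = sqrt (1 / D)" using real_sqrt_abs[of p] by (simp only: assms(1))
  also have "\<dots> = D powr (- 1 / 2)"
    using powr_minus_divide[of D "1/2"] powr_half_sqrt[of D] assms(2) by (simp add: real_sqrt_divide)
  finally have "\<bar>p\<bar> ^ N = (D powr (- 1 / 2)) ^ N" by simp
  also have "\<dots> = D powr (- real N / 2)"
    using assms(2) by (simp add: powr_power)
  finally show ?thesis .
qed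

definition ball_moment :: "'m::finite itself \<Rightarrow> nat \<Rightarrow> ennreal" where
  "ball_moment _ p = (\<integral>\<^sup>+h. unit_ball (h :: real ^ 'm ^ 'm) * ennreal (\<bar>det h\<bar> ^ p) \<partial>lborel)"

lemma ball_moment: "0 < ball_moment TYPE('m::finite) p" "ball_moment TYPE('m) p < top"
proof -
  show "0 < ball_moment TYPE('m::finite) p"
    unfolding ball_moment_def by (rule nn_integral_matrix_pos) (auto simp: unit_ball_def)
  have "continuous_on (cball 0 1) (\<lambda>h :: real ^ 'm ^ 'm. \<bar>det h\<bar> ^ p)"
    unfolding det_def by (intro continuous_intros)
  then have "bounded ((\<lambda>h :: real ^ 'm ^ 'm. \<bar>det h\<bar> ^ p) ` cball 0 1)"
    by (intro compact_imp_bounded compact_continuous_image) auto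
  then obtain M where M: "\<And>h :: real ^ 'm ^ 'm. norm h \<le> 1 \<Longrightarrow> \<bar>det h\<bar> ^ p \<le> M"
    unfolding bounded_iff by force
  have "ball_moment TYPE('m) p \<le> (\<integral>\<^sup>+h. unit_ball (h :: real ^ 'm ^ 'm) * ennreal M \<partial>lborel)"
    unfolding ball_moment_def by (intro nn_integral_mono) (auto simp: unit_ball_def M ennreal_leI)
  also have "\<dots> = (\<integral>\<^sup>+h. unit_ball (h :: real ^ 'm ^ 'm) \<partial>lborel) * ennreal M"
    by (rule nn_integral_multc) measurable
  also have "\<dots> < top"
    using nn_integral_unit_ball(2)[where 'a="real ^ 'm ^ 'm"] by (simp add: ennreal_mult_less_top)
  finally show "ball_moment TYPE('m) p < top" .
qed

section \<open>Two charts for the Gram matrix relative to a polar factor\<close>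

lemma unit_ball_eq_trace: "unit_ball x = of_bool (trace (gram x) \<le> 1)" for x :: "real ^ 'm ^ 'n"
proof -
  have "norm x \<le> 1 \<longleftrightarrow> (norm x)\<^sup>2 \<le> 1" by (simp add: abs_square_le_1)
  then show ?thesis by (simp add: unit_ball_def norm_matrix_eq_trace)
qed

text \<open>The form \<open>u\<close> in a basis orthonormal for \<open>s\<close>. For
  \<open>s = gram x\<close> and \<open>u = gram (transpose \<xi> ** x)\<close> it is the Gram matrix
  of the projected polar factor of \<open>x\<close>.\<close>

definition rel_gram :: "real ^ 'm ^ 'm \<Rightarrow> real ^ 'm ^ 'm \<Rightarrow> real ^ 'm ^ 'm" where
  "rel_gram s u = transpose (inv_root s) ** u ** inv_root s"

lemma rel_gram_measurable [measurable (raw)]: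
  fixes f :: "'a \<Rightarrow> real ^ 'm ^ 'm"
  assumes [measurable]: "f \<in> borel_measurable M" "g \<in> borel_measurable M"
  shows "(\<lambda>x. rel_gram (f x) (g x)) \<in> borel_measurable M"
  unfolding rel_gram_def by measurable

lemma trace_measurable [measurable (raw)]:
  fixes f :: "'a \<Rightarrow> real ^ 'm ^ 'm"
  assumes [measurable]: "f \<in> borel_measurable M"
  shows "(\<lambda>x. trace (f x)) \<in> borel_measurable M"
  unfolding trace_def by measurable

lemma polar_factor_orthogonal:
  fixes h :: "real ^ 'm ^ 'm"
  assumes "det h \<noteq> 0"
  shows "orthogonal_matrix (h ** inv_root (gram h))"
  using inv_root[of "gram h"] assms by (simp add: orthogonal_matrix gram_mult posdef_gram_iff det_mul)

lemma rel_gram_conj: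
  "rel_gram (gram h) (transpose h ** u ** h)
    = transpose (h ** inv_root (gram h)) ** u ** (h ** inv_root (gram h))" for h :: "real ^ 'm ^ 'm"
  by (simp add: rel_gram_def matrix_transpose_mul matrix_mul_assoc)

text \<open>Conjugating by a root leaves behind the polar factor of \<open>h\<close>. It is
  orthogonal for almost every \<open>h\<close>, so Lebesgue measure in \<open>\<tau>\<close> absorbs
  it and the integrals separate.\<close>

lemma nn_integral_rotate_rows:
  fixes \<Lambda> :: "real ^ 'm ^ 'k \<Rightarrow> ennreal" and w :: "real ^ 'm ^ 'm \<Rightarrow> ennreal"
  assumes [measurable]: "\<Lambda> \<in> borel_measurable borel" "w \<in> borel_measurable borel"
  shows "(\<integral>\<^sup>+h. \<integral>\<^sup>+\<tau>. w h * \<Lambda> (\<tau> ** (h ** inv_root (gram h))) \<partial>lborel \<partial>lborel)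
    = (\<integral>\<^sup>+h. w h \<partial>lborel) * (\<integral>\<^sup>+\<tau>. \<Lambda> \<tau> \<partial>lborel)"
proof -
  have "(\<integral>\<^sup>+h. \<integral>\<^sup>+\<tau>. w h * \<Lambda> (\<tau> ** (h ** inv_root (gram h))) \<partial>lborel \<partial>lborel)
      = (\<integral>\<^sup>+h. w h * (\<integral>\<^sup>+\<tau>. \<Lambda> \<tau> \<partial>lborel) \<partial>lborel)"
  proof (rule nn_integral_cong_AE)
    show "AE h in lborel. (\<integral>\<^sup>+\<tau>. w h * \<Lambda> (\<tau> ** (h ** inv_root (gram h))) \<partial>lborel) = w h * (\<integral>\<^sup>+\<tau>. \<Lambda> \<tau> \<partial>lborel)"
      using AE_det_nonzero
    proof eventually_elim
      case (elim h)
      define u where "u = h ** inv_root (gram h)"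
      have "\<bar>det u\<bar> = 1"
        using det_orthogonal_matrix[OF polar_factor_orthogonal[OF elim]] by (auto simp: u_def)
      then have "(\<integral>\<^sup>+\<tau>. \<Lambda> (\<tau> ** u) \<partial>lborel) = (\<integral>\<^sup>+\<tau>. \<Lambda> \<tau> \<partial>lborel)"
        using nn_integral_right_mult[of u \<Lambda>] by fastforce
      then show ?case by (simp add: u_def[symmetric] nn_integral_cmult)
    qed
  qed
  then show ?thesis by (simp add: nn_integral_multc)
qed

text \<open>The substitutions \<open>\<omega> = \<tau> ** h\<close> and then \<open>h \<mapsto> p ** h\<close>, where \<open>p\<close> is a root of the inverse of
  \<open>mat 1 + gram \<tau>\<close>.\<close>

lemma rel_gram_law:
  fixes g :: "real ^ 'm ^ 'm \<Rightarrow> ennreal"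
  assumes [measurable]: "g \<in> borel_measurable borel"
  shows "(\<integral>\<^sup>+\<omega>. \<integral>\<^sup>+h. of_bool (trace (gram (\<omega> :: real ^ 'm ^ 'k) + gram h) \<le> 1) * g (rel_gram (gram \<omega> + gram h) (gram h))
        * ennreal (\<bar>det h\<bar> ^ p) \<partial>lborel \<partial>lborel)
    = ball_moment TYPE('m) (CARD('k) + p) * (\<integral>\<^sup>+\<tau>. ennreal (det (mat 1 + gram (\<tau> :: real ^ 'm ^ 'k))
        powr (- real (CARD('k) + p + CARD('m)) / 2)) * g (inv_gram \<tau>) \<partial>lborel)"
proof -
  let ?f = "\<lambda>(\<omega> :: real ^ 'm ^ 'k) (h :: real ^ 'm ^ 'm). of_bool (trace (gram \<omega> + gram h) \<le> 1)
      * g (rel_gram (gram \<omega> + gram h) (gram h)) * ennreal (\<bar>det h\<bar> ^ p)"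
  define T where "T s u = of_bool (trace s \<le> 1) * g (rel_gram s u)" for s u :: "real ^ 'm ^ 'm"
  have [measurable]: "(\<lambda>x. T (a x) (b x)) \<in> borel_measurable M"
    if [measurable]: "a \<in> borel_measurable M" "b \<in> borel_measurable M" for a b and M :: "'z measure"
    unfolding T_def by measurable
  define \<Lambda> where "\<Lambda> \<tau> = ennreal (det (mat 1 + gram \<tau>) powr (- real (CARD('k) + p + CARD('m)) / 2)) * g (inv_gram \<tau>)"
    for \<tau> :: "real ^ 'm ^ 'k"
  have [measurable]: "\<Lambda> \<in> borel_measurable borel" unfolding \<Lambda>_def by measurable
  have "(\<integral>\<^sup>+\<omega>. \<integral>\<^sup>+h. ?f \<omega> h \<partial>lborel \<partial>lborel) = (\<integral>\<^sup>+h. \<integral>\<^sup>+\<omega>. ?f \<omega> h \<partial>lborel \<partial>lborel)"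
    by (intro nn_integral_lborel_swap) measurable
  also have "\<dots> = (\<integral>\<^sup>+h. \<integral>\<^sup>+\<tau>. T (transpose h ** (mat 1 + gram (\<tau> :: real ^ 'm ^ 'k)) ** h) (gram h)
      * ennreal (\<bar>det h\<bar> ^ (CARD('k) + p)) \<partial>lborel \<partial>lborel)"
  proof (rule nn_integral_cong_AE)
    show "AE h in lborel. (\<integral>\<^sup>+\<omega>. ?f \<omega> h \<partial>lborel) = (\<integral>\<^sup>+\<tau>. T (transpose h ** (mat 1 + gram (\<tau> :: real ^ 'm ^ 'k)) ** h) (gram h)
      * ennreal (\<bar>det h\<bar> ^ (CARD('k) + p)) \<partial>lborel)"
      using AE_det_nonzero
    proof eventually_elim
      case (elim h)
      have *: "gram (\<tau> ** h) + gram h = transpose h ** (mat 1 + gram \<tau>) ** h" for \<tau> :: "real ^ 'm ^ 'k"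
        by (simp add: gram_mult matrix_add_ldistrib matrix_add_rdistrib add.commute)
      have "(\<integral>\<^sup>+\<omega>. ?f \<omega> h \<partial>lborel) = ennreal (\<bar>det h\<bar> ^ CARD('k)) * (\<integral>\<^sup>+\<tau>. ?f (\<tau> ** h) h \<partial>lborel)"
        by (rule nn_integral_right_mult[OF elim]) measurable
      also have "\<dots> = (\<integral>\<^sup>+\<tau>. ennreal (\<bar>det h\<bar> ^ CARD('k)) * ?f (\<tau> ** h) h \<partial>lborel)"
        by (rule nn_integral_cmult[symmetric]) measurable
      finally show ?case
        unfolding * T_def by (simp add: power_add ennreal_mult' mult_ac)
    qed
  qed
  also have "\<dots> = (\<integral>\<^sup>+\<tau>. \<integral>\<^sup>+h. T (transpose h ** (mat 1 + gram (\<tau> :: real ^ 'm ^ 'k)) ** h) (gram h)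
      * ennreal (\<bar>det h\<bar> ^ (CARD('k) + p)) \<partial>lborel \<partial>lborel)"
    by (intro nn_integral_lborel_swap) measurable
  also have "\<dots> = (\<integral>\<^sup>+\<tau>. \<integral>\<^sup>+h. unit_ball h * ennreal (\<bar>det h\<bar> ^ (CARD('k) + p)) *
      (ennreal (det (mat 1 + gram \<tau>) powr (- real (CARD('k) + p + CARD('m)) / 2)) *
       g (rel_gram (gram h) (transpose h ** inv_gram (\<tau> :: real ^ 'm ^ 'k) ** h))) \<partial>lborel \<partial>lborel)"
  proof (rule nn_integral_cong)
    fix \<tau> :: "real ^ 'm ^ 'k"
    obtain r where r: "transpose r ** (mat 1 + gram \<tau>) ** r = mat 1" "gram r = inv_gram \<tau>"
      "(det r)\<^sup>2 = 1 / det (mat 1 + gram \<tau>)"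
      by (rule inv_gram_root_obtain)
    have dr: "det r \<noteq> 0" using r(3) det_one_add_gram_pos[of \<tau>] by auto
    have 1: "transpose (r ** h) ** (mat 1 + gram \<tau>) ** (r ** h) = gram h" for h :: "real ^ 'm ^ 'm"
      using arg_cong[OF r(1), of "\<lambda>B. transpose h ** B ** h"] by (simp add: matrix_transpose_mul matrix_mul_assoc)
    have 2: "gram (r ** h) = transpose h ** inv_gram \<tau> ** h" for h :: "real ^ 'm ^ 'm"
      by (simp add: gram_mult r(2))
    \<comment> \<open>The factor \<open>\<bar>det r\<bar>\<close> is the power -1/2 of the
      determinant. It occurs \<open>CARD('m)\<close> times from the substitution and
      \<open>CARD('k) + p\<close> times from the weight.\<close>
    have 3: "\<bar>det r\<bar> ^ CARD('m) * \<bar>det (r ** h)\<bar> ^ (CARD('k) + p)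
        = \<bar>det h\<bar> ^ (CARD('k) + p) * det (mat 1 + gram \<tau>) powr (- real (CARD('k) + p + CARD('m)) / 2)" for h :: "real ^ 'm ^ 'm"
      unfolding abs_power_eq_powr[OF r(3) det_one_add_gram_pos, symmetric]
      by (simp add: det_mul abs_mult power_mult_distrib power_add mult_ac)
    have 4: "ennreal (\<bar>det r\<bar> ^ CARD('m)) * ennreal (\<bar>det (r ** h)\<bar> ^ (CARD('k) + p))
        = ennreal (\<bar>det h\<bar> ^ (CARD('k) + p)) * ennreal (det (mat 1 + gram \<tau>) powr (- real (CARD('k) + p + CARD('m)) / 2))" for h :: "real ^ 'm ^ 'm"
      by (subst (1 2) ennreal_mult[symmetric]) (simp_all add: 3)
    have "(\<integral>\<^sup>+h. T (transpose h ** (mat 1 + gram \<tau>) ** h) (gram h) * ennreal (\<bar>det h\<bar> ^ (CARD('k) + p)) \<partial>lborel)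
      = ennreal (\<bar>det r\<bar> ^ CARD('m)) * (\<integral>\<^sup>+h. T (transpose (r ** h) ** (mat 1 + gram \<tau>) ** (r ** h)) (gram (r ** h))
          * ennreal (\<bar>det (r ** h)\<bar> ^ (CARD('k) + p)) \<partial>lborel)"
      by (rule nn_integral_left_mult[OF dr]) measurable
    also have "\<dots> = (\<integral>\<^sup>+h. T (gram h) (transpose h ** inv_gram \<tau> ** h) * (ennreal (\<bar>det r\<bar> ^ CARD('m)) *
          ennreal (\<bar>det (r ** h)\<bar> ^ (CARD('k) + p))) \<partial>lborel)"
      unfolding 1 2 by (subst nn_integral_cmult[symmetric]) (measurable, simp add: mult_ac)
    finally show "(\<integral>\<^sup>+h. T (transpose h ** (mat 1 + gram \<tau>) ** h) (gram h) * ennreal (\<bar>det h\<bar> ^ (CARD('k) + p)) \<partial>lborel)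
      = (\<integral>\<^sup>+h. unit_ball h * ennreal (\<bar>det h\<bar> ^ (CARD('k) + p)) *
      (ennreal (det (mat 1 + gram \<tau>) powr (- real (CARD('k) + p + CARD('m)) / 2)) *
       g (rel_gram (gram h) (transpose h ** inv_gram \<tau> ** h))) \<partial>lborel)"
      unfolding 4 T_def unit_ball_eq_trace by (simp add: mult_ac)
  qed
  also have "\<dots> = (\<integral>\<^sup>+h. \<integral>\<^sup>+\<tau>. unit_ball h * ennreal (\<bar>det h\<bar> ^ (CARD('k) + p)) *
      (ennreal (det (mat 1 + gram \<tau>) powr (- real (CARD('k) + p + CARD('m)) / 2)) *
       g (rel_gram (gram h) (transpose h ** inv_gram (\<tau> :: real ^ 'm ^ 'k) ** h))) \<partial>lborel \<partial>lborel)"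
    by (intro nn_integral_lborel_swap) measurable
  \<comment> \<open>Conjugating \<open>inv_gram \<tau>\<close> by the polar factor of
    \<open>h\<close> is the same as rotating the rows of \<open>\<tau>\<close> by it.\<close>
  also have "\<dots> = (\<integral>\<^sup>+h. \<integral>\<^sup>+\<tau>. unit_ball h * ennreal (\<bar>det h\<bar> ^ (CARD('k) + p)) *
      \<Lambda> (\<tau> ** (h ** inv_root (gram h))) \<partial>lborel \<partial>lborel)"
  proof (rule nn_integral_cong_AE)
    show "AE h in lborel. (\<integral>\<^sup>+\<tau>. unit_ball h * ennreal (\<bar>det h\<bar> ^ (CARD('k) + p)) *
      (ennreal (det (mat 1 + gram \<tau>) powr (- real (CARD('k) + p + CARD('m)) / 2)) *
       g (rel_gram (gram h) (transpose h ** inv_gram (\<tau> :: real ^ 'm ^ 'k) ** h))) \<partial>lborel)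
      = (\<integral>\<^sup>+\<tau>. unit_ball h * ennreal (\<bar>det h\<bar> ^ (CARD('k) + p)) * \<Lambda> (\<tau> ** (h ** inv_root (gram h))) \<partial>lborel)"
      using AE_det_nonzero
    proof eventually_elim
      case (elim h)
      note u = polar_factor_orthogonal[OF elim]
      show ?case
        by (simp only: \<Lambda>_def rel_gram_conj inv_gram_orthogonal[OF u] det_one_add_gram_orthogonal[OF u])
    qed
  qed
  also have "\<dots> = ball_moment TYPE('m) (CARD('k) + p) * (\<integral>\<^sup>+\<tau>. \<Lambda> \<tau> \<partial>lborel)"
    unfolding ball_moment_def by (rule nn_integral_rotate_rows) measurable
  finally show ?thesis unfolding \<Lambda>_def .
qed

text \<open>The left side of \<open>rel_gram_law\<close> with \<open>p = 1\<close> is evaluated a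
  second time. For fixed \<open>\<omega>\<close> the weight \<open>\<bar>det h\<bar>\<close> allows
  \<open>shift_gram\<close>, which replaces \<open>gram h + gram \<omega>\<close> by
  \<open>gram h\<close> and \<open>gram h\<close> by \<open>gram h - gram \<omega>\<close>.
  Substituting \<open>\<omega> = \<eta> ** h\<close> then gives \<open>mat 1 - gram \<eta>\<close>,
  with the same ball moment in front, which cancels.\<close>

lemma inv_gram_law:
  fixes g :: "real ^ 'm ^ 'm \<Rightarrow> ennreal"
  assumes [measurable]: "g \<in> borel_measurable borel"
  shows "(\<integral>\<^sup>+\<tau>. ennreal (det (mat 1 + gram (\<tau> :: real ^ 'm ^ 'k)) powr (- real (CARD('k) + 1 + CARD('m)) / 2))
        * g (inv_gram \<tau>) \<partial>lborel)
    = (\<integral>\<^sup>+\<eta>. of_bool (posdef (mat 1 - gram \<eta>)) * g (mat 1 - gram (\<eta> :: real ^ 'm ^ 'k)) \<partial>lborel)"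
proof -
  define \<Lambda> where "\<Lambda> \<eta> = of_bool (posdef (mat 1 - gram \<eta>)) * g (mat 1 - gram \<eta>)" for \<eta> :: "real ^ 'm ^ 'k"
  have [measurable]: "\<Lambda> \<in> borel_measurable borel" unfolding \<Lambda>_def by measurable
  define T where "T s u = of_bool (trace s \<le> 1) * g (rel_gram s u)" for s u :: "real ^ 'm ^ 'm"
  have [measurable]: "(\<lambda>x. T (a x) (b x)) \<in> borel_measurable M"
    if [measurable]: "a \<in> borel_measurable M" "b \<in> borel_measurable M" for a b and M :: "'z measure"
    unfolding T_def by measurable
  have "(\<integral>\<^sup>+\<omega>. \<integral>\<^sup>+h. T (gram (\<omega> :: real ^ 'm ^ 'k) + gram h) (gram h) * ennreal (\<bar>det h\<bar> ^ 1) \<partial>lborel \<partial>lborel)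
    = (\<integral>\<^sup>+\<omega>. \<integral>\<^sup>+h. T (gram h) (gram h - gram (\<omega> :: real ^ 'm ^ 'k)) * of_bool (posdef (gram h - gram \<omega>)) * ennreal \<bar>det h\<bar> \<partial>lborel \<partial>lborel)"
  proof (rule nn_integral_cong)
    fix \<omega> :: "real ^ 'm ^ 'k"
    show "(\<integral>\<^sup>+h. T (gram \<omega> + gram h) (gram h) * ennreal (\<bar>det h\<bar> ^ 1) \<partial>lborel)
      = (\<integral>\<^sup>+h. T (gram h) (gram h - gram \<omega>) * of_bool (posdef (gram h - gram \<omega>)) * ennreal \<bar>det h\<bar> \<partial>lborel)"
      using shift_gram[of "\<lambda>s. T s (s - gram \<omega>)" \<omega>] by (simp add: add.commute)
  qed
  also have "\<dots> = (\<integral>\<^sup>+h. \<integral>\<^sup>+\<omega>. T (gram h) (gram h - gram (\<omega> :: real ^ 'm ^ 'k)) * of_bool (posdef (gram h - gram \<omega>)) * ennreal \<bar>det h\<bar> \<partial>lborel \<partial>lborel)"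
    by (intro nn_integral_lborel_swap) measurable
  also have "\<dots> = (\<integral>\<^sup>+h. \<integral>\<^sup>+\<eta>. unit_ball h * ennreal (\<bar>det h\<bar> ^ (CARD('k) + 1)) * \<Lambda> (\<eta> ** (h ** inv_root (gram h))) \<partial>lborel \<partial>lborel)"
  proof (rule nn_integral_cong_AE)
    show "AE h in lborel. (\<integral>\<^sup>+\<omega>. T (gram h) (gram h - gram (\<omega> :: real ^ 'm ^ 'k)) * of_bool (posdef (gram h - gram \<omega>)) * ennreal \<bar>det h\<bar> \<partial>lborel)
      = (\<integral>\<^sup>+\<eta>. unit_ball h * ennreal (\<bar>det h\<bar> ^ (CARD('k) + 1)) * \<Lambda> (\<eta> ** (h ** inv_root (gram h))) \<partial>lborel)"
      using AE_det_nonzero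
    proof eventually_elim
      case (elim h)
      define u where "u = h ** inv_root (gram h)"
      have u: "orthogonal_matrix u" unfolding u_def by (rule polar_factor_orthogonal[OF elim])
      then have du: "det u \<noteq> 0" using det_orthogonal_matrix[OF u] by auto
      have uu: "transpose u ** u = mat 1" using u by (simp add: orthogonal_matrix)
      have *: "gram h - gram (\<eta> ** h) = transpose h ** (mat 1 - gram \<eta>) ** h" for \<eta> :: "real ^ 'm ^ 'k"
        by (simp add: gram_mult matrix_diff_ldistrib matrix_diff_rdistrib)
      have **: "mat 1 - gram (\<eta> ** u) = transpose u ** (mat 1 - gram \<eta>) ** u" for \<eta> :: "real ^ 'm ^ 'k"
        by (simp add: gram_mult matrix_diff_ldistrib matrix_diff_rdistrib uu)
      have "(\<integral>\<^sup>+\<omega>. T (gram h) (gram h - gram (\<omega> :: real ^ 'm ^ 'k)) * of_bool (posdef (gram h - gram \<omega>)) * ennreal \<bar>det h\<bar> \<partial>lborel)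
        = ennreal (\<bar>det h\<bar> ^ CARD('k)) * (\<integral>\<^sup>+\<eta>. T (gram h) (gram h - gram ((\<eta> :: real ^ 'm ^ 'k) ** h)) * of_bool (posdef (gram h - gram (\<eta> ** h))) * ennreal \<bar>det h\<bar> \<partial>lborel)"
        by (rule nn_integral_right_mult[OF elim]) measurable
      also have "\<dots> = (\<integral>\<^sup>+\<eta>. ennreal (\<bar>det h\<bar> ^ CARD('k)) * (T (gram h) (gram h - gram ((\<eta> :: real ^ 'm ^ 'k) ** h)) * of_bool (posdef (gram h - gram (\<eta> ** h))) * ennreal \<bar>det h\<bar>) \<partial>lborel)"
        by (rule nn_integral_cmult[symmetric]) measurable
      also have "\<dots> = (\<integral>\<^sup>+\<eta>. unit_ball h * ennreal (\<bar>det h\<bar> ^ (CARD('k) + 1)) * \<Lambda> (\<eta> ** u) \<partial>lborel)"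
        unfolding * T_def \<Lambda>_def ** posdef_conj_iff[OF elim] posdef_conj_iff[OF du] rel_gram_conj u_def[symmetric] unit_ball_eq_trace
        by (simp add: power_add ennreal_mult' mult_ac)
      finally show ?case by (simp only: u_def)
    qed
  qed
  also have "\<dots> = ball_moment TYPE('m) (CARD('k) + 1) * (\<integral>\<^sup>+\<eta>. \<Lambda> \<eta> \<partial>lborel)"
    unfolding ball_moment_def by (rule nn_integral_rotate_rows) measurable
  finally have "ball_moment TYPE('m) (CARD('k) + 1) *
      (\<integral>\<^sup>+\<tau>. ennreal (det (mat 1 + gram (\<tau> :: real ^ 'm ^ 'k)) powr (- real (CARD('k) + 1 + CARD('m)) / 2)) * g (inv_gram \<tau>) \<partial>lborel)
      = ball_moment TYPE('m) (CARD('k) + 1) * (\<integral>\<^sup>+\<eta>. \<Lambda> \<eta> \<partial>lborel)"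
    unfolding T_def using rel_gram_law[where 'k='k and p=1, OF assms] by simp
  then show ?thesis
    unfolding \<Lambda>_def using ball_moment[where 'm='m, of "CARD('k) + 1"]
    by (simp only: ennreal_mult_cancel_left) auto
qed


subsection \<open>Laws under the invariant measure\<close>

text \<open>A matrix-variate t density without its normalising constant. With \<open>a = n\<close>
  it governs the law of the projected frame.\<close>

definition chart_weight :: "real \<Rightarrow> real ^ 'm ^ 'k \<Rightarrow> ennreal" where
  "chart_weight a \<tau> = ennreal (det (mat 1 + gram \<tau>) powr (- a / 2))"

lemma chart_weight_measurable [measurable]: "chart_weight a \<in> borel_measurable borel"
  unfolding chart_weight_def[abs_def] by measurable

lemma gram_frame: "gram (stack 0 (mat 1) :: real ^ 'l ^ ('k::finite + 'l::finite)) = mat 1"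
  by (simp add: gram_stack)

lemma frame_transpose_stack: "transpose (stack 0 (mat 1)) ** stack \<omega> t = t"
  for \<omega> :: "real ^ 'm ^ 'k" and t :: "real ^ 'm ^ 'l"
  by (simp add: vec_eq_iff matrix_matrix_mult_def transpose_def sum_UNIV_Plus mat_def if_distrib[of "\<lambda>c. c * _"]
      cong: if_cong)

locale stiefel_setting =
  fixes \<sigma> :: real and \<mu> :: "(real ^ 'l ^ 'n) measure"
  assumes stiefel: "stiefel_measure \<sigma> \<mu>"
begin

lemma sets_mu: "sets \<mu> = sets (restrict_space borel stiefel)"
  using stiefel by (simp add: stiefel_measure_def)

lemma space_mu: "space \<mu> = stiefel"
  using sets_eq_imp_space_eq[OF sets_mu] by (simp add: space_restrict_space)

lemma sigma_pos: "0 < \<sigma>"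
  using stiefel by (simp add: stiefel_measure_def)

lemma emeasure_mu: "emeasure \<mu> (space \<mu>) = ennreal \<sigma>"
  using stiefel by (simp add: stiefel_measure_def space_mu)

lemma measurable_id_mu [measurable]: "(\<lambda>\<xi>. \<xi>) \<in> borel_measurable \<mu>"
proof -
  have "(\<lambda>\<xi>. \<xi>) \<in> borel_measurable (restrict_space borel stiefel)"
    by (rule measurable_restrict_space1) simp
  then show ?thesis using measurable_cong_sets[OF sets_mu refl] by blast
qed

lemma finite_mu: "finite_measure \<mu>"
  by (rule finite_measureI) (simp add: emeasure_mu)

lemma sigma_finite_mu: "sigma_finite_measure \<mu>"
  using finite_mu by (rule finite_measure.axioms(1))

lemma left_mult_measurable_mu:
  fixes g :: "real ^ 'n ^ 'n"
  assumes g: "orthogonal_matrix g"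
  shows "(\<lambda>\<xi>. g ** \<xi>) \<in> measurable \<mu> \<mu>"
proof -
  have "(\<lambda>\<xi>. g ** \<xi>) \<in> measurable \<mu> (restrict_space borel stiefel)"
  proof (rule measurable_restrict_space2)
    show "(\<lambda>\<xi>. g ** \<xi>) \<in> space \<mu> \<rightarrow> stiefel"
      by (auto simp: space_mu stiefel_def gram_orthogonal_left[OF g])
  qed measurable
  then show ?thesis using measurable_cong_sets[OF refl sets_mu] by blast
qed

lemma nn_integral_mu_rotate:
  fixes g :: "real ^ 'n ^ 'n"
  assumes g: "orthogonal_matrix g" and [measurable]: "f \<in> borel_measurable borel"
  shows "(\<integral>\<^sup>+\<xi>. f (g ** \<xi>) \<partial>\<mu>) = (\<integral>\<^sup>+\<xi>. f \<xi> \<partial>\<mu>)"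
proof -
  have "distr \<mu> \<mu> (\<lambda>\<xi>. g ** \<xi>) = \<mu>" using stiefel g by (simp add: stiefel_measure_def)
  then have "(\<integral>\<^sup>+\<xi>. f \<xi> \<partial>\<mu>) = (\<integral>\<^sup>+\<xi>. f \<xi> \<partial>distr \<mu> \<mu> (\<lambda>\<xi>. g ** \<xi>))" by simp
  also have "\<dots> = (\<integral>\<^sup>+\<xi>. f (g ** \<xi>) \<partial>\<mu>)"
    by (rule nn_integral_distr[OF left_mult_measurable_mu[OF g]]) measurable
  finally show ?thesis by simp
qed

lemma nn_integral_swap_mu:
  fixes f :: "real ^ 'l ^ 'n \<Rightarrow> 'b::euclidean_space \<Rightarrow> ennreal"
  assumes "(\<lambda>p. f (fst p) (snd p)) \<in> borel_measurable (borel \<Otimes>\<^sub>M borel)"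
  shows "(\<integral>\<^sup>+\<xi>. \<integral>\<^sup>+x. f \<xi> x \<partial>lborel \<partial>\<mu>) = (\<integral>\<^sup>+x. \<integral>\<^sup>+\<xi>. f \<xi> x \<partial>\<mu> \<partial>lborel)"
proof -
  interpret \<mu>: sigma_finite_measure \<mu> by (rule sigma_finite_mu)
  interpret pair_sigma_finite \<mu> "lborel :: 'b measure" ..
  have "(\<lambda>p. (fst p, snd p)) \<in> measurable (\<mu> \<Otimes>\<^sub>M (lborel :: 'b measure)) (borel \<Otimes>\<^sub>M borel)"
    by measurable
  from measurable_compose[OF this assms]
  have "case_prod f \<in> borel_measurable (\<mu> \<Otimes>\<^sub>M (lborel :: 'b measure))"
    by (simp add: case_prod_unfold)
  then show ?thesis by (rule Fubini'[symmetric])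
qed

end

locale stiefel_law = stiefel_setting \<sigma> \<mu>
  for \<sigma> :: real and \<mu> :: "(real ^ 'l ^ ('k::finite + 'l::finite)) measure"
begin

text \<open>By invariance the law of \<open>gram (transpose \<xi> ** v)\<close> is the same for all \<open>v\<close> in the Stiefel manifold;
  it is found by averaging over the polar factor \<open>v\<close> of \<open>x\<close> in a ball.\<close>

lemma gram_law_frame:
  fixes v :: "real ^ 'm ^ ('k + 'l)" and g :: "real ^ 'm ^ 'm \<Rightarrow> ennreal"
  assumes ml: "CARD('m) \<le> CARD('l)" and v: "gram v = mat 1" and [measurable]: "g \<in> borel_measurable borel"
  shows "(\<integral>\<^sup>+\<xi>. g (gram (transpose \<xi> ** v)) \<partial>\<mu>) * (\<integral>\<^sup>+\<tau>. chart_weight (CARD('k) + CARD('l)) (\<tau> :: real ^ 'm ^ 'k) \<partial>lborel)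
    = ennreal \<sigma> * (\<integral>\<^sup>+\<tau>. chart_weight (CARD('k) + CARD('l)) (\<tau> :: real ^ 'm ^ 'k) * g (inv_gram \<tau>) \<partial>lborel)"
proof -
  define A where "A g = (\<integral>\<^sup>+\<tau>. chart_weight (CARD('k) + CARD('l)) (\<tau> :: real ^ 'm ^ 'k) * g (inv_gram \<tau>) \<partial>lborel)"
    for g :: "real ^ 'm ^ 'm \<Rightarrow> ennreal"
  define b where "b g = (\<integral>\<^sup>+\<xi>. g (gram (transpose \<xi> ** v)) \<partial>\<mu>)" for g :: "real ^ 'm ^ 'm \<Rightarrow> ennreal"
  define \<beta> where "\<beta> = (\<integral>\<^sup>+x. unit_ball (x :: real ^ 'm ^ ('k + 'l)) \<partial>lborel)"
  have "\<exists>C. \<forall>G :: real ^ 'm ^ 'm \<Rightarrow> ennreal. G \<in> borel_measurable borel \<longrightarrow>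
      (\<integral>\<^sup>+t. G (gram (t :: real ^ 'm ^ 'l)) \<partial>lborel) =
      C * (\<integral>\<^sup>+h. G (gram h) * ennreal (\<bar>det h\<bar> ^ (CARD('l) - CARD('m))) \<partial>lborel)"
    by (rule nn_integral_polar[OF ml]) blast
  then obtain C where C: "\<And>G :: real ^ 'm ^ 'm \<Rightarrow> ennreal. G \<in> borel_measurable borel \<Longrightarrow>
      (\<integral>\<^sup>+t. G (gram (t :: real ^ 'm ^ 'l)) \<partial>lborel) =
      C * (\<integral>\<^sup>+h. G (gram h) * ennreal (\<bar>det h\<bar> ^ (CARD('l) - CARD('m))) \<partial>lborel)"
    by blast
  define C' where "C' = C * ball_moment TYPE('m) (CARD('k) + (CARD('l) - CARD('m)))"
  have cardn: "CARD('m) \<le> CARD('k + 'l)" using ml by simp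
  have key: "b g * \<beta> = ennreal \<sigma> * (C' * A g)" if [measurable]: "g \<in> borel_measurable borel" for g
  proof -
    have inv: "(\<integral>\<^sup>+\<xi>. g (gram (transpose \<xi> ** w)) \<partial>\<mu>) = b g" if w: "gram w = mat 1" for w :: "real ^ 'm ^ ('k + 'l)"
    \<comment> \<open>The rotation from \<open>v\<close> to \<open>w\<close> is transferred to
      \<open>\<xi>\<close> by transposition, where the invariance of the measure removes it.\<close>
    proof -
      obtain u where u: "orthogonal_matrix u" "u ** v = w"
        using v w by (rule orthogonal_matrix_transitive)
      have "(\<integral>\<^sup>+\<xi>. g (gram (transpose (transpose u ** \<xi>) ** v)) \<partial>\<mu>) = b g"
        unfolding b_def using u(1) by (intro nn_integral_mu_rotate) (simp, measurable)
      then show ?thesis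
        by (simp add: matrix_transpose_mul matrix_mul_assoc[symmetric] u(2)[symmetric])
    qed
    have "b g * \<beta> = (\<integral>\<^sup>+x. unit_ball (x :: real ^ 'm ^ ('k + 'l)) * b g \<partial>lborel)"
      unfolding \<beta>_def by (subst nn_integral_multc) (simp_all add: mult.commute)
    also have "\<dots> = (\<integral>\<^sup>+x. \<integral>\<^sup>+\<xi>. unit_ball (x :: real ^ 'm ^ ('k + 'l)) * g (rel_gram (gram x) (gram (transpose \<xi> ** x))) \<partial>\<mu> \<partial>lborel)"
    proof (rule nn_integral_cong_AE)
      show "AE x in lborel. unit_ball (x :: real ^ 'm ^ ('k + 'l)) * b g
        = (\<integral>\<^sup>+\<xi>. unit_ball x * g (rel_gram (gram x) (gram (transpose \<xi> ** x))) \<partial>\<mu>)"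
        using AE_posdef_gram[OF cardn]
      proof eventually_elim
        case (elim x)
        have 1: "gram (x ** inv_root (gram x)) = mat 1"
          using inv_root[OF elim] by (simp add: gram_mult)
        have 2: "rel_gram (gram x) (gram (transpose \<xi> ** x)) = gram (transpose \<xi> ** (x ** inv_root (gram x)))" for \<xi>
          by (simp add: rel_gram_def matrix_transpose_mul matrix_mul_assoc)
        have "(\<integral>\<^sup>+\<xi>. unit_ball x * g (rel_gram (gram x) (gram (transpose \<xi> ** x))) \<partial>\<mu>)
          = unit_ball x * (\<integral>\<^sup>+\<xi>. g (rel_gram (gram x) (gram (transpose \<xi> ** x))) \<partial>\<mu>)"
          by (rule nn_integral_cmult) measurable
        also have "\<dots> = unit_ball x * b g" unfolding 2 inv[OF 1] ..
        finally show ?case by simp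
      qed
    qed
    also have "\<dots> = (\<integral>\<^sup>+\<xi>. \<integral>\<^sup>+x. unit_ball (x :: real ^ 'm ^ ('k + 'l)) * g (rel_gram (gram x) (gram (transpose \<xi> ** x))) \<partial>lborel \<partial>\<mu>)"
      by (rule nn_integral_swap_mu[symmetric]) measurable
    also have "\<dots> = (\<integral>\<^sup>+\<xi>. C' * A g \<partial>\<mu>)"
    proof (rule nn_integral_cong)
      fix \<xi> assume "\<xi> \<in> space \<mu>"
      then have \<xi>: "gram \<xi> = mat 1" by (simp add: space_mu stiefel_def)
      obtain u where u: "orthogonal_matrix u" "u ** stack 0 (mat 1) = \<xi>"
        using gram_frame \<xi> by (rule orthogonal_matrix_transitive)
      have uu: "transpose u ** u = mat 1" using u(1) by (simp add: orthogonal_matrix)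
      have \<xi>u: "transpose \<xi> ** (u ** stack \<omega> t) = t" for \<omega> :: "real ^ 'm ^ 'k" and t
      proof -
        have "transpose \<xi> ** (u ** stack \<omega> t) = transpose (stack 0 (mat 1)) ** (transpose u ** u) ** stack \<omega> t"
          by (simp only: u(2)[symmetric] matrix_transpose_mul matrix_mul_assoc)
        then show ?thesis by (simp add: uu frame_transpose_stack)
      qed
      have "(\<integral>\<^sup>+x. unit_ball (x :: real ^ 'm ^ ('k + 'l)) * g (rel_gram (gram x) (gram (transpose \<xi> ** x))) \<partial>lborel)
        = (\<integral>\<^sup>+x. unit_ball (u ** x :: real ^ 'm ^ ('k + 'l)) * g (rel_gram (gram (u ** x)) (gram (transpose \<xi> ** (u ** x)))) \<partial>lborel)"
        by (rule nn_integral_orthogonal_left[OF u(1), symmetric]) measurable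
      also have "\<dots> = (\<integral>\<^sup>+\<omega>. \<integral>\<^sup>+t. unit_ball (u ** stack \<omega> t :: real ^ 'm ^ ('k + 'l))
          * g (rel_gram (gram (u ** stack \<omega> t)) (gram (transpose \<xi> ** (u ** stack \<omega> t)))) \<partial>lborel \<partial>lborel)"
        by (rule nn_integral_stack) measurable
      also have "\<dots> = (\<integral>\<^sup>+\<omega>. \<integral>\<^sup>+t. of_bool (trace (gram (\<omega> :: real ^ 'm ^ 'k) + gram t) \<le> 1)
          * g (rel_gram (gram \<omega> + gram t) (gram (t :: real ^ 'm ^ 'l))) \<partial>lborel \<partial>lborel)"
        by (simp only: unit_ball_eq_trace gram_orthogonal_left[OF u(1)] \<xi>u gram_stack)
      also have "\<dots> = (\<integral>\<^sup>+\<omega>. C * (\<integral>\<^sup>+h. of_bool (trace (gram (\<omega> :: real ^ 'm ^ 'k) + gram h) \<le> 1)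
          * g (rel_gram (gram \<omega> + gram h) (gram h)) * ennreal (\<bar>det h\<bar> ^ (CARD('l) - CARD('m))) \<partial>lborel) \<partial>lborel)"
        by (intro nn_integral_cong C) measurable
      also have "\<dots> = C * (\<integral>\<^sup>+\<omega>. \<integral>\<^sup>+h. of_bool (trace (gram (\<omega> :: real ^ 'm ^ 'k) + gram h) \<le> 1)
          * g (rel_gram (gram \<omega> + gram h) (gram h)) * ennreal (\<bar>det h\<bar> ^ (CARD('l) - CARD('m))) \<partial>lborel \<partial>lborel)"
        by (rule nn_integral_cmult) measurable
      also have "\<dots> = C' * A g"
      proof -
        \<comment> \<open>With \<open>p = l - m\<close> the exponent \<open>k + p + m\<close> is
          \<open>n\<close>; the truncated subtraction is exact by \<open>ml\<close>.\<close>
        have "real (CARD('k) + (CARD('l) - CARD('m)) + CARD('m)) = real (CARD('k) + CARD('l))" using ml by simp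
        then show ?thesis
          unfolding rel_gram_law[OF that] C'_def A_def chart_weight_def by (simp add: mult.assoc)
      qed
      finally show "(\<integral>\<^sup>+x. unit_ball (x :: real ^ 'm ^ ('k + 'l)) * g (rel_gram (gram x) (gram (transpose \<xi> ** x))) \<partial>lborel) = C' * A g" .
    qed
    also have "\<dots> = ennreal \<sigma> * (C' * A g)" by (simp add: emeasure_mu mult.commute)
    finally show ?thesis .
  qed
  have \<beta>: "\<beta> \<noteq> 0" "\<beta> \<noteq> top"
    using nn_integral_unit_ball[where 'a="real ^ 'm ^ ('k + 'l)"] by (auto simp: \<beta>_def)
  have s0: "ennreal \<sigma> \<noteq> 0" using sigma_pos by simp
  \<comment> \<open>The constant function 1 determines \<open>\<beta>\<close> in terms of
    \<open>C'\<close>. This shows that \<open>C'\<close> can be cancelled and eliminates both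
    unknown constants.\<close>
  have "b (\<lambda>_. 1) = ennreal \<sigma>" by (simp add: b_def emeasure_mu)
  then have "ennreal \<sigma> * \<beta> = ennreal \<sigma> * (C' * A (\<lambda>_. 1))" using key[of "\<lambda>_. 1"] by simp
  then have \<beta>': "\<beta> = C' * A (\<lambda>_. 1)" using s0 by (simp add: ennreal_mult_cancel_left)
  then have "C' \<noteq> 0" "C' \<noteq> top" using \<beta> by (auto simp: ennreal_top_mult split: if_splits)
  have "C' * (b g * A (\<lambda>_. 1)) = C' * (ennreal \<sigma> * A g)"
    using key[of g] by (simp add: \<beta>' mult_ac)
  then have "b g * A (\<lambda>_. 1) = ennreal \<sigma> * A g"
    using \<open>C' \<noteq> 0\<close> \<open>C' \<noteq> top\<close> by (simp add: ennreal_mult_cancel_left)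
  then show ?thesis by (simp add: b_def A_def)
qed

text \<open>The inverse \<open>b\<close> of \<open>c\<close> makes \<open>x ** b\<close> a frame;
  conjugating the test function by \<open>c\<close> undoes this. Any \<open>c\<close> with the Gram
  matrix of \<open>x\<close> may serve.\<close>

lemma gram_law:
  fixes x :: "real ^ 'm ^ ('k + 'l)" and c :: "real ^ 'm ^ 'm" and g :: "real ^ 'm ^ 'm \<Rightarrow> ennreal"
  assumes ml: "CARD('m) \<le> CARD('l)" and c: "gram x = gram c" "det c \<noteq> 0" and [measurable]: "g \<in> borel_measurable borel"
  shows "(\<integral>\<^sup>+\<xi>. g (gram (transpose \<xi> ** x)) \<partial>\<mu>) * (\<integral>\<^sup>+\<tau>. chart_weight (CARD('k) + CARD('l)) (\<tau> :: real ^ 'm ^ 'k) \<partial>lborel)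
    = ennreal \<sigma> * (\<integral>\<^sup>+\<tau>. chart_weight (CARD('k) + CARD('l)) (\<tau> :: real ^ 'm ^ 'k)
        * g (transpose c ** inv_gram \<tau> ** c) \<partial>lborel)"
proof -
  obtain b where b: "c ** b = mat 1" "b ** c = mat 1" using c(2) by (rule matrix_inverse_obtain)
  have "gram (x ** b) = transpose b ** gram c ** b" by (simp only: gram_mult c(1))
  also have "\<dots> = gram (c ** b)" by (simp only: gram_mult)
  finally have v: "gram (x ** b) = mat 1" by (simp add: b transpose_mat)
  have eq: "gram (transpose \<xi> ** x) = transpose c ** gram (transpose \<xi> ** (x ** b)) ** c" for \<xi>
  proof -
    have "transpose \<xi> ** (x ** b) ** c = transpose \<xi> ** (x ** (b ** c))"
      by (simp only: matrix_mul_assoc)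
    then have "transpose \<xi> ** x = transpose \<xi> ** (x ** b) ** c" by (simp add: b)
    then show ?thesis by (simp only: gram_mult[of "transpose \<xi> ** (x ** b)" c])
  qed
  have "(\<lambda>u. g (transpose c ** u ** c)) \<in> borel_measurable borel" by measurable
  from gram_law_frame[OF ml v this] show ?thesis unfolding eq .
qed

end


subsection \<open>The constants\<close>

lemma borel_measurable_complex_of_real [measurable (raw)]:
  assumes "f \<in> borel_measurable M"
  shows "(\<lambda>x. complex_of_real (f x)) \<in> borel_measurable M"
  using assms by (rule measurable_compose) (intro borel_measurable_continuous_onI continuous_intros)

text \<open>The branch cut along the negative reals rules out a continuity argument, but on the real
  line the power is given by one elementary formula on each half-line and is 0 at 0.\<close>

lemma borel_measurable_of_real_powr [measurable (raw)]:
  fixes z :: complex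
  assumes f: "f \<in> borel_measurable M"
  shows "(\<lambda>x. complex_of_real (f x) powr z) \<in> borel_measurable M"
proof -
  have "complex_of_real t powr z = (if t = 0 then 0 else if 0 < t then exp (z * of_real (ln t))
      else exp (z * (of_real (ln (- t)) + \<i> * of_real pi)))" for t
    using Ln_minus[of "complex_of_real (- t)"] Ln_of_real[of "- t"] by (auto simp: powr_def Ln_of_real)
  then have "(\<lambda>t. complex_of_real t powr z) = (\<lambda>t. if t = 0 then 0 else if 0 < t then exp (z * of_real (ln t))
      else exp (z * (of_real (ln (- t)) + \<i> * of_real pi)))" by (rule ext)
  moreover have "\<dots> \<in> borel_measurable borel" by measurable
  ultimately have "(\<lambda>t. complex_of_real t powr z) \<in> borel_measurable borel" by simp
  with f show ?thesis by (rule measurable_compose)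
qed

text \<open>An identity for all nonnegative Borel functions is an equality of image measures. It
  therefore passes to every Bochner integral, and if one side defaults to 0 for lack of
  integrability then so does the other.\<close>

lemma integral_transfer:
  fixes f :: "'c::second_countable_topology \<Rightarrow> complex" and w :: "'b \<Rightarrow> real"
  assumes T: "T \<in> borel_measurable M" and S: "S \<in> borel_measurable N"
    and w: "w \<in> borel_measurable N" "\<And>y. 0 \<le> w y"
    and eq: "\<And>f. f \<in> borel_measurable borel \<Longrightarrow>
      (\<integral>\<^sup>+x. f (T x) \<partial>M) = (\<integral>\<^sup>+y. ennreal (w y) * f (S y) \<partial>N)"
    and f: "f \<in> borel_measurable borel"
  shows "(LINT x|M. f (T x)) = (LINT y|N. complex_of_real (w y) * f (S y))"
proof -
  have "distr M borel T = distr (density N w) borel S"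
  proof (rule measure_eqI)
    fix A assume "A \<in> sets (distr M borel T)"
    then have A [measurable]: "A \<in> sets borel" by simp
    have "emeasure (distr M borel T) A = (\<integral>\<^sup>+x. indicator A (T x) \<partial>M)"
      using nn_integral_distr[of T M borel "indicator A"] T by simp
    also have "\<dots> = (\<integral>\<^sup>+y. ennreal (w y) * indicator A (S y) \<partial>N)"
      by (rule eq) simp
    also have "\<dots> = (\<integral>\<^sup>+y. indicator A (S y) \<partial>density N w)"
      using w(1) S by (subst nn_integral_density) simp_all
    also have "\<dots> = emeasure (distr (density N w) borel S) A"
      using nn_integral_distr[of S "density N w" borel "indicator A"] S by simp
    finally show "emeasure (distr M borel T) A = emeasure (distr (density N w) borel S) A" .
  qed simp
  then have "(LINT x|distr M borel T. f x) = (LINT x|distr (density N w) borel S. f x)" by simp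
  then show ?thesis
    using T S w f by (simp add: integral_distr integral_density scaleR_conv_of_real)
qed

section \<open>Gaussian and Gamma integrals\<close>

definition gauss_mass :: "'a::euclidean_space itself \<Rightarrow> real" where
  "gauss_mass _ = enn2real (\<integral>\<^sup>+x. ennreal (exp (- (norm (x :: 'a))\<^sup>2)) \<partial>lborel)"

lemma nn_integral_gauss:
  "(\<integral>\<^sup>+x. ennreal (exp (- (norm (x :: 'a::euclidean_space))\<^sup>2)) \<partial>lborel) = ennreal (gauss_mass TYPE('a))"
  and gauss_mass_pos: "0 < gauss_mass TYPE('a::euclidean_space)"
proof -
  let ?I = "\<integral>\<^sup>+x. ennreal (exp (- (norm (x :: 'a))\<^sup>2)) \<partial>lborel"
  have "(norm x)\<^sup>2 = (\<Sum>b\<in>Basis. (x \<bullet> b)\<^sup>2)" for x :: 'a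
    unfolding power2_norm_eq_inner euclidean_inner[of x x] by (simp add: power2_eq_square)
  then have "ennreal (exp (- (norm x)\<^sup>2)) = (\<Prod>b\<in>Basis. ennreal (exp (- (x \<bullet> b)\<^sup>2)))" for x :: 'a
    by (simp add: sum_negf[symmetric] exp_sum prod_ennreal)
  then have "?I = (\<Prod>b\<in>(Basis :: 'a set). \<integral>\<^sup>+u. ennreal (exp (- u\<^sup>2)) \<partial>lborel)"
    using nn_integral_lborel_prod[of "\<lambda>(_::'a) u. ennreal (exp (- u\<^sup>2))"] by simp
  moreover have "(\<integral>\<^sup>+u. ennreal (exp (- u\<^sup>2)) \<partial>lborel) < top"
  proof -
    have i0: "integrable lborel (\<lambda>x::real. indicator {0..} x *\<^sub>R exp (- x\<^sup>2))"
      using gaussian_moment_0 unfolding has_bochner_integral_iff by (rule conjunct1)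
    have i1: "integrable lborel (\<lambda>x::real. indicator {0..} (0 + (-1) * x) *\<^sub>R exp (- (0 + (-1) * x)\<^sup>2))"
      by (rule lborel_integrable_real_affine[OF i0]) simp
    have "integrable lborel (\<lambda>x::real. exp (- x\<^sup>2))"
      by (rule Bochner_Integration.integrable_bound[OF Bochner_Integration.integrable_add[OF i0 i1]])
        (auto simp: indicator_def)
    then have "(\<integral>\<^sup>+u. ennreal (norm (exp (- u\<^sup>2 :: real))) \<partial>lborel) < top"
      by (simp only: integrable_iff_bounded infinity_ennreal_def)
    then show ?thesis by simp
  qed
  ultimately have fin: "?I < top"
    by (simp add: less_top[symmetric] ennreal_prod_eq_top power_eq_top_ennreal)
  have "0 < ennreal (exp (- 1)) * (\<integral>\<^sup>+x. unit_ball (x :: 'a) \<partial>lborel)"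
    using nn_integral_unit_ball(1)[where 'a='a] by (simp add: ennreal_zero_less_mult_iff)
  also have "\<dots> = (\<integral>\<^sup>+x. ennreal (exp (- 1)) * unit_ball (x :: 'a) \<partial>lborel)"
    by (rule nn_integral_cmult[symmetric]) measurable
  also have "\<dots> \<le> ?I"
    by (intro nn_integral_mono) (auto simp: unit_ball_def abs_square_le_1 intro!: ennreal_leI)
  finally have "0 < ?I" .
  then show "0 < gauss_mass TYPE('a)" using fin by (simp add: gauss_mass_def enn2real_positive_iff)
  show "?I = ennreal (gauss_mass TYPE('a))"
    using fin by (simp add: gauss_mass_def)
qed

lemma nn_integral_gauss_scaled:
  assumes "0 < u"
  shows "(\<integral>\<^sup>+x. ennreal (exp (- u * (norm (x :: 'a::euclidean_space))\<^sup>2)) \<partial>lborel)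
    = ennreal (gauss_mass TYPE('a) * u powr (- real DIM('a) / 2))"
proof -
  define s where "s = sqrt u"
  have s: "0 < s" "s\<^sup>2 = u" using assms by (simp_all add: s_def)
  have "lborel = density (distr lborel borel (\<lambda>x :: 'a. 0 + s *\<^sub>R x)) (\<lambda>_. ennreal (\<bar>s\<bar> ^ DIM('a)))"
    using lborel_affine[of s "0::'a"] s(1) by simp
  then have "(\<integral>\<^sup>+x. ennreal (exp (- (norm (x :: 'a))\<^sup>2)) \<partial>lborel)
    = (\<integral>\<^sup>+x. ennreal (exp (- (norm (x :: 'a))\<^sup>2)) \<partial>density (distr lborel borel (\<lambda>x :: 'a. 0 + s *\<^sub>R x)) (\<lambda>_. ennreal (\<bar>s\<bar> ^ DIM('a))))"
    by simp
  also have "\<dots> = ennreal (s ^ DIM('a)) * (\<integral>\<^sup>+x. ennreal (exp (- u * (norm (x :: 'a))\<^sup>2)) \<partial>lborel)"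
    using s by (simp add: nn_integral_density nn_integral_distr nn_integral_cmult power_mult_distrib)
  finally have *: "ennreal (gauss_mass TYPE('a)) = ennreal (s ^ DIM('a)) * (\<integral>\<^sup>+x. ennreal (exp (- u * (norm (x :: 'a))\<^sup>2)) \<partial>lborel)"
    by (simp only: nn_integral_gauss)
  have "s = u powr (1/2)" using assms by (simp add: s_def powr_half_sqrt)
  then have "s ^ DIM('a) = u powr (real DIM('a) / 2)" using assms by (simp add: powr_power)
  then have inv: "u powr (- real DIM('a) / 2) * s ^ DIM('a) = 1"
    using assms by (simp add: powr_add[symmetric])
  have "ennreal (gauss_mass TYPE('a) * u powr (- real DIM('a) / 2)) = ennreal (u powr (- real DIM('a) / 2)) * ennreal (gauss_mass TYPE('a))"
    by (simp add: ennreal_mult'' mult.commute)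
  also have "\<dots> = ennreal (u powr (- real DIM('a) / 2) * s ^ DIM('a)) * (\<integral>\<^sup>+x. ennreal (exp (- u * (norm (x :: 'a))\<^sup>2)) \<partial>lborel)"
    unfolding * by (simp add: ennreal_mult' mult.assoc)
  finally show ?thesis unfolding inv by simp
qed

lemma nn_integral_Gamma_scaled:
  assumes "0 < a" "0 < s"
  shows "(\<integral>\<^sup>+t. ennreal (indicator {0<..} t * (t powr (a - 1) * exp (- s * t))) \<partial>lborel) = ennreal (Gamma a * s powr (- a))"
proof -
  have "ennreal (Gamma a) = (\<integral>\<^sup>+t. ennreal (indicator {0..} t * t powr (a - 1) / exp t) \<partial>lborel)"
    by (rule Gamma_conv_nn_integral_real[OF assms(1)])
  also have "\<dots> = (\<integral>\<^sup>+t. ennreal (indicator {0<..} t * (t powr (a - 1) * exp (- t))) \<partial>lborel)"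
    by (intro nn_integral_cong) (auto simp: indicator_def exp_minus field_simps)
  also have "\<dots> = ennreal s * (\<integral>\<^sup>+t. ennreal (indicator {0<..} (s * t) * ((s * t) powr (a - 1) * exp (- (s * t)))) \<partial>lborel)"
    using assms(2) by (subst nn_integral_real_affine[where c=s and t=0]) simp_all
  also have "\<dots> = ennreal s * (\<integral>\<^sup>+t. ennreal (s powr (a - 1)) * ennreal (indicator {0<..} t * (t powr (a - 1) * exp (- s * t))) \<partial>lborel)"
    using assms(2) by (intro arg_cong[where f="(*) _"] nn_integral_cong)
      (auto simp: indicator_def powr_mult zero_less_mult_iff ennreal_mult'[symmetric] mult_ac)
  also have "\<dots> = ennreal (s * s powr (a - 1)) * (\<integral>\<^sup>+t. ennreal (indicator {0<..} t * (t powr (a - 1) * exp (- s * t))) \<partial>lborel)"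
    using assms(2) by (simp add: nn_integral_cmult ennreal_mult' mult.assoc)
  also have "s * s powr (a - 1) = s powr a"
    using assms(2) by (simp add: powr_mult_base)
  finally have *: "ennreal (Gamma a) = ennreal (s powr a) * (\<integral>\<^sup>+t. ennreal (indicator {0<..} t * (t powr (a - 1) * exp (- s * t))) \<partial>lborel)" .
  have "ennreal (Gamma a * s powr (- a)) = ennreal (s powr (- a)) * ennreal (Gamma a)"
    by (simp add: ennreal_mult'' mult.commute)
  also have "\<dots> = ennreal (s powr (- a) * s powr a) * (\<integral>\<^sup>+t. ennreal (indicator {0<..} t * (t powr (a - 1) * exp (- s * t))) \<partial>lborel)"
    unfolding * by (simp add: ennreal_mult' mult.assoc)
  finally show ?thesis using assms(2) by (simp add: powr_add[symmetric])
qed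

lemma norm_powr_of_real_nonneg: "norm (complex_of_real t powr z) = t powr Re z" if "0 \<le> t"
  using that by (cases "t = 0") (simp_all add: norm_powr_real_powr)

lemma integral_Gamma_scaled:
  assumes z: "0 < Re z" and s: "0 < s"
  shows "(LINT t|lborel. indicator {0<..} t *\<^sub>R (complex_of_real t powr (z - 1) * of_real (exp (- s * t))))
    = Gamma z * complex_of_real s powr (- z)"
proof -
  have meas: "set_borel_measurable lborel {0<..} (\<lambda>t. complex_of_real t powr (z - 1) / of_real (exp t))"
    unfolding set_borel_measurable_def by measurable
  have "(LINT t:{0<..}|lborel. complex_of_real t powr (z - 1) / of_real (exp t)) = integral {0<..} (\<lambda>t. complex_of_real t powr (z - 1) / of_real (exp t))"
  proof (rule set_borel_integral_eq_integral(2))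
    have "(\<lambda>t. complex_of_real t powr (z - 1) / of_real (exp t)) absolutely_integrable_on {0<..}"
      by (rule absolutely_integrable_Gamma_integral'[OF z])
    then show "set_integrable lborel {0<..} (\<lambda>t. complex_of_real t powr (z - 1) / of_real (exp t))"
      using meas unfolding set_integrable_def set_borel_measurable_def by (simp add: integrable_completion)
  qed
  also have "\<dots> = Gamma z"
    by (rule integral_unique[OF Gamma_integral_complex'[OF z]])
  finally have G: "(LINT t|lborel. indicator {0<..} t *\<^sub>R (complex_of_real t powr (z - 1) / of_real (exp t))) = Gamma z"
    by (simp add: set_lebesgue_integral_def)
  have "Gamma z = s *\<^sub>R (LINT t|lborel. indicator {0<..} (0 + s * t) *\<^sub>R (complex_of_real (0 + s * t) powr (z - 1) / of_real (exp (0 + s * t))))"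
    unfolding G[symmetric] using s by (subst lborel_integral_real_affine[where c=s and t=0]) simp_all
  also have "(LINT t|lborel. indicator {0<..} (0 + s * t) *\<^sub>R (complex_of_real (0 + s * t) powr (z - 1) / of_real (exp (0 + s * t))))
    = (LINT t|lborel. complex_of_real s powr (z - 1) * (indicator {0<..} t *\<^sub>R (complex_of_real t powr (z - 1) * of_real (exp (- s * t)))))"
    using s by (intro Bochner_Integration.integral_cong refl)
      (auto simp: indicator_def zero_less_mult_iff powr_times_real exp_minus field_simps)
  also have "\<dots> = complex_of_real s powr (z - 1) * (LINT t|lborel. indicator {0<..} t *\<^sub>R (complex_of_real t powr (z - 1) * of_real (exp (- s * t))))"
    by (rule integral_mult_right_zero)
  also have "s *\<^sub>R (complex_of_real s powr (z - 1) * (LINT t|lborel. indicator {0<..} t *\<^sub>R (complex_of_real t powr (z - 1) * of_real (exp (- s * t)))))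
    = complex_of_real s powr z * (LINT t|lborel. indicator {0<..} t *\<^sub>R (complex_of_real t powr (z - 1) * of_real (exp (- s * t))))"
    using s by (simp add: scaleR_conv_of_real powr_diff)
  finally show ?thesis using s by (simp add: powr_minus field_simps)
qed

text \<open>Write \<open>(1 + (norm y)\<^sup>2) powr - z\<close> as a Gamma integral and integrate over \<open>y\<close> first.\<close>

lemma integral_one_add_norm:
  fixes z :: complex
  defines "D \<equiv> real DIM('a::euclidean_space)"
  assumes z: "D / 2 < Re z"
  shows "(LINT y|lborel. complex_of_real (1 + (norm (y :: 'a))\<^sup>2) powr (- z))
      = of_real (gauss_mass TYPE('a)) * Gamma (z - of_real D / 2) / Gamma z"
    and "(\<integral>\<^sup>+y. ennreal ((1 + (norm (y :: 'a))\<^sup>2) powr (- Re z)) \<partial>lborel)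
      = ennreal (gauss_mass TYPE('a) * Gamma (Re z - D / 2) / Gamma (Re z))"
proof -
  have D: "0 < D" by (simp add: D_def)
  have z0: "0 < Re z" "0 < Re (z - of_real D / 2)" using z D by auto
  define F where "F y u = indicator {0<..} u *\<^sub>R (complex_of_real u powr (z - 1) * of_real (exp (- (1 + (norm (y :: 'a))\<^sup>2) * u)))" for y u
  have [measurable]: "(\<lambda>p. F (fst p) (snd p)) \<in> borel_measurable (lborel \<Otimes>\<^sub>M lborel)"
    unfolding F_def by measurable
  have pos: "0 < 1 + (norm y)\<^sup>2" for y :: 'a by (rule add_pos_nonneg) auto
  have nF: "ennreal (norm (F y u)) = ennreal (indicator {0<..} u * (u powr (Re z - 1) * exp (- (1 + (norm y)\<^sup>2) * u)))" for y u
    by (auto simp: F_def indicator_def norm_mult norm_powr_of_real_nonneg)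
  have nu: "(\<integral>\<^sup>+u. ennreal (norm (F y u)) \<partial>lborel) = ennreal (Gamma (Re z)) * ennreal ((1 + (norm y)\<^sup>2) powr (- Re z))" for y
    unfolding nF using nn_integral_Gamma_scaled[OF z0(1) pos[of y]] Gamma_real_pos[OF z0(1)] by (simp add: ennreal_mult')
  have ny: "(\<integral>\<^sup>+y. ennreal (norm (F y u)) \<partial>lborel)
    = ennreal (gauss_mass TYPE('a)) * ennreal (indicator {0<..} u * (u powr ((Re z - D / 2) - 1) * exp (- 1 * u)))" for u
  proof (cases "0 < u")
    case True
    have "(\<integral>\<^sup>+y. ennreal (norm (F y u)) \<partial>lborel) = (\<integral>\<^sup>+y. ennreal (u powr (Re z - 1) * exp (- u)) * ennreal (exp (- u * (norm (y :: 'a))\<^sup>2)) \<partial>lborel)"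
      unfolding nF using True by (intro nn_integral_cong) (simp add: ennreal_mult'[symmetric] exp_add[symmetric] algebra_simps)
    also have "\<dots> = ennreal (u powr (Re z - 1) * exp (- u)) * ennreal (gauss_mass TYPE('a) * u powr (- D / 2))"
      by (subst nn_integral_cmult) (simp_all add: nn_integral_gauss_scaled[OF True, simplified] D_def)
    also have "\<dots> = ennreal (gauss_mass TYPE('a) * ((u powr (Re z - 1) * u powr (- D / 2)) * exp (- u)))"
      using gauss_mass_pos[where 'a='a] by (simp add: ennreal_mult'[symmetric] mult_ac)
    also have "u powr (Re z - 1) * u powr (- D / 2) = u powr ((Re z - D / 2) - 1)"
      by (simp add: powr_add[symmetric] algebra_simps)
    finally show ?thesis using True gauss_mass_pos[where 'a='a] by (simp add: ennreal_mult')
  qed (simp add: nF)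
  have tot: "(\<integral>\<^sup>+y. \<integral>\<^sup>+u. ennreal (norm (F y u)) \<partial>lborel \<partial>lborel) = ennreal (gauss_mass TYPE('a) * Gamma (Re z - D / 2))"
  proof -
    have "(\<integral>\<^sup>+y. \<integral>\<^sup>+u. ennreal (norm (F y u)) \<partial>lborel \<partial>lborel) = (\<integral>\<^sup>+u. \<integral>\<^sup>+y. ennreal (norm (F y u)) \<partial>lborel \<partial>lborel)"
      by (intro nn_integral_lborel_swap) (unfold F_def case_prod_unfold, measurable)
    also have "\<dots> = ennreal (gauss_mass TYPE('a)) *
        (\<integral>\<^sup>+u. ennreal (indicator {0<..} u * (u powr ((Re z - D / 2) - 1) * exp (- 1 * u))) \<partial>lborel)"
      unfolding ny by (rule nn_integral_cmult) measurable
    also have "(\<integral>\<^sup>+u. ennreal (indicator {0<..} u * (u powr ((Re z - D / 2) - 1) * exp (- 1 * u))) \<partial>lborel)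
        = ennreal (Gamma (Re z - D / 2) * 1 powr (- (Re z - D / 2)))"
      by (rule nn_integral_Gamma_scaled) (use z0(2) in simp_all)
    finally show ?thesis using gauss_mass_pos[where 'a='a] by (simp add: ennreal_mult')
  qed
  have "ennreal (Gamma (Re z)) * (\<integral>\<^sup>+y. ennreal ((1 + (norm (y :: 'a))\<^sup>2) powr (- Re z)) \<partial>lborel) = ennreal (gauss_mass TYPE('a) * Gamma (Re z - D / 2))"
    unfolding tot[symmetric] nu by (rule nn_integral_cmult[symmetric]) measurable
  moreover have g0: "0 < Gamma (Re z)" by (rule Gamma_real_pos[OF z0(1)])
  ultimately have "ennreal (1 / Gamma (Re z)) * (ennreal (Gamma (Re z)) * (\<integral>\<^sup>+y. ennreal ((1 + (norm (y :: 'a))\<^sup>2) powr (- Re z)) \<partial>lborel))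
    = ennreal (1 / Gamma (Re z)) * ennreal (gauss_mass TYPE('a) * Gamma (Re z - D / 2))" by simp
  then show "(\<integral>\<^sup>+y. ennreal ((1 + (norm (y :: 'a))\<^sup>2) powr (- Re z)) \<partial>lborel)
      = ennreal (gauss_mass TYPE('a) * Gamma (Re z - D / 2) / Gamma (Re z))"
    using g0 by (simp add: mult.assoc[symmetric] ennreal_mult'[symmetric])
  have int: "integrable (lborel \<Otimes>\<^sub>M lborel) (case_prod F)"
  proof (rule integrableI_bounded)
    show "case_prod F \<in> borel_measurable (lborel \<Otimes>\<^sub>M lborel)" by (simp add: case_prod_unfold)
    show "(\<integral>\<^sup>+p. ennreal (norm (case_prod F p)) \<partial>(lborel \<Otimes>\<^sub>M lborel)) < \<infinity>"
      by (subst lborel.nn_integral_fst[symmetric]) (simp_all add: tot)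
  qed
  have cu: "(LINT u|lborel. F y u) = Gamma z * complex_of_real (1 + (norm y)\<^sup>2) powr (- z)" for y
    unfolding F_def by (rule integral_Gamma_scaled[OF z0(1) pos])
  have cy: "(LINT y|lborel. F y u) = of_real (gauss_mass TYPE('a)) *
      (indicator {0<..} u *\<^sub>R (complex_of_real u powr ((z - of_real D / 2) - 1) * of_real (exp (- 1 * u))))" for u
  proof (cases "0 < u")
    case True
    have "F y u = (complex_of_real u powr (z - 1) * of_real (exp (- u))) * of_real (exp (- u * (norm y)\<^sup>2))" for y
      using True by (simp add: F_def of_real_mult[symmetric] mult.assoc exp_add[symmetric] algebra_simps del: of_real_mult)
    then have "(LINT y|lborel. F y u) = (complex_of_real u powr (z - 1) * of_real (exp (- u))) * of_real (LINT y|lborel. exp (- u * (norm (y :: 'a))\<^sup>2))"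
      by simp
    also have "(LINT y|lborel. exp (- u * (norm (y :: 'a))\<^sup>2)) = gauss_mass TYPE('a) * u powr (- D / 2)"
      using gauss_mass_pos[where 'a='a]
      by (subst integral_eq_nn_integral) (simp_all add: nn_integral_gauss_scaled[OF True, simplified] D_def)
    also have "complex_of_real (gauss_mass TYPE('a) * u powr (- D / 2)) = of_real (gauss_mass TYPE('a)) * complex_of_real u powr (- of_real D / 2)"
      using True by (simp add: powr_of_real[symmetric])
    finally have "(LINT y|lborel. F y u) = of_real (gauss_mass TYPE('a)) *
        ((complex_of_real u powr (z - 1) * complex_of_real u powr (- of_real D / 2)) * of_real (exp (- u)))"
      by (simp only: mult_ac)
    also have "complex_of_real u powr (z - 1) * complex_of_real u powr (- of_real D / 2)
        = complex_of_real u powr ((z - of_real D / 2) - 1)"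
      unfolding powr_add[symmetric] by (rule arg_cong[where f="\<lambda>w. _ powr w"]) simp
    finally show ?thesis using True by simp
  qed (simp add: F_def)
  have "Gamma z * (LINT y|lborel. complex_of_real (1 + (norm (y :: 'a))\<^sup>2) powr (- z)) = (LINT y|lborel. LINT u|lborel. F y u)"
    unfolding cu by simp
  also have "\<dots> = (LINT u|lborel. LINT y|lborel. F y u)"
    by (rule lborel_pair.Fubini_integral[OF int, symmetric])
  also have "\<dots> = of_real (gauss_mass TYPE('a)) * (Gamma (z - of_real D / 2) * complex_of_real 1 powr (- (z - of_real D / 2)))"
    unfolding cy integral_mult_right_zero using integral_Gamma_scaled[OF z0(2) zero_less_one] by simp
  finally show "(LINT y|lborel. complex_of_real (1 + (norm (y :: 'a))\<^sup>2) powr (- z))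
      = of_real (gauss_mass TYPE('a)) * Gamma (z - of_real D / 2) / Gamma z"
    using Gamma_eq_zero_iff[of z] z0(1) by (auto simp: field_simps elim!: nonpos_Ints_cases)
qed


section \<open>Integration over k x m matrices, one row at a time\<close>

lemma gram_single_row: "gram y = outer (y $ 1)" for y :: "real ^ 'm ^ 1"
  by (simp add: vec_eq_iff matrix_matrix_mult_def transpose_def outer_def)

lemma norm_single_row: "norm y = norm (y $ 1)" for y :: "real ^ 'm ^ 1"
  by (simp add: norm_vec_def L2_set_def sum_nonneg)

lemma det_one_add_gram_row: "det (mat 1 + gram y) = 1 + (norm y)\<^sup>2" for y :: "real ^ 'm ^ 1"
  unfolding gram_single_row norm_single_row outer_def by (rule det_one_add_outer)

text \<open>The integral of (1 + |y|^2)^(-a/2) over one row y of length m, as given by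
  \<open>integral_one_add_norm\<close>.\<close>

definition row_const :: "'m::finite itself \<Rightarrow> complex \<Rightarrow> complex" where
  "row_const _ a = of_real (gauss_mass TYPE(real ^ 'm ^ 1)) * Gamma ((a - of_nat CARD('m)) / 2) / Gamma (a / 2)"

text \<open>The counterpart for absolute values, where a nonnegative integral needs a real constant;
  the two agree at real arguments.\<close>

definition row_const_real :: "'m::finite itself \<Rightarrow> real \<Rightarrow> real" where
  "row_const_real _ a = gauss_mass TYPE(real ^ 'm ^ 1) * Gamma ((a - real CARD('m)) / 2) / Gamma (a / 2)"

lemma row_const_real_pos: "real CARD('m::finite) < a \<Longrightarrow> 0 < row_const_real TYPE('m) a"
  unfolding row_const_real_def
  by (intro divide_pos_pos mult_pos_pos gauss_mass_pos Gamma_real_pos) auto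

text \<open>For posdef \<open>A = gram c\<close> one has \<open>A + gram (y ** c) = transpose c ** (mat 1 + gram y) ** c\<close>.\<close>

lemma row_integral:
  fixes A :: "real ^ 'm ^ 'm" and z :: complex
  assumes A: "posdef A" and z: "real CARD('m) < Re z"
  shows "(\<integral>\<^sup>+y. ennreal (det (A + gram (y :: real ^ 'm ^ 1)) powr (- Re z / 2)) \<partial>lborel)
      = ennreal (row_const_real TYPE('m) (Re z) * det A powr (- (Re z - 1) / 2))"
    and "(LINT y|lborel. complex_of_real (det (A + gram (y :: real ^ 'm ^ 1))) powr (- z / 2))
      = row_const TYPE('m) z * complex_of_real (det A) powr (- (z - 1) / 2)"
proof -
  obtain c where c: "A = gram c" "det c \<noteq> 0" using A by (rule posdef_obtain_root)
  have dA: "0 < det A" by (rule posdef_det_pos[OF A])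
  have dc: "\<bar>det c\<bar> = sqrt (det A)" by (simp add: c(1) det_mul real_sqrt_abs2)
  have det: "det (A + gram (y ** c)) = det A * (1 + (norm y)\<^sup>2)" for y :: "real ^ 'm ^ 1"
  proof -
    have "A + gram (y ** c) = transpose c ** (mat 1 + gram y) ** c"
      by (simp add: c(1) gram_mult matrix_add_ldistrib matrix_add_rdistrib)
    then show ?thesis by (simp add: det_mul det_one_add_gram_row c(1))
  qed
  have pos: "0 < 1 + (norm y)\<^sup>2" for y :: "real ^ 'm ^ 1" by (rule add_pos_nonneg) auto
  have z2: "real DIM(real ^ 'm ^ 1) / 2 < Re (z / 2)" using z by simp
  note J = integral_one_add_norm[where 'a="real ^ 'm ^ 1", OF z2]
  have "(\<integral>\<^sup>+y. ennreal (det (A + gram (y :: real ^ 'm ^ 1)) powr (- Re z / 2)) \<partial>lborel)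
    = ennreal (\<bar>det c\<bar> ^ CARD(1)) * (\<integral>\<^sup>+y. ennreal (det (A + gram ((y :: real ^ 'm ^ 1) ** c)) powr (- Re z / 2)) \<partial>lborel)"
    by (rule nn_integral_right_mult[OF c(2)]) measurable
  also have "\<dots> = ennreal (sqrt (det A)) * (\<integral>\<^sup>+y. ennreal (det A powr (- Re z / 2)) * ennreal ((1 + (norm (y :: real ^ 'm ^ 1))\<^sup>2) powr (- Re (z / 2))) \<partial>lborel)"
    unfolding det using dA pos by (simp add: dc powr_mult ennreal_mult less_imp_le)
  also have "\<dots> = ennreal (sqrt (det A)) * (ennreal (det A powr (- Re z / 2)) * (\<integral>\<^sup>+y. ennreal ((1 + (norm (y :: real ^ 'm ^ 1))\<^sup>2) powr (- Re (z / 2))) \<partial>lborel))"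
    by (subst nn_integral_cmult) simp_all
  also have "\<dots> = ennreal (sqrt (det A) * det A powr (- Re z / 2) * row_const_real TYPE('m) (Re z))"
    unfolding J(2) using dA row_const_real_pos[OF z]
    by (simp add: row_const_real_def diff_divide_distrib ennreal_mult'[symmetric] ennreal_mult''[symmetric] mult.assoc)
  also have "sqrt (det A) * det A powr (- Re z / 2) = det A powr (- (Re z - 1) / 2)"
    using dA by (simp add: powr_half_sqrt[symmetric] powr_add[symmetric] field_simps)
  finally show "(\<integral>\<^sup>+y. ennreal (det (A + gram (y :: real ^ 'm ^ 1)) powr (- Re z / 2)) \<partial>lborel)
      = ennreal (row_const_real TYPE('m) (Re z) * det A powr (- (Re z - 1) / 2))" by (simp add: mult.commute)
  have "(LINT y|lborel. complex_of_real (det (A + gram (y :: real ^ 'm ^ 1))) powr (- z / 2))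
    = (LINT y|lborel. complex_of_real \<bar>det c\<bar> * complex_of_real (det (A + gram ((y :: real ^ 'm ^ 1) ** c))) powr (- z / 2))"
  proof (rule integral_transfer[where T="\<lambda>y. y" and S="\<lambda>y. y ** c" and w="\<lambda>_. \<bar>det c\<bar>" and M=lborel and N=lborel
      and f="\<lambda>y. complex_of_real (det (A + gram y)) powr (- z / 2)"])
    fix f :: "real ^ 'm ^ 1 \<Rightarrow> ennreal" assume [measurable]: "f \<in> borel_measurable borel"
    show "(\<integral>\<^sup>+y. f y \<partial>lborel) = (\<integral>\<^sup>+y. ennreal \<bar>det c\<bar> * f (y ** c) \<partial>lborel)"
      using nn_integral_right_mult[OF c(2), of f] by (simp add: nn_integral_cmult)
  qed (simp_all, measurable)
  also have "\<dots> = (LINT y|lborel. (complex_of_real (sqrt (det A)) * complex_of_real (det A) powr (- z / 2)) *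
      complex_of_real (1 + (norm (y :: real ^ 'm ^ 1))\<^sup>2) powr (- (z / 2)))"
    unfolding det dc of_real_mult using dA pos
    by (intro Bochner_Integration.integral_cong refl) (simp add: powr_times_real less_imp_le del: of_real_add)
  also have "\<dots> = (complex_of_real (sqrt (det A)) * complex_of_real (det A) powr (- z / 2)) *
      (LINT y|lborel. complex_of_real (1 + (norm (y :: real ^ 'm ^ 1))\<^sup>2) powr (- (z / 2)))"
    by (rule integral_mult_right_zero)
  also have "(LINT y|lborel. complex_of_real (1 + (norm (y :: real ^ 'm ^ 1))\<^sup>2) powr (- (z / 2))) = row_const TYPE('m) z"
    unfolding J(1) by (simp add: row_const_def diff_divide_distrib)
  also have "complex_of_real (sqrt (det A)) * complex_of_real (det A) powr (- z / 2) = complex_of_real (det A) powr (- (z - 1) / 2)"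
  proof -
    have "complex_of_real (sqrt (det A)) = complex_of_real (det A) powr (1 / 2)"
      using dA powr_of_real[of "det A" "1/2"] by (simp add: powr_half_sqrt)
    then have "complex_of_real (sqrt (det A)) * complex_of_real (det A) powr (- z / 2) = complex_of_real (det A) powr (1 / 2 + - z / 2)"
      by (simp only: powr_add)
    also have "1 / 2 + - z / 2 = - (z - 1) / 2" by (simp add: field_simps)
    finally show ?thesis .
  qed
  finally show "(LINT y|lborel. complex_of_real (det (A + gram (y :: real ^ 'm ^ 1))) powr (- z / 2))
      = row_const TYPE('m) z * complex_of_real (det A) powr (- (z - 1) / 2)" by (simp only: mult.commute)
qed

text \<open>A family of 1 x m matrices over a set of indices instead of one matrix, so that the rows
  can be added by induction on the set.\<close>

definition rows_gram :: "'k set \<Rightarrow> ('k \<Rightarrow> real ^ 'm ^ 1) \<Rightarrow> real ^ 'm ^ 'm" where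
  "rows_gram S \<tau> = mat 1 + (\<Sum>i\<in>S. gram (\<tau> i))"

lemma posdef_rows_gram: "finite S \<Longrightarrow> posdef (rows_gram S \<tau>)"
proof (induction S rule: finite_induct)
  case empty
  then show ?case by (simp add: rows_gram_def posdef_mat_1)
next
  case (insert i S)
  then have "rows_gram (insert i S) \<tau> = rows_gram S \<tau> + gram (\<tau> i)"
    by (simp add: rows_gram_def add_ac)
  then show ?case using insert posdef_add_gram by metis
qed

text \<open>Integrating out one row by \<open>row_integral\<close> lowers the parameter
  \<open>z\<close> by 1, whence the shifts by \<open>i\<close> in the product and the lower bound
  for \<open>Re z\<close>, which makes the last row converge. Both parts share one induction because
  the first gives the integrability that Fubini needs in the second.\<close>

lemma rows_integral:
  fixes z :: complex
  assumes "finite (S :: 'k set)" "real (card S) + real CARD('m::finite) - 1 < Re z"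
  shows "(\<integral>\<^sup>+\<tau>. ennreal (det (rows_gram S \<tau>) powr (- Re z / 2)) \<partial>Pi\<^sub>M S (\<lambda>_. lborel :: (real ^ 'm ^ 1) measure))
      = ennreal (\<Prod>i<card S. row_const_real TYPE('m) (Re z - real i))"
    and "(LINT \<tau>|Pi\<^sub>M S (\<lambda>_. lborel :: (real ^ 'm ^ 1) measure). complex_of_real (det (rows_gram S \<tau>)) powr (- z / 2))
      = (\<Prod>i<card S. row_const TYPE('m) (z - of_nat i))"
proof -
  interpret P: product_sigma_finite "\<lambda>_ :: 'k. lborel :: (real ^ 'm ^ 1) measure" ..
  let ?M = "\<lambda>S. Pi\<^sub>M S (\<lambda>_ :: 'k. lborel :: (real ^ 'm ^ 1) measure)"
  have meas: "rows_gram S \<in> borel_measurable (?M S)" if "finite S" for S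
  proof -
    have [measurable]: "(\<lambda>\<tau>. \<tau> i) \<in> borel_measurable (?M S)" if "i \<in> S" for i
      using measurable_component_singleton[OF that, of "\<lambda>_. lborel :: (real ^ 'm ^ 1) measure"] by simp
    show ?thesis unfolding rows_gram_def[abs_def] by measurable
  qed
  have "(\<integral>\<^sup>+\<tau>. ennreal (det (rows_gram S \<tau>) powr (- Re z / 2)) \<partial>?M S)
      = ennreal (\<Prod>i<card S. row_const_real TYPE('m) (Re z - real i))
    \<and> (LINT \<tau>|?M S. complex_of_real (det (rows_gram S \<tau>)) powr (- z / 2))
      = (\<Prod>i<card S. row_const TYPE('m) (z - of_nat i))"
    using assms
  proof (induction S arbitrary: z rule: finite_induct)
    case empty
    show ?case
      by (simp add: rows_gram_def PiM_empty nn_integral_count_space_finite lebesgue_integral_count_space_finite)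
  next
    case (insert j S)
    define z' where "z' = z - 1"
    have cz: "real CARD('m) < Re z" "real (card S) + real CARD('m) - 1 < Re z'"
      using insert by (simp_all add: z'_def)
    note IH = insert.IH[OF cz(2)]
    note m1 [measurable] = meas[of "insert j S"] meas[of S]
    have fins: "finite (insert j S)" "finite S" using insert by auto
    have upd: "rows_gram (insert j S) (\<tau>(j := y)) = rows_gram S \<tau> + gram y" for \<tau> :: "'k \<Rightarrow> real ^ 'm ^ 1" and y
    proof -
      have "(\<Sum>i\<in>S. gram ((\<tau>(j := y)) i)) = (\<Sum>i\<in>S. gram (\<tau> i))"
        using insert by (intro sum.cong) auto
      then show ?thesis using insert by (simp add: rows_gram_def add_ac)
    qed
    note R = row_integral[OF posdef_rows_gram[OF fins(2)] cz(1)]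
    have prod: "(\<Prod>i<card (insert j S). f i) = f 0 * (\<Prod>i<card S. f (Suc i))" for f :: "nat \<Rightarrow> 'z::comm_monoid_mult"
      unfolding card_insert_disjoint[OF insert.hyps] by (rule prod.lessThan_Suc_shift)
    have nn: "(\<integral>\<^sup>+\<tau>. ennreal (det (rows_gram (insert j S) \<tau>) powr (- Re z / 2)) \<partial>?M (insert j S))
      = ennreal (\<Prod>i<card (insert j S). row_const_real TYPE('m) (Re z - real i))"
    proof -
      have "(\<integral>\<^sup>+\<tau>. ennreal (det (rows_gram (insert j S) \<tau>) powr (- Re z / 2)) \<partial>?M (insert j S))
        = (\<integral>\<^sup>+\<tau>. \<integral>\<^sup>+y. ennreal (det (rows_gram (insert j S) (\<tau>(j := y))) powr (- Re z / 2)) \<partial>lborel \<partial>?M S)"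
        using insert fins m1(1) by (intro P.product_nn_integral_insert) (auto, measurable)
      also have "\<dots> = (\<integral>\<^sup>+\<tau>. ennreal (row_const_real TYPE('m) (Re z)) * ennreal (det (rows_gram S \<tau>) powr (- Re z' / 2)) \<partial>?M S)"
        unfolding upd R(1) using row_const_real_pos[OF cz(1)] by (simp add: z'_def ennreal_mult')
      also have "\<dots> = ennreal (row_const_real TYPE('m) (Re z)) * (\<integral>\<^sup>+\<tau>. ennreal (det (rows_gram S \<tau>) powr (- Re z' / 2)) \<partial>?M S)"
        using m1(2) fins by (intro nn_integral_cmult) measurable
      also have "\<dots> = ennreal (\<Prod>i<card (insert j S). row_const_real TYPE('m) (Re z - real i))"
        unfolding IH[THEN conjunct1] prod using row_const_real_pos[OF cz(1)]
        by (simp add: ennreal_mult'[symmetric] z'_def diff_diff_eq)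
      finally show ?thesis .
    qed
    have int: "integrable (?M (insert j S)) (\<lambda>\<tau>. complex_of_real (det (rows_gram (insert j S) \<tau>)) powr (- z / 2))"
    proof (rule integrableI_bounded)
      show "(\<lambda>\<tau>. complex_of_real (det (rows_gram (insert j S) \<tau>)) powr (- z / 2)) \<in> borel_measurable (?M (insert j S))"
        using m1(1) fins by measurable
      have "ennreal (norm (complex_of_real (det (rows_gram (insert j S) \<tau>)) powr (- z / 2)))
        = ennreal (det (rows_gram (insert j S) \<tau>) powr (- Re z / 2))" for \<tau> :: "'k \<Rightarrow> real ^ 'm ^ 1"
        using posdef_det_pos[OF posdef_rows_gram[OF fins(1), of \<tau>]] by (simp add: norm_powr_of_real_nonneg)
      then show "(\<integral>\<^sup>+\<tau>. ennreal (norm (complex_of_real (det (rows_gram (insert j S) \<tau>)) powr (- z / 2))) \<partial>?M (insert j S)) < \<infinity>"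
        using nn by simp
    qed
    have "(LINT \<tau>|?M (insert j S). complex_of_real (det (rows_gram (insert j S) \<tau>)) powr (- z / 2))
      = (LINT \<tau>|?M S. LINT y|lborel. complex_of_real (det (rows_gram (insert j S) (\<tau>(j := y)))) powr (- z / 2))"
      by (rule P.product_integral_insert) (use insert int in auto)
    also have "\<dots> = (LINT \<tau>|?M S. row_const TYPE('m) z * complex_of_real (det (rows_gram S \<tau>)) powr (- z' / 2))"
      unfolding upd R(2) z'_def ..
    also have "\<dots> = row_const TYPE('m) z * (LINT \<tau>|?M S. complex_of_real (det (rows_gram S \<tau>)) powr (- z' / 2))"
      by (rule integral_mult_right_zero)
    also have "\<dots> = (\<Prod>i<card (insert j S). row_const TYPE('m) (z - of_nat i))"
      unfolding IH[THEN conjunct2] prod by (simp add: z'_def diff_diff_eq)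
    finally show ?case using nn by blast
  qed
  then show "(\<integral>\<^sup>+\<tau>. ennreal (det (rows_gram S \<tau>) powr (- Re z / 2)) \<partial>?M S)
      = ennreal (\<Prod>i<card S. row_const_real TYPE('m) (Re z - real i))"
    "(LINT \<tau>|?M S. complex_of_real (det (rows_gram S \<tau>)) powr (- z / 2))
      = (\<Prod>i<card S. row_const TYPE('m) (z - of_nat i))" by blast+
qed

lemma lborel_rows:
  "distr (Pi\<^sub>M UNIV (\<lambda>_ :: 'k::finite. lborel :: (real ^ 'm ^ 1) measure)) borel (\<lambda>\<tau>. \<chi> i. \<tau> i $ 1)
    = (lborel :: (real ^ 'm ^ 'k) measure)" (is "distr ?P _ ?f = _")
proof (rule lborel_eqI[symmetric])
  interpret P: product_sigma_finite "\<lambda>_ :: 'k. lborel :: (real ^ 'm ^ 1) measure" ..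
  fix l u :: "real ^ 'm ^ 'k" assume le: "\<And>b. b \<in> Basis \<Longrightarrow> l \<bullet> b \<le> u \<bullet> b"
  have le': "l $ i $ j \<le> u $ i $ j" for i j
    using le[of "axis i (axis j 1)"] by (simp add: inner_axis)
  define r :: "real ^ 'm ^ 'k \<Rightarrow> 'k \<Rightarrow> real ^ 'm ^ 1" where "r v i = (\<chi> _. v $ i)" for v :: "real ^ 'm ^ 'k" and i
  have [measurable]: "(\<lambda>\<tau>. \<tau> i) \<in> borel_measurable ?P" for i
    using measurable_component_singleton[of i UNIV "\<lambda>_. lborel :: (real ^ 'm ^ 1) measure"] by simp
  have f: "?f \<in> borel_measurable ?P" by measurable
  have vim: "?f -` box l u \<inter> space ?P = Pi\<^sub>E UNIV (\<lambda>i. box (r l i) (r u i))"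
    by (auto simp: space_PiM PiE_def Pi_def box_matrix r_def)
  have e: "emeasure lborel (box (r l i) (r u i)) = ennreal (\<Prod>j\<in>UNIV. u $ i $ j - l $ i $ j)" for i
  proof (subst emeasure_lborel_box)
    show "r l i \<bullet> b \<le> r u i \<bullet> b" if "b \<in> Basis" for b
      using that by (auto simp: Basis_matrix inner_axis r_def le')
  qed (simp add: prod_Basis_matrix inner_axis r_def)
  have "emeasure (distr ?P borel ?f) (box l u) = emeasure ?P (Pi\<^sub>E UNIV (\<lambda>i. box (r l i) (r u i)))"
    using f by (subst emeasure_distr) (simp_all add: vim)
  also have "\<dots> = (\<Prod>i\<in>UNIV. ennreal (\<Prod>j\<in>UNIV. u $ i $ j - l $ i $ j))"
    by (subst P.emeasure_PiM) (simp_all add: e)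
  also have "\<dots> = ennreal (\<Prod>i\<in>UNIV. \<Prod>j\<in>UNIV. u $ i $ j - l $ i $ j)"
    by (rule prod_ennreal) (auto intro!: prod_nonneg simp: le')
  finally show "emeasure (distr ?P borel ?f) (box l u) = ennreal (prod ((\<bullet>) (u - l)) Basis)"
    by (simp add: prod_Basis_matrix inner_axis)
qed simp

lemma rows_gram_eq: "mat 1 + gram (\<chi> i. \<tau> i $ 1) = rows_gram UNIV \<tau>"
  for \<tau> :: "'k::finite \<Rightarrow> real ^ 'm ^ 1"
  by (simp add: rows_gram_def gram_eq_sum_outer gram_single_row)

lemma chart_integral:
  fixes z :: complex
  assumes "real CARD('k::finite) + real CARD('m::finite) - 1 < Re z"
  shows "(\<integral>\<^sup>+\<tau>. chart_weight (Re z) (\<tau> :: real ^ 'm ^ 'k) \<partial>lborel)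
      = ennreal (\<Prod>i<CARD('k). row_const_real TYPE('m) (Re z - real i))"
    and "(LINT \<tau>|lborel. complex_of_real (det (mat 1 + gram (\<tau> :: real ^ 'm ^ 'k))) powr (- z / 2))
      = (\<Prod>i<CARD('k). row_const TYPE('m) (z - of_nat i))"
proof -
  let ?P = "Pi\<^sub>M UNIV (\<lambda>_ :: 'k. lborel :: (real ^ 'm ^ 1) measure)"
  have [measurable]: "(\<lambda>\<tau>. \<tau> i) \<in> borel_measurable ?P" for i
    using measurable_component_singleton[of i UNIV "\<lambda>_. lborel :: (real ^ 'm ^ 1) measure"] by simp
  have f [measurable]: "(\<lambda>\<tau>. \<chi> i. \<tau> i $ 1) \<in> borel_measurable ?P" by measurable
  note R = rows_integral[of "UNIV :: 'k set", OF _ assms]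
  have "(\<integral>\<^sup>+\<tau>. chart_weight (Re z) (\<tau> :: real ^ 'm ^ 'k) \<partial>lborel) = (\<integral>\<^sup>+\<tau>. chart_weight (Re z) (\<chi> i. \<tau> i $ 1) \<partial>?P)"
    by (subst lborel_rows[symmetric], subst nn_integral_distr) simp_all
  also have "\<dots> = ennreal (\<Prod>i<CARD('k). row_const_real TYPE('m) (Re z - real i))"
    unfolding chart_weight_def rows_gram_eq by (rule R(1)) simp
  finally show "(\<integral>\<^sup>+\<tau>. chart_weight (Re z) (\<tau> :: real ^ 'm ^ 'k) \<partial>lborel)
      = ennreal (\<Prod>i<CARD('k). row_const_real TYPE('m) (Re z - real i))" .
  have "(LINT \<tau>|lborel. complex_of_real (det (mat 1 + gram (\<tau> :: real ^ 'm ^ 'k))) powr (- z / 2))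
    = (LINT \<tau>|?P. complex_of_real (det (mat 1 + gram (\<chi> i. \<tau> i $ 1))) powr (- z / 2))"
    by (subst lborel_rows[symmetric], subst integral_distr) simp_all
  also have "\<dots> = (\<Prod>i<CARD('k). row_const TYPE('m) (z - of_nat i))"
    unfolding rows_gram_eq by (rule R(2)) simp
  finally show "(LINT \<tau>|lborel. complex_of_real (det (mat 1 + gram (\<tau> :: real ^ 'm ^ 'k))) powr (- z / 2))
      = (\<Prod>i<CARD('k). row_const TYPE('m) (z - of_nat i))" .
qed


subsection \<open>The kernel identities\<close>

text \<open>By \<open>chart_integral\<close> this is the integral of |I + t't|^(-z/2) over k x m
  matrices t. It is evaluated at \<open>lam\<close> for the kernels and at \<open>n\<close> for the
  normalisation.\<close>

definition chart_const :: "'m::finite itself \<Rightarrow> nat \<Rightarrow> complex \<Rightarrow> complex" where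
  "chart_const _ k z = (\<Prod>i<k. row_const TYPE('m) (z - of_nat i))"

definition chart_const_real :: "'m::finite itself \<Rightarrow> nat \<Rightarrow> real \<Rightarrow> real" where
  "chart_const_real _ k a = (\<Prod>i<k. row_const_real TYPE('m) (a - real i))"

lemma chart_const_real_pos:
  assumes "real k + real CARD('m::finite) - 1 < a"
  shows "0 < chart_const_real TYPE('m) k a"
  unfolding chart_const_real_def
proof (rule prod_pos)
  fix i assume "i \<in> {..<k}"
  then have "real i \<le> real k - 1" by (auto simp: of_nat_less_iff[symmetric] simp del: of_nat_less_iff)
  with assms show "0 < row_const_real TYPE('m) (a - real i)" by (intro row_const_real_pos) simp
qed

text \<open>The form suited to \<open>inv_gram_law\<close>, where the power of the determinant sits
  on one side and the indicator of the ball on the other.\<close>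

lemma integral_transfer_weighted:
  fixes f :: "'c::second_countable_topology \<Rightarrow> complex" and w :: "'b \<Rightarrow> real"
  assumes T [measurable]: "T \<in> borel_measurable M" and S: "S \<in> borel_measurable N"
    and w: "w \<in> borel_measurable N" "\<And>y. 0 \<le> w y"
    and v [measurable]: "v \<in> borel_measurable M" and v0: "\<And>y. 0 \<le> v y"
    and eq: "\<And>f. f \<in> borel_measurable borel \<Longrightarrow>
      (\<integral>\<^sup>+x. ennreal (v x) * f (T x) \<partial>M) = (\<integral>\<^sup>+y. ennreal (w y) * f (S y) \<partial>N)"
    and f [measurable]: "f \<in> borel_measurable borel"
  shows "(LINT x|M. complex_of_real (v x) * f (T x)) = (LINT y|N. complex_of_real (w y) * f (S y))"
proof -
  have "(LINT x|density M v. f (T x)) = (LINT y|N. complex_of_real (w y) * f (S y))"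
  proof (rule integral_transfer[OF _ S w _ f])
    fix f :: "'c \<Rightarrow> ennreal" assume [measurable]: "f \<in> borel_measurable borel"
    show "(\<integral>\<^sup>+x. f (T x) \<partial>density M v) = (\<integral>\<^sup>+y. ennreal (w y) * f (S y) \<partial>N)"
      by (subst nn_integral_density) (simp_all add: eq)
  qed simp
  then show ?thesis
    by (subst (asm) integral_density) (simp_all add: v0 scaleR_conv_of_real)
qed

text \<open>With \<open>B = gram r\<close>, substituting \<open>\<tau> ** r\<close> pulls out
  \<open>det B\<close>. The scale \<open>\<bar>det r\<bar> ^ CARD('k)\<close> is the power k/2 of
  \<open>det B\<close>, which accounts for the exponent on the right.\<close>

lemma chart_integral_shifted:
  fixes z :: complex and B :: "real ^ 'm ^ 'm"
  assumes B: "posdef B" and z: "real CARD('k::finite) + real CARD('m) - 1 < Re z"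
  shows "(\<integral>\<^sup>+\<tau>. ennreal (det (B + gram (\<tau> :: real ^ 'm ^ 'k)) powr (- Re z / 2)) \<partial>lborel)
      = ennreal (det B powr ((real CARD('k) - Re z) / 2) * chart_const_real TYPE('m) CARD('k) (Re z))"
    and "(LINT \<tau>|lborel. complex_of_real (det (B + gram (\<tau> :: real ^ 'm ^ 'k))) powr (- z / 2))
      = complex_of_real (det B) powr ((of_nat CARD('k) - z) / 2) * chart_const TYPE('m) CARD('k) z"
proof -
  obtain r where r: "B = gram r" "det r \<noteq> 0" using B by (rule posdef_obtain_root)
  have dB: "0 < det B" by (rule posdef_det_pos[OF B])
  have det: "det (B + gram (\<tau> ** r)) = det B * det (mat 1 + gram \<tau>)" for \<tau> :: "real ^ 'm ^ 'k"
  proof -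
    have "B + gram (\<tau> ** r) = transpose r ** (mat 1 + gram \<tau>) ** r"
      by (simp add: r(1) gram_mult matrix_add_ldistrib matrix_add_rdistrib)
    then show ?thesis by (simp add: det_mul r(1))
  qed
  note pos = det_one_add_gram_pos[where 'm='m and 'k='k]
  define W where "W = \<bar>det r\<bar> ^ CARD('k)"
  have W0: "0 \<le> W" by (simp add: W_def)
  have W: "W = det B powr (real CARD('k) / 2)"
  proof -
    have "\<bar>det r\<bar> = det B powr (1/2)" using dB by (simp add: powr_half_sqrt r(1) det_mul real_sqrt_abs2)
    then show ?thesis using dB by (simp add: W_def powr_power)
  qed
  have "(\<integral>\<^sup>+\<tau>. ennreal (det (B + gram (\<tau> :: real ^ 'm ^ 'k)) powr (- Re z / 2)) \<partial>lborel)
    = ennreal W * (\<integral>\<^sup>+\<tau>. ennreal (det (B + gram ((\<tau> :: real ^ 'm ^ 'k) ** r)) powr (- Re z / 2)) \<partial>lborel)"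
    unfolding W_def by (rule nn_integral_right_mult[OF r(2)]) measurable
  also have "\<dots> = ennreal W * (\<integral>\<^sup>+\<tau>. ennreal (det B powr (- Re z / 2)) * chart_weight (Re z) (\<tau> :: real ^ 'm ^ 'k) \<partial>lborel)"
    unfolding det chart_weight_def using dB pos by (simp add: powr_mult ennreal_mult less_imp_le)
  also have "\<dots> = ennreal W * (ennreal (det B powr (- Re z / 2)) * ennreal (chart_const_real TYPE('m) CARD('k) (Re z)))"
    unfolding chart_const_real_def chart_integral(1)[OF z, symmetric] by (subst nn_integral_cmult) simp_all
  also have "\<dots> = ennreal (W * det B powr (- Re z / 2) * chart_const_real TYPE('m) CARD('k) (Re z))"
    using W0 by (simp add: ennreal_mult' mult.assoc)
  also have "W * det B powr (- Re z / 2) = det B powr ((real CARD('k) - Re z) / 2)"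
    unfolding W powr_add[symmetric] by (simp add: diff_divide_distrib)
  finally show "(\<integral>\<^sup>+\<tau>. ennreal (det (B + gram (\<tau> :: real ^ 'm ^ 'k)) powr (- Re z / 2)) \<partial>lborel)
      = ennreal (det B powr ((real CARD('k) - Re z) / 2) * chart_const_real TYPE('m) CARD('k) (Re z))" .
  have "(LINT \<tau>|lborel. complex_of_real (det (B + gram (\<tau> :: real ^ 'm ^ 'k))) powr (- z / 2))
    = (LINT \<tau>|lborel. complex_of_real W * complex_of_real (det (B + gram ((\<tau> :: real ^ 'm ^ 'k) ** r))) powr (- z / 2))"
  proof (rule integral_transfer[where T="\<lambda>y. y" and S="\<lambda>y. y ** r" and w="\<lambda>_. W" and M=lborel and N=lborel
      and f="\<lambda>y. complex_of_real (det (B + gram y)) powr (- z / 2)"])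
    fix f :: "real ^ 'm ^ 'k \<Rightarrow> ennreal" assume [measurable]: "f \<in> borel_measurable borel"
    show "(\<integral>\<^sup>+y. f y \<partial>lborel) = (\<integral>\<^sup>+y. ennreal W * f (y ** r) \<partial>lborel)"
      using nn_integral_right_mult[OF r(2), of f] by (simp add: nn_integral_cmult W_def)
  qed (simp_all add: W0, measurable)
  also have "\<dots> = (LINT \<tau>|lborel. (complex_of_real W * complex_of_real (det B) powr (- z / 2)) *
      complex_of_real (det (mat 1 + gram (\<tau> :: real ^ 'm ^ 'k))) powr (- z / 2))"
    unfolding det of_real_mult using dB pos
    by (intro Bochner_Integration.integral_cong refl) (simp add: powr_times_real less_imp_le)
  also have "\<dots> = (complex_of_real W * complex_of_real (det B) powr (- z / 2)) * chart_const TYPE('m) CARD('k) z"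
    unfolding integral_mult_right_zero chart_integral(2)[OF z] chart_const_def ..
  also have "complex_of_real W * complex_of_real (det B) powr (- z / 2) = complex_of_real (det B) powr ((of_nat CARD('k) - z) / 2)"
  proof -
    have "complex_of_real W = complex_of_real (det B) powr (of_nat CARD('k) / 2)"
      using dB powr_of_real[of "det B" "real CARD('k) / 2"] by (simp add: W)
    then have "complex_of_real W * complex_of_real (det B) powr (- z / 2) = complex_of_real (det B) powr (of_nat CARD('k) / 2 + - z / 2)"
      by (simp only: powr_add)
    also have "of_nat CARD('k) / 2 + - z / 2 = (of_nat CARD('k) - z) / 2" by (simp add: field_simps)
    finally show ?thesis .
  qed
  finally show "(LINT \<tau>|lborel. complex_of_real (det (B + gram (\<tau> :: real ^ 'm ^ 'k))) powr (- z / 2))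
      = complex_of_real (det B) powr ((of_nat CARD('k) - z) / 2) * chart_const TYPE('m) CARD('k) z" .
qed

lemma norm_det_powr: "norm (det_powr s \<alpha>) = \<bar>det s\<bar> powr Re \<alpha>" for s :: "real ^ 'm ^ 'm"
  unfolding det_powr_def by (rule norm_powr_of_real_nonneg) simp

lemma det_powr_measurable [measurable (raw)]:
  fixes f :: "'a \<Rightarrow> real ^ 'm ^ 'm"
  assumes [measurable]: "f \<in> borel_measurable M"
  shows "(\<lambda>x. det_powr (f x) \<alpha>) \<in> borel_measurable M"
  unfolding det_powr_def by measurable

lemma det_powr_plus_measurable [measurable (raw)]:
  fixes f :: "'a \<Rightarrow> real ^ 'm ^ 'm"
  assumes [measurable]: "f \<in> borel_measurable M"
  shows "(\<lambda>x. det_powr_plus (f x) \<alpha>) \<in> borel_measurable M"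
  unfolding det_powr_plus_def by measurable

lemma det_powr_mult: "det_powr (A ** B) \<alpha> = det_powr A \<alpha> * det_powr B \<alpha>" for A B :: "real ^ 'm ^ 'm"
  unfolding det_powr_def by (simp add: det_mul abs_mult powr_times_real)

lemma det_powr_add: "det_powr A (\<alpha> + \<beta>) = det_powr A \<alpha> * det_powr A \<beta>" for A :: "real ^ 'm ^ 'm"
  unfolding det_powr_def by (rule powr_add)

text \<open>The kernel identity in the chart \<open>\<tau>\<close>: by the law of \<open>gram (transpose \<xi> ** x)\<close>, where
  \<open>gram x = gram c\<close>, the integrals below are, up to a constant, its expectations.\<close>

definition chart_pair :: "'k::finite itself \<Rightarrow> real \<Rightarrow> (real ^ 'm ^ 'm \<Rightarrow> complex) \<Rightarrow> (real ^ 'm ^ 'm \<Rightarrow> complex)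
    \<Rightarrow> real \<Rightarrow> complex \<Rightarrow> bool" where
  "chart_pair _ N w v Kr Kc \<longleftrightarrow> (\<forall>c. det c \<noteq> 0 \<longrightarrow>
     (\<integral>\<^sup>+\<tau>. chart_weight N (\<tau> :: real ^ 'm ^ 'k) * ennreal (norm (w (transpose c ** inv_gram \<tau> ** c))) \<partial>lborel)
       = ennreal (Kr * norm (v (gram c))) \<and>
     (LINT \<tau>|lborel. complex_of_real (det (mat 1 + gram (\<tau> :: real ^ 'm ^ 'k)) powr (- N / 2)) * w (transpose c ** inv_gram \<tau> ** c))
       = Kc * v (gram c))"

lemma chart_weight_norm:
  "chart_weight N \<tau> * ennreal (norm b) = ennreal (norm (complex_of_real (det (mat 1 + gram \<tau>) powr (- N / 2)) * b))"
  by (simp add: chart_weight_def norm_mult ennreal_mult')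

lemma det_powr_inv_gram: "det_powr (inv_gram \<tau>) \<alpha> = complex_of_real (det (mat 1 + gram \<tau>)) powr (- \<alpha>)"
  for \<tau> :: "real ^ 'm ^ 'k"
proof -
  have "complex_of_real (1 / D) powr \<alpha> = complex_of_real D powr (- \<alpha>)" if "0 < D" for D :: real
    using that by (simp add: powr_def Ln_of_real ln_div flip: of_real_divide)
  then show ?thesis
    using det_one_add_gram_pos[of \<tau>] unfolding det_powr_def det_inv_gram by simp
qed

lemma of_real_powr_real: "0 < D \<Longrightarrow> complex_of_real (D powr a) = complex_of_real D powr complex_of_real a"
  by (simp add: powr_of_real)

text \<open>The determinant of \<open>transpose c ** inv_gram \<tau> ** c\<close> factors, and the
  power of \<open>det (inv_gram \<tau>)\<close> changes the exponent \<open>N\<close> of the weight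
  into \<open>z\<close>.\<close>

lemma chart_pair_power:
  fixes z :: complex
  assumes z: "real CARD('k::finite) + real CARD('m::finite) - 1 < Re z"
  shows "chart_pair TYPE('k) N (\<lambda>u :: real ^ 'm ^ 'm. det_powr u ((z - of_real N) / 2)) (\<lambda>s. det_powr s ((z - of_real N) / 2))
    (chart_const_real TYPE('m) CARD('k) (Re z)) (chart_const TYPE('m) CARD('k) z)"
  unfolding chart_pair_def
proof (intro allI impI)
  fix c :: "real ^ 'm ^ 'm" assume "det c \<noteq> 0"
  let ?v = "det_powr (gram c) ((z - of_real N) / 2)"
  have pt: "complex_of_real (det (mat 1 + gram \<tau>) powr (- N / 2)) * det_powr (transpose c ** inv_gram \<tau> ** c) ((z - of_real N) / 2)
    = ?v * complex_of_real (det (mat 1 + gram \<tau>)) powr (- z / 2)" for \<tau> :: "real ^ 'm ^ 'k"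
  proof -
    define D where "D = det (mat 1 + gram \<tau>)"
    have D: "0 < D" unfolding D_def by (rule det_one_add_gram_pos)
    have e: "complex_of_real D powr of_real (- N / 2) * complex_of_real D powr (- ((z - of_real N) / 2)) = complex_of_real D powr (- z / 2)"
      unfolding powr_add[symmetric] by (rule arg_cong[where f="\<lambda>w. _ powr w"]) (simp add: field_simps)
    show ?thesis
      unfolding det_powr_mult det_powr_inv_gram D_def[symmetric] of_real_powr_real[OF D] e[symmetric]
      by (simp only: mult_ac)
  qed
  have "(\<integral>\<^sup>+\<tau>. chart_weight N (\<tau> :: real ^ 'm ^ 'k) * ennreal (norm (det_powr (transpose c ** inv_gram \<tau> ** c) ((z - of_real N) / 2))) \<partial>lborel)
    = (\<integral>\<^sup>+\<tau>. ennreal (norm ?v) * chart_weight (Re z) (\<tau> :: real ^ 'm ^ 'k) \<partial>lborel)"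
    unfolding chart_weight_norm pt using det_one_add_gram_pos[where 'm='m and 'k='k]
    by (simp add: norm_mult chart_weight_def ennreal_mult' norm_powr_of_real_nonneg less_imp_le)
  also have "\<dots> = ennreal (norm ?v) * ennreal (chart_const_real TYPE('m) CARD('k) (Re z))"
    unfolding chart_const_real_def chart_integral(1)[OF z, symmetric] by (rule nn_integral_cmult) measurable
  also have "\<dots> = ennreal (chart_const_real TYPE('m) CARD('k) (Re z) * norm ?v)"
    by (simp add: ennreal_mult'' mult.commute)
  finally show "(\<integral>\<^sup>+\<tau>. chart_weight N (\<tau> :: real ^ 'm ^ 'k) * ennreal (norm (det_powr (transpose c ** inv_gram \<tau> ** c) ((z - of_real N) / 2))) \<partial>lborel)
      = ennreal (chart_const_real TYPE('m) CARD('k) (Re z) * norm ?v) \<and>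
    (LINT \<tau>|lborel. complex_of_real (det (mat 1 + gram (\<tau> :: real ^ 'm ^ 'k)) powr (- N / 2)) * det_powr (transpose c ** inv_gram \<tau> ** c) ((z - of_real N) / 2))
      = chart_const TYPE('m) CARD('k) z * ?v"
    unfolding pt integral_mult_right_zero chart_integral(2)[OF z] chart_const_def by (simp add: mult.commute)
qed

text \<open>Conjugation by \<open>c\<close> turns I + c'Rc into I + cc'R, which equals (R^(-1) +
  cc') R.\<close>

lemma det_one_add_conj_inv_gram:
  fixes c :: "real ^ 'm ^ 'm" and \<tau> :: "real ^ 'm ^ 'k"
  assumes c: "det c \<noteq> 0"
  shows "det (mat 1 + transpose c ** inv_gram \<tau> ** c)
    = det (mat 1 + c ** transpose c + gram \<tau>) * det (inv_gram \<tau>)"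
proof -
  obtain b where b: "c ** b = mat 1" "b ** c = mat 1" "det b = 1 / det c" using c by (rule matrix_inverse_obtain)
  have "c ** (mat 1 + transpose c ** inv_gram \<tau> ** c) ** b = c ** b + c ** transpose c ** inv_gram \<tau> ** (c ** b)"
    by (simp add: matrix_add_ldistrib matrix_add_rdistrib matrix_mul_assoc)
  also have "\<dots> = (mat 1 + gram \<tau>) ** inv_gram \<tau> + c ** transpose c ** inv_gram \<tau>"
    by (simp add: b inv_gram)
  also have "\<dots> = (mat 1 + c ** transpose c + gram \<tau>) ** inv_gram \<tau>"
    by (simp add: matrix_add_rdistrib add_ac)
  finally have "det c * det (mat 1 + transpose c ** inv_gram \<tau> ** c) * det b = det (mat 1 + c ** transpose c + gram \<tau>) * det (inv_gram \<tau>)"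
    by (metis det_mul)
  then show ?thesis using b(3) c by simp
qed

text \<open>The two matrices are similar by \<open>c\<close>.\<close>

lemma det_one_add_transpose: "det (mat 1 + c ** transpose c) = det (mat 1 + gram c)"
  if c: "det c \<noteq> 0" for c :: "real ^ 'm ^ 'm"
proof -
  obtain b where b: "c ** b = mat 1" "b ** c = mat 1" "det b = 1 / det c" using c by (rule matrix_inverse_obtain)
  have "c ** (mat 1 + gram c) ** b = c ** b + c ** transpose c ** (c ** b)"
    by (simp add: matrix_add_ldistrib matrix_add_rdistrib matrix_mul_assoc)
  then have "c ** (mat 1 + gram c) ** b = mat 1 + c ** transpose c" by (simp add: b)
  then have "det c * det (mat 1 + gram c) * det b = det (mat 1 + c ** transpose c)" by (metis det_mul)
  then show ?thesis using b(3) c by simp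
qed

text \<open>By \<open>det_one_add_conj_inv_gram\<close> the powers of
  \<open>det (mat 1 + gram \<tau>)\<close> cancel: -N/2 from the density, -(z - N)/2 from the first
  factor and z/2 from the second. What is left is the shifted chart integral with
  \<open>B = mat 1 + c ** transpose c\<close>.\<close>

lemma chart_pair_beta:
  fixes z :: complex
  assumes z: "real CARD('k::finite) + real CARD('m::finite) - 1 < Re z"
  shows "chart_pair TYPE('k) N
    (\<lambda>u :: real ^ 'm ^ 'm. det_powr u ((z - of_real N) / 2) * det_powr (mat 1 + u) (- z / 2))
    (\<lambda>s. det_powr s ((z - of_real N) / 2) * det_powr (mat 1 + s) ((of_nat CARD('k) - z) / 2))
    (chart_const_real TYPE('m) CARD('k) (Re z)) (chart_const TYPE('m) CARD('k) z)"
  unfolding chart_pair_def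
proof (intro allI impI)
  fix c :: "real ^ 'm ^ 'm" assume c: "det c \<noteq> 0"
  let ?p = "det_powr (gram c) ((z - of_real N) / 2)"
  let ?w = "\<lambda>u :: real ^ 'm ^ 'm. det_powr u ((z - of_real N) / 2) * det_powr (mat 1 + u) (- z / 2)"
  define B where "B = mat 1 + c ** transpose c"
  have B: "posdef B" unfolding B_def using posdef_one_add_gram[of "transpose c"] by simp
  have dB: "0 < det B" by (rule posdef_det_pos[OF B])
  have dBg: "det B = det (mat 1 + gram c)" unfolding B_def by (rule det_one_add_transpose[OF c])
  have pB: "0 < det (B + gram \<tau>)" for \<tau> :: "real ^ 'm ^ 'k"
    by (rule posdef_det_pos[OF posdef_add_gram[OF B]])
  have pt: "complex_of_real (det (mat 1 + gram \<tau>) powr (- N / 2)) * ?w (transpose c ** inv_gram \<tau> ** c)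
    = ?p * complex_of_real (det (B + gram \<tau>)) powr (- z / 2)" for \<tau> :: "real ^ 'm ^ 'k"
  proof -
    define D where "D = det (mat 1 + gram \<tau>)"
    have D: "0 < D" unfolding D_def by (rule det_one_add_gram_pos)
    have e: "complex_of_real D powr of_real (- N / 2) * complex_of_real D powr (- ((z - of_real N) / 2)) * complex_of_real D powr (- (- z / 2)) = 1"
    proof -
      have "complex_of_real D powr of_real (- N / 2) * complex_of_real D powr (- ((z - of_real N) / 2)) * complex_of_real D powr (- (- z / 2))
        = complex_of_real D powr 0"
        unfolding powr_add[symmetric] by (rule arg_cong[where f="\<lambda>w. _ powr w"]) (simp add: field_simps)
      then show ?thesis using D by simp
    qed
    have w: "det_powr (mat 1 + transpose c ** inv_gram \<tau> ** c) (- z / 2) = complex_of_real (det (B + gram \<tau>)) powr (- z / 2) * det_powr (inv_gram \<tau>) (- z / 2)"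
      using pB[of \<tau>] unfolding det_powr_def det_one_add_conj_inv_gram[OF c] B_def[symmetric]
      by (simp add: abs_mult powr_times_real)
    have "complex_of_real (det (mat 1 + gram \<tau>) powr (- N / 2)) * ?w (transpose c ** inv_gram \<tau> ** c)
      = (complex_of_real D powr of_real (- N / 2) * complex_of_real D powr (- ((z - of_real N) / 2)) * complex_of_real D powr (- (- z / 2)))
        * (?p * complex_of_real (det (B + gram \<tau>)) powr (- z / 2))"
      unfolding w unfolding det_powr_mult det_powr_inv_gram D_def[symmetric] of_real_powr_real[OF D]
      by (simp only: mult_ac)
    then show ?thesis by (simp only: e mult_1_left)
  qed
  have "(\<integral>\<^sup>+\<tau>. chart_weight N (\<tau> :: real ^ 'm ^ 'k) * ennreal (norm (?w (transpose c ** inv_gram \<tau> ** c))) \<partial>lborel)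
    = (\<integral>\<^sup>+\<tau>. ennreal (norm ?p) * ennreal (det (B + gram (\<tau> :: real ^ 'm ^ 'k)) powr (- Re z / 2)) \<partial>lborel)"
    unfolding chart_weight_norm pt using pB
    by (simp add: norm_mult ennreal_mult' norm_powr_of_real_nonneg less_imp_le)
  also have "\<dots> = ennreal (norm ?p) * ennreal (det B powr ((real CARD('k) - Re z) / 2) * chart_const_real TYPE('m) CARD('k) (Re z))"
    unfolding chart_integral_shifted(1)[OF B z, symmetric] by (rule nn_integral_cmult) measurable
  also have "\<dots> = ennreal (chart_const_real TYPE('m) CARD('k) (Re z) * norm (?p * det_powr (mat 1 + gram c) ((of_nat CARD('k) - z) / 2)))"
    using dB chart_const_real_pos[OF z] unfolding norm_mult norm_det_powr[of "mat 1 + gram c"] dBg[symmetric]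
    by (simp add: ennreal_mult'[symmetric] mult_ac)
  finally have nn: "(\<integral>\<^sup>+\<tau>. chart_weight N (\<tau> :: real ^ 'm ^ 'k) * ennreal (norm (?w (transpose c ** inv_gram \<tau> ** c))) \<partial>lborel)
    = ennreal (chart_const_real TYPE('m) CARD('k) (Re z) * norm (?p * det_powr (mat 1 + gram c) ((of_nat CARD('k) - z) / 2)))" .
  have "(LINT \<tau>|lborel. complex_of_real (det (mat 1 + gram (\<tau> :: real ^ 'm ^ 'k)) powr (- N / 2)) * ?w (transpose c ** inv_gram \<tau> ** c))
      = chart_const TYPE('m) CARD('k) z * (?p * det_powr (mat 1 + gram c) ((of_nat CARD('k) - z) / 2))"
    unfolding pt integral_mult_right_zero chart_integral_shifted(2)[OF B z] det_powr_def[of "mat 1 + gram c"] dBg[symmetric]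
    using dB by (simp add: mult_ac)
  with nn show "(\<integral>\<^sup>+\<tau>. chart_weight N (\<tau> :: real ^ 'm ^ 'k) * ennreal (norm (?w (transpose c ** inv_gram \<tau> ** c))) \<partial>lborel)
    = ennreal (chart_const_real TYPE('m) CARD('k) (Re z) * norm (?p * det_powr (mat 1 + gram c) ((of_nat CARD('k) - z) / 2))) \<and>
    (LINT \<tau>|lborel. complex_of_real (det (mat 1 + gram (\<tau> :: real ^ 'm ^ 'k)) powr (- N / 2)) * ?w (transpose c ** inv_gram \<tau> ** c))
      = chart_const TYPE('m) CARD('k) z * (?p * det_powr (mat 1 + gram c) ((of_nat CARD('k) - z) / 2))" by blast
qed


section \<open>Matrix beta integrals and the truncated kernel\<close>

lemma of_real_of_bool: "complex_of_real (of_bool P) = of_bool P"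
  by (cases P) simp_all

text \<open>A matrix beta integral. The offset in \<open>\<beta>\<close> is that of
  \<open>inv_gram_law\<close>: carried to the chart \<open>\<tau>\<close>, the integrand is the
  power -z/2 of \<open>det (mat 1 + gram \<tau>)\<close>.\<close>

lemma ball_integral_unit:
  fixes z :: complex
  assumes z: "real CARD('k::finite) + real CARD('m::finite) - 1 < Re z"
  defines "\<beta> \<equiv> (z - of_nat (CARD('k) + 1 + CARD('m))) / 2"
  shows "(\<integral>\<^sup>+\<eta>. ennreal (norm (det_powr_plus (mat 1 - gram (\<eta> :: real ^ 'm ^ 'k)) \<beta>)) \<partial>lborel)
      = ennreal (chart_const_real TYPE('m) CARD('k) (Re z))"
    and "(LINT \<eta>|lborel. det_powr_plus (mat 1 - gram (\<eta> :: real ^ 'm ^ 'k)) \<beta>) = chart_const TYPE('m) CARD('k) z"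
proof -
  define e where "e = - real (CARD('k) + 1 + CARD('m)) / 2"
  have R\<beta>: "e - Re \<beta> = - Re z / 2" by (simp add: \<beta>_def e_def field_simps)
  have C\<beta>: "complex_of_real e + - \<beta> = - z / 2" by (simp add: \<beta>_def e_def field_simps)
  have "(\<integral>\<^sup>+\<eta>. ennreal (norm (det_powr_plus (mat 1 - gram (\<eta> :: real ^ 'm ^ 'k)) \<beta>)) \<partial>lborel)
    = (\<integral>\<^sup>+\<eta>. of_bool (posdef (mat 1 - gram \<eta>)) * ennreal (norm (det_powr (mat 1 - gram (\<eta> :: real ^ 'm ^ 'k)) \<beta>)) \<partial>lborel)"
    by (intro nn_integral_cong) (simp add: det_powr_plus_def)
  also have "\<dots> = (\<integral>\<^sup>+\<tau>. ennreal (det (mat 1 + gram (\<tau> :: real ^ 'm ^ 'k)) powr e) * ennreal (norm (det_powr (inv_gram \<tau>) \<beta>)) \<partial>lborel)"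
    unfolding e_def by (rule inv_gram_law[symmetric]) measurable
  also have "\<dots> = (\<integral>\<^sup>+\<tau>. chart_weight (Re z) (\<tau> :: real ^ 'm ^ 'k) \<partial>lborel)"
  proof (rule nn_integral_cong)
    fix \<tau> :: "real ^ 'm ^ 'k"
    show "ennreal (det (mat 1 + gram \<tau>) powr e) * ennreal (norm (det_powr (inv_gram \<tau>) \<beta>)) = chart_weight (Re z) \<tau>"
      using det_one_add_gram_pos[of \<tau>] R\<beta> unfolding det_powr_inv_gram chart_weight_def
      by (simp add: norm_powr_of_real_nonneg less_imp_le ennreal_mult'[symmetric] powr_add[symmetric])
  qed
  finally show "(\<integral>\<^sup>+\<eta>. ennreal (norm (det_powr_plus (mat 1 - gram (\<eta> :: real ^ 'm ^ 'k)) \<beta>)) \<partial>lborel)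
      = ennreal (chart_const_real TYPE('m) CARD('k) (Re z))"
    unfolding chart_const_real_def chart_integral(1)[OF z] .
  have "(LINT \<eta>|lborel. det_powr_plus (mat 1 - gram (\<eta> :: real ^ 'm ^ 'k)) \<beta>)
    = (LINT \<eta>|lborel. complex_of_real (of_bool (posdef (mat 1 - gram \<eta>))) * det_powr (mat 1 - gram (\<eta> :: real ^ 'm ^ 'k)) \<beta>)"
    by (intro Bochner_Integration.integral_cong refl) (simp add: det_powr_plus_def)
  also have "\<dots> = (LINT \<tau>|lborel. complex_of_real (det (mat 1 + gram (\<tau> :: real ^ 'm ^ 'k)) powr e) * det_powr (inv_gram \<tau>) \<beta>)"
  proof (rule integral_transfer_weighted[where f="\<lambda>u. det_powr u \<beta>"
      and T="\<lambda>\<eta> :: real ^ 'm ^ 'k. mat 1 - gram \<eta>" and v="\<lambda>\<eta>. of_bool (posdef (mat 1 - gram \<eta>))" and S=inv_gram and w="\<lambda>\<tau>. det (mat 1 + gram \<tau>) powr e"])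
    fix f :: "real ^ 'm ^ 'm \<Rightarrow> ennreal" assume "f \<in> borel_measurable borel"
    from inv_gram_law[where 'k='k, OF this]
    show "(\<integral>\<^sup>+x. ennreal (of_bool (posdef (mat 1 - gram x))) * f (mat 1 - gram (x :: real ^ 'm ^ 'k)) \<partial>lborel)
      = (\<integral>\<^sup>+y. ennreal (det (mat 1 + gram (y :: real ^ 'm ^ 'k)) powr e) * f (inv_gram y) \<partial>lborel)"
      by (simp add: e_def of_bool_def if_distrib cong: if_cong)
  qed simp_all
  also have "\<dots> = (LINT \<tau>|lborel. complex_of_real (det (mat 1 + gram (\<tau> :: real ^ 'm ^ 'k))) powr (- z / 2))"
  proof (intro Bochner_Integration.integral_cong refl)
    fix \<tau> :: "real ^ 'm ^ 'k"
    show "complex_of_real (det (mat 1 + gram \<tau>) powr e) * det_powr (inv_gram \<tau>) \<beta> = complex_of_real (det (mat 1 + gram \<tau>)) powr (- z / 2)"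
      unfolding det_powr_inv_gram of_real_powr_real[OF det_one_add_gram_pos] powr_add[symmetric] C\<beta> ..
  qed
  finally show "(LINT \<eta>|lborel. det_powr_plus (mat 1 - gram (\<eta> :: real ^ 'm ^ 'k)) \<beta>) = chart_const TYPE('m) CARD('k) z"
    unfolding chart_integral(2)[OF z] chart_const_def .
qed

lemma det_powr_plus_conj:
  fixes s c :: "real ^ 'm ^ 'm"
  assumes "det c \<noteq> 0"
  shows "det_powr_plus (transpose c ** s ** c) \<alpha> = det_powr (gram c) \<alpha> * det_powr_plus s \<alpha>"
  unfolding det_powr_plus_def posdef_conj_iff[OF assms] by (simp add: det_powr_mult mult_ac)

text \<open>For \<open>A = gram r\<close>, substituting \<open>\<zeta> ** r\<close> reduces to the
  unit ball, and the scale raises the exponent from \<open>\<beta>\<close> to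
  \<open>\<gamma>\<close>, that is by k/2. Outside the cone both sides vanish, since adding
  \<open>gram \<eta>\<close> to a positive definite \<open>A - gram \<eta>\<close> would make
  \<open>A\<close> positive definite.\<close>

lemma ball_integral:
  fixes z :: complex and A :: "real ^ 'm ^ 'm"
  assumes z: "real CARD('k::finite) + real CARD('m) - 1 < Re z"
  defines "\<beta> \<equiv> (z - of_nat (CARD('k) + 1 + CARD('m))) / 2"
    and "\<gamma> \<equiv> (z - of_nat (1 + CARD('m))) / 2"
  shows "(\<integral>\<^sup>+\<eta>. ennreal (norm (det_powr_plus (A - gram (\<eta> :: real ^ 'm ^ 'k)) \<beta>)) \<partial>lborel)
      = ennreal (chart_const_real TYPE('m) CARD('k) (Re z) * norm (det_powr_plus A \<gamma>))"
    and "(LINT \<eta>|lborel. det_powr_plus (A - gram (\<eta> :: real ^ 'm ^ 'k)) \<beta>)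
      = chart_const TYPE('m) CARD('k) z * det_powr_plus A \<gamma>"
proof -
  have "(\<integral>\<^sup>+\<eta>. ennreal (norm (det_powr_plus (A - gram (\<eta> :: real ^ 'm ^ 'k)) \<beta>)) \<partial>lborel)
      = ennreal (chart_const_real TYPE('m) CARD('k) (Re z) * norm (det_powr_plus A \<gamma>)) \<and>
    (LINT \<eta>|lborel. det_powr_plus (A - gram (\<eta> :: real ^ 'm ^ 'k)) \<beta>)
      = chart_const TYPE('m) CARD('k) z * det_powr_plus A \<gamma>"
  proof (cases "posdef A")
    case False
    have "\<not> posdef (A - gram \<eta>)" for \<eta> :: "real ^ 'm ^ 'k"
      using posdef_add_gram[of "A - gram \<eta>" \<eta>] False by auto
    then show ?thesis using False by (simp add: det_powr_plus_def)
  next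
    case True
    obtain r where r: "A = gram r" "det r \<noteq> 0" using True by (rule posdef_obtain_root)
    have dA: "0 < det A" by (rule posdef_det_pos[OF True])
    define W where "W = \<bar>det r\<bar> ^ CARD('k)"
    have W0: "0 \<le> W" by (simp add: W_def)
    have W: "W = det A powr (real CARD('k) / 2)"
    proof -
      have "\<bar>det r\<bar> = det A powr (1/2)" using dA by (simp add: powr_half_sqrt r(1) det_mul real_sqrt_abs2)
      then show ?thesis using dA by (simp add: W_def powr_power)
    qed
    have W\<gamma>: "complex_of_real W * det_powr A \<beta> = det_powr_plus A \<gamma>"
    proof -
      have "complex_of_real W = complex_of_real (det A) powr (of_nat CARD('k) / 2)"
        using dA powr_of_real[of "det A" "real CARD('k) / 2"] by (simp add: W)
      then have "complex_of_real W * det_powr A \<beta> = complex_of_real (det A) powr (of_nat CARD('k) / 2 + \<beta>)"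
        using dA by (simp add: det_powr_def powr_add)
      also have "of_nat CARD('k) / 2 + \<beta> = \<gamma>" by (simp add: \<beta>_def \<gamma>_def field_simps)
      finally show ?thesis using True dA by (simp add: det_powr_plus_def det_powr_def)
    qed
    have sub: "det_powr_plus (A - gram (\<zeta> ** r)) \<beta> = det_powr A \<beta> * det_powr_plus (mat 1 - gram \<zeta>) \<beta>" for \<zeta> :: "real ^ 'm ^ 'k"
    proof -
      have "A - gram (\<zeta> ** r) = transpose r ** (mat 1 - gram \<zeta>) ** r"
        by (simp add: r(1) gram_mult matrix_diff_ldistrib matrix_diff_rdistrib)
      then show ?thesis by (simp only: det_powr_plus_conj[OF r(2)] r(1))
    qed
    have "(\<integral>\<^sup>+\<eta>. ennreal (norm (det_powr_plus (A - gram (\<eta> :: real ^ 'm ^ 'k)) \<beta>)) \<partial>lborel)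
      = ennreal W * (\<integral>\<^sup>+\<zeta>. ennreal (norm (det_powr_plus (A - gram ((\<zeta> :: real ^ 'm ^ 'k) ** r)) \<beta>)) \<partial>lborel)"
      unfolding W_def by (rule nn_integral_right_mult[OF r(2)]) measurable
    also have "\<dots> = ennreal W * (\<integral>\<^sup>+\<zeta>. ennreal (norm (det_powr A \<beta>)) * ennreal (norm (det_powr_plus (mat 1 - gram (\<zeta> :: real ^ 'm ^ 'k)) \<beta>)) \<partial>lborel)"
      unfolding sub by (simp add: norm_mult ennreal_mult')
    also have "\<dots> = ennreal W * (ennreal (norm (det_powr A \<beta>)) * ennreal (chart_const_real TYPE('m) CARD('k) (Re z)))"
      unfolding ball_integral_unit(1)[OF z, symmetric] \<beta>_def by (subst nn_integral_cmult) simp_all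
    also have "\<dots> = ennreal (chart_const_real TYPE('m) CARD('k) (Re z) * norm (complex_of_real W * det_powr A \<beta>))"
      using W0 chart_const_real_pos[OF z] by (simp add: norm_mult ennreal_mult'[symmetric] mult_ac)
    finally have nn: "(\<integral>\<^sup>+\<eta>. ennreal (norm (det_powr_plus (A - gram (\<eta> :: real ^ 'm ^ 'k)) \<beta>)) \<partial>lborel)
      = ennreal (chart_const_real TYPE('m) CARD('k) (Re z) * norm (det_powr_plus A \<gamma>))" unfolding W\<gamma> .
    have "(LINT \<eta>|lborel. det_powr_plus (A - gram (\<eta> :: real ^ 'm ^ 'k)) \<beta>)
      = (LINT \<zeta>|lborel. complex_of_real W * det_powr_plus (A - gram ((\<zeta> :: real ^ 'm ^ 'k) ** r)) \<beta>)"
    proof (rule integral_transfer[where T="\<lambda>y. y" and S="\<lambda>y. y ** r" and w="\<lambda>_. W" and M=lborel and N=lborel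
        and f="\<lambda>y. det_powr_plus (A - gram y) \<beta>"])
      fix f :: "real ^ 'm ^ 'k \<Rightarrow> ennreal" assume [measurable]: "f \<in> borel_measurable borel"
      show "(\<integral>\<^sup>+y. f y \<partial>lborel) = (\<integral>\<^sup>+y. ennreal W * f (y ** r) \<partial>lborel)"
        using nn_integral_right_mult[OF r(2), of f] by (simp add: nn_integral_cmult W_def)
    qed (simp_all add: W0, measurable)
    also have "\<dots> = (LINT \<zeta>|lborel. (complex_of_real W * det_powr A \<beta>) * det_powr_plus (mat 1 - gram (\<zeta> :: real ^ 'm ^ 'k)) \<beta>)"
      unfolding sub by (simp only: mult.assoc)
    also have "\<dots> = det_powr_plus A \<gamma> * chart_const TYPE('m) CARD('k) z"
      by (simp only: W\<gamma> integral_mult_right_zero ball_integral_unit(2)[OF z, folded \<beta>_def])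
    finally show ?thesis using nn by (simp only: mult.commute)
  qed
  then show "(\<integral>\<^sup>+\<eta>. ennreal (norm (det_powr_plus (A - gram (\<eta> :: real ^ 'm ^ 'k)) \<beta>)) \<partial>lborel)
      = ennreal (chart_const_real TYPE('m) CARD('k) (Re z) * norm (det_powr_plus A \<gamma>))"
    "(LINT \<eta>|lborel. det_powr_plus (A - gram (\<eta> :: real ^ 'm ^ 'k)) \<beta>)
      = chart_const TYPE('m) CARD('k) z * det_powr_plus A \<gamma>" by blast+
qed

text \<open>Conjugation by \<open>c\<close> turns the truncation at \<open>a\<close> into one of
  \<open>inv_gram \<tau>\<close> at \<open>a'\<close>. The factor with \<open>\<delta>\<close>
  brings the density to the exponent of \<open>inv_gram_law\<close>, after which the truncated
  matrix is \<open>(mat 1 - a') - gram \<eta>\<close> and \<open>ball_integral\<close> applies with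
  \<open>A = mat 1 - a'\<close>.\<close>

lemma chart_pair_truncated:
  fixes z :: complex and a :: "real ^ 'm ^ 'm"
  assumes z: "real CARD('k::finite) + real CARD('m) - 1 < Re z" and a: "posdef a"
    and d: "d = (real CARD('m) + 1) / 2" and \<delta>: "\<delta> = (N - real CARD('k)) / 2 - d"
  shows "chart_pair TYPE('k) N
    (\<lambda>u. det_powr u (- of_real \<delta>) * det_powr_plus (u - a) ((z - of_nat CARD('k)) / 2 - of_real d))
    (\<lambda>s. det_powr s (of_real d - of_real N / 2) * det_powr_plus (s - a) (z / 2 - of_real d))
    (chart_const_real TYPE('m) CARD('k) (Re z)) (chart_const TYPE('m) CARD('k) z)"
  unfolding chart_pair_def
proof (intro allI impI)
  fix c :: "real ^ 'm ^ 'm" assume c: "det c \<noteq> 0"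
  let ?w = "\<lambda>u. det_powr u (- of_real \<delta>) * det_powr_plus (u - a) ((z - of_nat CARD('k)) / 2 - of_real d)"
  let ?v = "det_powr (gram c) (of_real d - of_real N / 2) * det_powr_plus (gram c - a) (z / 2 - of_real d)"
  define \<beta> where "\<beta> = (z - of_nat (CARD('k) + 1 + CARD('m))) / 2"
  define \<gamma> where "\<gamma> = (z - of_nat (1 + CARD('m))) / 2"
  define e where "e = - real (CARD('k) + 1 + CARD('m)) / 2"
  define P where "P = det_powr (gram c) ((z - of_real N) / 2)"
  have \<beta>: "(z - of_nat CARD('k)) / 2 - of_real d = \<beta>" by (simp add: \<beta>_def d field_simps)
  have \<gamma>: "z / 2 - of_real d = \<gamma>" by (simp add: \<gamma>_def d field_simps)
  obtain b where cb: "c ** b = mat 1" "b ** c = mat 1" using c by (rule matrix_inverse_obtain)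
  define a' where "a' = transpose b ** a ** b"
  have a: "a = transpose c ** a' ** c"
  proof -
    have "transpose c ** a' ** c = transpose (b ** c) ** a ** (b ** c)"
      by (simp add: a'_def matrix_transpose_mul matrix_mul_assoc)
    then show ?thesis by (simp add: cb transpose_mat)
  qed
  have plus: "det_powr_plus (transpose c ** u ** c - a) \<alpha> = det_powr (gram c) \<alpha> * det_powr_plus (u - a') \<alpha>" for u \<alpha>
  proof -
    have "transpose c ** u ** c - a = transpose c ** (u - a') ** c"
      by (simp add: a matrix_diff_ldistrib matrix_diff_rdistrib)
    then show ?thesis by (simp only: det_powr_plus_conj[OF c])
  qed
  have v: "?v = P * det_powr_plus (mat 1 - a') \<gamma>"
  proof -
    have "det_powr_plus (gram c - a) \<gamma> = det_powr (gram c) \<gamma> * det_powr_plus (mat 1 - a') \<gamma>"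
      using plus[of "mat 1" \<gamma>] by simp
    moreover have "det_powr (gram c) (of_real d - of_real N / 2) * det_powr (gram c) \<gamma> = P"
      unfolding P_def det_powr_add[symmetric] by (rule arg_cong[where f="det_powr _"]) (simp add: \<gamma>_def d field_simps)
    ultimately show ?thesis unfolding \<gamma> by (simp only: mult.assoc[symmetric])
  qed
  have pt: "complex_of_real (det (mat 1 + gram \<tau>) powr (- N / 2)) * ?w (transpose c ** inv_gram \<tau> ** c)
    = P * (complex_of_real (det (mat 1 + gram \<tau>) powr e) * det_powr_plus (inv_gram \<tau> - a') \<beta>)" for \<tau> :: "real ^ 'm ^ 'k"
  proof -
    define D where "D = det (mat 1 + gram \<tau>)"
    have D: "0 < D" unfolding D_def by (rule det_one_add_gram_pos)
    have 1: "complex_of_real D powr of_real (- N / 2) * complex_of_real D powr (- (- of_real \<delta>)) = complex_of_real D powr of_real e"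
      unfolding powr_add[symmetric] by (rule arg_cong[where f="\<lambda>w. _ powr w"]) (simp add: e_def \<delta> d field_simps)
    have 2: "det_powr (gram c) (- of_real \<delta>) * det_powr (gram c) \<beta> = P"
      unfolding P_def det_powr_add[symmetric] by (rule arg_cong[where f="det_powr _"]) (simp add: \<beta>_def \<delta> d field_simps)
    have 3: "det_powr (transpose c ** inv_gram \<tau> ** c) (- of_real \<delta>) = det_powr (gram c) (- of_real \<delta>) * complex_of_real D powr (- (- of_real \<delta>))"
      unfolding det_powr_mult det_powr_inv_gram D_def by (simp only: mult_ac)
    show ?thesis
      unfolding \<beta> 3 plus D_def[symmetric] of_real_powr_real[OF D] 1[symmetric] 2[symmetric] by (simp only: mult_ac)
  qed
  let ?f = "\<lambda>u. det_powr_plus (u - a') \<beta>"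
  \<comment> \<open>The ball condition produced by \<open>inv_gram_law\<close> is implied by the
    truncation, because \<open>a'\<close> is positive definite with \<open>a\<close>.\<close>
  have pd: "posdef (mat 1 - gram \<eta>)" if "posdef (mat 1 - gram \<eta> - a')" for \<eta> :: "real ^ 'm ^ 'k"
  proof -
    have "posdef a'" using assms(2) posdef_conj_iff[OF c, of a'] a by simp
    then obtain h where h: "a' = gram h" "det h \<noteq> 0" by (rule posdef_obtain_root)
    show ?thesis using posdef_add_gram[OF that, of h] by (simp add: h(1))
  qed
  have bool: "of_bool (posdef (mat 1 - gram \<eta>)) * ?f (mat 1 - gram \<eta>) = det_powr_plus ((mat 1 - a') - gram \<eta>) \<beta>" for \<eta> :: "real ^ 'm ^ 'k"
  proof -
    have eq: "mat 1 - gram \<eta> - a' = (mat 1 - a') - gram \<eta>" by simp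
    show ?thesis using pd[of \<eta>] unfolding det_powr_plus_def eq by auto
  qed
  have "(\<integral>\<^sup>+\<tau>. chart_weight N (\<tau> :: real ^ 'm ^ 'k) * ennreal (norm (?w (transpose c ** inv_gram \<tau> ** c))) \<partial>lborel)
    = (\<integral>\<^sup>+\<tau>. ennreal (norm P) * (ennreal (det (mat 1 + gram (\<tau> :: real ^ 'm ^ 'k)) powr e) * ennreal (norm (?f (inv_gram \<tau>)))) \<partial>lborel)"
    unfolding chart_weight_norm pt by (simp add: norm_mult ennreal_mult')
  also have "\<dots> = ennreal (norm P) * (\<integral>\<^sup>+\<tau>. ennreal (det (mat 1 + gram (\<tau> :: real ^ 'm ^ 'k)) powr e) * ennreal (norm (?f (inv_gram \<tau>))) \<partial>lborel)"
    by (rule nn_integral_cmult) measurable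
  also have "(\<integral>\<^sup>+\<tau>. ennreal (det (mat 1 + gram (\<tau> :: real ^ 'm ^ 'k)) powr e) * ennreal (norm (?f (inv_gram \<tau>))) \<partial>lborel)
    = (\<integral>\<^sup>+\<eta>. of_bool (posdef (mat 1 - gram \<eta>)) * ennreal (norm (?f (mat 1 - gram (\<eta> :: real ^ 'm ^ 'k)))) \<partial>lborel)"
    unfolding e_def by (rule inv_gram_law) measurable
  also have "\<dots> = (\<integral>\<^sup>+\<eta>. ennreal (norm (det_powr_plus ((mat 1 - a') - gram (\<eta> :: real ^ 'm ^ 'k)) \<beta>)) \<partial>lborel)"
    unfolding bool[symmetric] by (intro nn_integral_cong) simp
  also have "\<dots> = ennreal (chart_const_real TYPE('m) CARD('k) (Re z) * norm (det_powr_plus (mat 1 - a') \<gamma>))"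
    unfolding \<beta>_def \<gamma>_def by (rule ball_integral(1)[OF z])
  also have "ennreal (norm P) * \<dots> = ennreal (chart_const_real TYPE('m) CARD('k) (Re z) * norm ?v)"
    unfolding v norm_mult by (simp add: ennreal_mult'[symmetric] mult_ac)
  finally have nn: "(\<integral>\<^sup>+\<tau>. chart_weight N (\<tau> :: real ^ 'm ^ 'k) * ennreal (norm (?w (transpose c ** inv_gram \<tau> ** c))) \<partial>lborel)
    = ennreal (chart_const_real TYPE('m) CARD('k) (Re z) * norm ?v)" .
  have "(LINT \<tau>|lborel. complex_of_real (det (mat 1 + gram (\<tau> :: real ^ 'm ^ 'k)) powr (- N / 2)) * ?w (transpose c ** inv_gram \<tau> ** c))
    = P * (LINT \<tau>|lborel. complex_of_real (det (mat 1 + gram (\<tau> :: real ^ 'm ^ 'k)) powr e) * ?f (inv_gram \<tau>))"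
    unfolding pt by (rule integral_mult_right_zero)
  also have "(LINT \<tau>|lborel. complex_of_real (det (mat 1 + gram (\<tau> :: real ^ 'm ^ 'k)) powr e) * ?f (inv_gram \<tau>))
    = (LINT \<eta>|lborel. complex_of_real (of_bool (posdef (mat 1 - gram \<eta>))) * ?f (mat 1 - gram (\<eta> :: real ^ 'm ^ 'k)))"
  proof (rule integral_transfer_weighted[where f="?f"
      and S="\<lambda>\<eta> :: real ^ 'm ^ 'k. mat 1 - gram \<eta>" and w="\<lambda>\<eta>. of_bool (posdef (mat 1 - gram \<eta>))" and T=inv_gram and v="\<lambda>\<tau>. det (mat 1 + gram \<tau>) powr e"])
    fix f :: "real ^ 'm ^ 'm \<Rightarrow> ennreal" assume "f \<in> borel_measurable borel"
    from inv_gram_law[where 'k='k, OF this]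
    show "(\<integral>\<^sup>+y. ennreal (det (mat 1 + gram (y :: real ^ 'm ^ 'k)) powr e) * f (inv_gram y) \<partial>lborel)
      = (\<integral>\<^sup>+x. ennreal (of_bool (posdef (mat 1 - gram x))) * f (mat 1 - gram (x :: real ^ 'm ^ 'k)) \<partial>lborel)"
      by (simp add: e_def of_bool_def if_distrib cong: if_cong)
  qed simp_all
  also have "\<dots> = (LINT \<eta>|lborel. det_powr_plus ((mat 1 - a') - gram (\<eta> :: real ^ 'm ^ 'k)) \<beta>)"
    unfolding bool[symmetric] of_real_of_bool ..
  also have "\<dots> = chart_const TYPE('m) CARD('k) z * det_powr_plus (mat 1 - a') \<gamma>"
    unfolding \<beta>_def \<gamma>_def by (rule ball_integral(2)[OF z])
  finally have "(LINT \<tau>|lborel. complex_of_real (det (mat 1 + gram (\<tau> :: real ^ 'm ^ 'k)) powr (- N / 2)) * ?w (transpose c ** inv_gram \<tau> ** c))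
    = chart_const TYPE('m) CARD('k) z * ?v" unfolding v by (simp only: mult_ac)
  with nn show "(\<integral>\<^sup>+\<tau>. chart_weight N (\<tau> :: real ^ 'm ^ 'k) * ennreal (norm (?w (transpose c ** inv_gram \<tau> ** c))) \<partial>lborel)
    = ennreal (chart_const_real TYPE('m) CARD('k) (Re z) * norm ?v) \<and>
    (LINT \<tau>|lborel. complex_of_real (det (mat 1 + gram (\<tau> :: real ^ 'm ^ 'k)) powr (- N / 2)) * ?w (transpose c ** inv_gram \<tau> ** c))
    = chart_const TYPE('m) CARD('k) z * ?v" by blast
qed


subsection \<open>The Radon transform\<close>

text \<open>Transitivity gives an orthogonal matrix. If its determinant is -1, it is composed with
  the reflection of one coordinate of the \<open>'k\<close> block, which fixes the standard
  frame.\<close>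

lemma frame_rotation:
  fixes \<xi> :: "real ^ 'l ^ ('k::finite + 'l::finite)"
  assumes "gram \<xi> = mat 1"
  shows "orthogonal_matrix (frame_rotation \<xi>)" "frame_rotation \<xi> ** stack 0 (mat 1) = \<xi>"
proof -
  obtain g where g: "orthogonal_matrix g" "g ** stack 0 (mat 1) = \<xi>"
    using gram_frame assms by (rule orthogonal_matrix_transitive)
  have "\<exists>g. orthogonal_matrix g \<and> det g = 1 \<and> g ** stack 0 (mat 1) = \<xi>"
  proof (cases "det g = 1")
    case False
    then have dg: "det g = - 1" using det_orthogonal_matrix[OF g(1)] by auto
    define s :: "'k + 'l \<Rightarrow> real" where "s i = (if i = Inl undefined then - 1 else 1)" for i
    define r :: "real ^ ('k + 'l) ^ ('k + 'l)" where "r = (\<chi> i j. if i = j then s i else 0)"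
    have rm: "(r ** M) $ i $ j = s i * M $ i $ j" for M :: "real ^ 'z::finite ^ ('k + 'l)" and i j
    proof -
      have "(r ** M) $ i $ j = (\<Sum>a\<in>UNIV. if a = i then s i * M $ i $ j else 0)"
        unfolding matrix_matrix_mult_def vec_lambda_beta by (rule sum.cong) (auto simp: r_def)
      then show ?thesis by (simp add: sum.delta)
    qed
    have "transpose r = r" by (auto simp: r_def transpose_def vec_eq_iff)
    moreover have "r ** r = mat 1"
      by (auto simp: vec_eq_iff rm) (auto simp: r_def s_def mat_def)
    ultimately have "orthogonal_matrix r" by (simp add: orthogonal_matrix)
    moreover have "det r = - 1"
      by (subst det_diagonal) (auto simp: r_def s_def prod.delta)
    moreover have "r ** stack 0 (mat 1) = (stack 0 (mat 1) :: real ^ 'l ^ ('k + 'l))"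
    proof -
      have "(r ** stack 0 (mat 1)) $ i $ j = (stack 0 (mat 1) :: real ^ 'l ^ ('k + 'l)) $ i $ j" for i j
        by (cases i) (auto simp: rm s_def)
      then show ?thesis by (simp add: vec_eq_iff)
    qed
    ultimately have "orthogonal_matrix (g ** r)" "det (g ** r) = 1" "g ** r ** stack 0 (mat 1) = \<xi>"
      using g dg by (simp_all add: orthogonal_matrix_mul det_mul matrix_mul_assoc[symmetric])
    then show ?thesis by blast
  qed (use g in blast)
  then have "orthogonal_matrix (frame_rotation \<xi>) \<and> det (frame_rotation \<xi>) = 1 \<and> frame_rotation \<xi> ** stack 0 (mat 1) = \<xi>"
    unfolding frame_rotation_def by (rule someI_ex)
  then show "orthogonal_matrix (frame_rotation \<xi>)" "frame_rotation \<xi> ** stack 0 (mat 1) = \<xi>" by blast+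
qed

lemma integral_orthogonal_left:
  fixes g :: "real ^ 'n ^ 'n" and f :: "real ^ 'm ^ 'n \<Rightarrow> complex"
  assumes g: "orthogonal_matrix g" and f: "f \<in> borel_measurable borel"
  shows "(LINT x|lborel. f (g ** x)) = (LINT x|lborel. f x)"
proof -
  have "(LINT x|lborel. f (g ** x)) = (LINT x|lborel. complex_of_real 1 * f x)"
  proof (rule integral_transfer[where T="\<lambda>x. g ** x" and S="\<lambda>x. x" and w="\<lambda>_. 1"])
    fix h :: "real ^ 'm ^ 'n \<Rightarrow> ennreal" assume "h \<in> borel_measurable borel"
    from nn_integral_orthogonal_left[OF g this]
    show "(\<integral>\<^sup>+x. h (g ** x) \<partial>lborel) = (\<integral>\<^sup>+x. ennreal 1 * h x \<partial>lborel)" by simp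
  qed (use f in simp_all)
  then show ?thesis by simp
qed

lemma integral_stack:
  fixes f :: "real ^ 'm ^ ('k::finite + 'l::finite) \<Rightarrow> complex"
  assumes f [measurable]: "f \<in> borel_measurable borel" and fin: "(\<integral>\<^sup>+x. ennreal (norm (f x)) \<partial>lborel) < \<infinity>"
  shows "(LINT x|lborel. f x) = (LINT t|lborel. LINT \<omega>|lborel. f (stack \<omega> t))"
proof -
  have "(LINT x|lborel. f x) = (LINT p|(lborel \<Otimes>\<^sub>M lborel). f (stack (fst p) (snd p)))"
    by (subst lborel_stack[symmetric], subst integral_distr) (simp_all add: case_prod_unfold)
  also have "\<dots> = (LINT t|lborel. LINT \<omega>|lborel. f (stack \<omega> t))"
  proof -
    have "integrable (lborel \<Otimes>\<^sub>M lborel) (case_prod (\<lambda>\<omega> t. f (stack \<omega> t)))"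
    proof (rule integrableI_bounded)
      show "case_prod (\<lambda>\<omega> t. f (stack \<omega> t)) \<in> borel_measurable (lborel \<Otimes>\<^sub>M lborel)"
        by (simp add: case_prod_unfold)
      have "(\<integral>\<^sup>+p. ennreal (norm (case_prod (\<lambda>\<omega> t. f (stack \<omega> t)) p)) \<partial>(lborel \<Otimes>\<^sub>M lborel)) = (\<integral>\<^sup>+x. ennreal (norm (f x)) \<partial>lborel)"
        by (subst lborel.nn_integral_fst[symmetric]) (simp_all add: nn_integral_stack case_prod_unfold)
      then show "(\<integral>\<^sup>+p. ennreal (norm (case_prod (\<lambda>\<omega> t. f (stack \<omega> t)) p)) \<partial>(lborel \<Otimes>\<^sub>M lborel)) < \<infinity>"
        using fin by simp
    qed
    from lborel_pair.integral_snd[OF this] show ?thesis by (simp add: case_prod_unfold)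
  qed
  finally show ?thesis .
qed

lemma nn_integral_stack_swap:
  fixes f :: "real ^ 'm ^ ('k::finite + 'l::finite) \<Rightarrow> ennreal"
  assumes [measurable]: "f \<in> borel_measurable borel"
  shows "(\<integral>\<^sup>+x. f x \<partial>lborel) = (\<integral>\<^sup>+t. \<integral>\<^sup>+\<omega>. f (stack \<omega> t) \<partial>lborel \<partial>lborel)"
  unfolding nn_integral_stack[OF assms] by (intro nn_integral_lborel_swap) measurable

section \<open>Passage between Lebesgue and Borel measurable functions\<close>

lemma borel_measurable_lebesgue_AE:
  fixes f g :: "'a::euclidean_space \<Rightarrow> complex"
  assumes [measurable]: "g \<in> borel_measurable borel" and AE: "AE x in lborel. f x = g x"
  shows "f \<in> borel_measurable lebesgue"
proof -
  have "g \<in> borel_measurable lebesgue" by (rule measurable_completion) simp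
  have "f -` S \<inter> space lebesgue \<in> sets lebesgue" if [measurable]: "S \<in> sets borel" for S
  proof -
    have gS: "g -` S \<inter> space lebesgue \<in> sets lebesgue"
      using \<open>g \<in> borel_measurable lebesgue\<close> that by (rule measurable_sets)
    have "AE x in lebesgue. x \<in> f -` S \<inter> space lebesgue \<longleftrightarrow> x \<in> g -` S \<inter> space lebesgue"
      using AE_completion[OF AE] by eventually_elim auto
    then show ?thesis
      using completion.in_sets_AE[of "g -` S \<inter> space lebesgue" "f -` S \<inter> space lebesgue" lborel] gS
      by (auto simp: eq_commute)
  qed
  then show ?thesis by (intro measurableI) auto
qed

lemma integral_lebesgue_cong_AE:
  fixes f g :: "'a::euclidean_space \<Rightarrow> complex"
  assumes g [measurable]: "g \<in> borel_measurable borel" and AE: "AE x in lborel. f x = g x"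
  shows "(LINT x|lebesgue. f x) = (LINT x|lborel. g x)"
proof -
  have "(LINT x|lebesgue. f x) = (LINT x|lebesgue. g x)"
    by (rule integral_cong_AE[OF borel_measurable_lebesgue_AE[OF assms] _ AE_completion[OF AE]])
      (rule measurable_completion, simp)
  also have "\<dots> = (LINT x|lborel. g x)" by (rule integral_completion) simp
  finally show ?thesis .
qed

lemma lebesgue_measurable_obtain_borel:
  fixes f :: "'a::euclidean_space \<Rightarrow> complex"
  assumes f: "f \<in> borel_measurable lebesgue"
  obtains f0 where "f0 \<in> borel_measurable borel" "AE x in lborel. f x = f0 x"
proof -
  have "(\<lambda>x. Re (f x)) \<in> borel_measurable lebesgue" "(\<lambda>x. Im (f x)) \<in> borel_measurable lebesgue"
    using f by measurable
  then obtain u v where u: "u \<in> borel_measurable lborel" "AE x in lborel. Re (f x) = u x"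
    and v: "v \<in> borel_measurable lborel" "AE x in lborel. Im (f x) = v x"
    by (metis completion_ex_borel_measurable_real)
  show ?thesis
  proof
    have [measurable]: "u \<in> borel_measurable borel" "v \<in> borel_measurable borel" using u v by simp_all
    have "(\<lambda>x. complex_of_real (u x) + \<i> * complex_of_real (v x)) \<in> borel_measurable borel" by measurable
    then show "(\<lambda>x. complex_of_real (u x) + \<i> * complex_of_real (v x)) \<in> borel_measurable borel" .
    show "AE x in lborel. f x = complex_of_real (u x) + \<i> * complex_of_real (v x)"
      using u(2) v(2) by eventually_elim (metis complex_eq)
  qed
qed

text \<open>A null set of the full space meets almost every fibre in a null set. Hence the Radon
  transform along a fixed frame changes only for a null set of \<open>t\<close> when
  \<open>f\<close> is replaced by a Borel representative.\<close>

lemma AE_stack_rotated: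
  fixes u :: "real ^ ('k::finite + 'l::finite) ^ ('k + 'l)" and P :: "real ^ 'm ^ ('k + 'l) \<Rightarrow> bool"
  assumes u: "orthogonal_matrix u" and P: "AE x in lborel. P x"
  shows "AE t in lborel. AE \<omega> in lborel. P (u ** stack \<omega> t)"
proof -
  obtain N where N: "{x \<in> space lborel. \<not> P x} \<subseteq> N" "emeasure lborel N = 0" "N \<in> sets lborel"
    using P by (rule AE_E)
  then have [measurable]: "N \<in> sets borel" by simp
  have "(\<integral>\<^sup>+t. \<integral>\<^sup>+\<omega>. indicator N (u ** stack \<omega> t) \<partial>lborel \<partial>lborel) = (\<integral>\<^sup>+x. indicator N (u ** x) \<partial>lborel)"
    by (rule nn_integral_stack_swap[symmetric]) measurable
  also have "\<dots> = (\<integral>\<^sup>+x. indicator N x \<partial>lborel)"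
    by (rule nn_integral_orthogonal_left[OF u]) measurable
  finally have "(\<integral>\<^sup>+t. \<integral>\<^sup>+\<omega>. indicator N (u ** stack \<omega> t) \<partial>lborel \<partial>lborel) = 0" using N by simp
  then have "AE t in lborel. (\<integral>\<^sup>+\<omega>. indicator N (u ** stack \<omega> t) \<partial>lborel) = (0::ennreal)"
    by (subst (asm) nn_integral_0_iff_AE) measurable
  then show ?thesis
  proof eventually_elim
    case (elim t)
    then have "AE \<omega> in lborel. indicator N (u ** stack \<omega> t) = (0::ennreal)"
      by (subst (asm) nn_integral_0_iff_AE) measurable
    then show ?case
      by eventually_elim (use N(1) in \<open>auto simp: indicator_def split: if_splits\<close>)
  qed
qed

text \<open>A formula for the Radon transform which does not mention the rotation, and so shows that
  it is measurable in \<open>\<xi>\<close>: \<open>z\<close> is averaged over the fibres of \<open>z \<mapsto> transpose \<xi> ** z\<close>.\<close>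

lemma radon_fibre_formula:
  fixes \<xi> :: "real ^ 'l ^ ('k::finite + 'l::finite)" and f :: "real ^ 'm ^ ('k + 'l) \<Rightarrow> complex" and t :: "real ^ 'm ^ 'l"
  assumes \<xi>: "gram \<xi> = mat 1" and f: "f \<in> borel_measurable borel"
  shows "(LINT \<omega>|lborel. f (frame_rotation \<xi> ** stack \<omega> t))
    = (LINT z|lborel. complex_of_real (enn2real (unit_box (transpose \<xi> ** z))) * f (\<xi> ** t + z - \<xi> ** (transpose \<xi> ** z)))"
proof -
  define u where "u = frame_rotation \<xi>"
  have u: "orthogonal_matrix u" "u ** stack 0 (mat 1) = \<xi>"
    using frame_rotation[OF \<xi>] by (simp_all add: u_def)
  have uu: "transpose u ** u = mat 1" using u(1) by (simp add: orthogonal_matrix)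
  have \<xi>u: "transpose \<xi> ** (u ** stack \<omega> s) = s" for \<omega> :: "real ^ 'm ^ 'k" and s :: "real ^ 'm ^ 'l"
  proof -
    have "transpose \<xi> ** (u ** stack \<omega> s) = transpose (stack 0 (mat 1)) ** (transpose u ** u) ** stack \<omega> s"
      by (simp only: u(2)[symmetric] matrix_transpose_mul matrix_mul_assoc)
    then show ?thesis by (simp add: uu frame_transpose_stack)
  qed
  have \<xi>t: "\<xi> ** s = u ** stack 0 s" for s :: "real ^ 'm ^ 'l"
  proof -
    have "stack 0 (mat 1) ** s = (stack 0 s :: real ^ 'm ^ ('k + 'l))"
    proof -
      have "(stack 0 (mat 1) ** s) $ i $ j = (stack 0 s :: real ^ 'm ^ ('k + 'l)) $ i $ j" for i j
        by (cases i) (simp_all add: matrix_matrix_mult_def mat_def if_distrib[of "\<lambda>c. c * _"] cong: if_cong)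
      then show ?thesis by (simp add: vec_eq_iff)
    qed
    then show ?thesis by (simp add: u(2)[symmetric] matrix_mul_assoc[symmetric])
  qed
  have st: "stack 0 t + stack \<omega> s - stack 0 s = stack \<omega> t" for \<omega> :: "real ^ 'm ^ 'k" and s t :: "real ^ 'm ^ 'l"
  proof -
    have "(stack 0 t + stack \<omega> s - stack 0 s) $ i = stack \<omega> t $ i" for i by (cases i) simp_all
    then show ?thesis by (simp add: vec_eq_iff)
  qed
  have arg: "\<xi> ** t + u ** stack \<omega> s - \<xi> ** s = u ** stack \<omega> t" for \<omega> :: "real ^ 'm ^ 'k" and s :: "real ^ 'm ^ 'l"
    unfolding \<xi>t by (simp only: matrix_add_ldistrib[symmetric] matrix_diff_ldistrib[symmetric] st)
  have box: "ennreal (enn2real (unit_box y)) = unit_box y" for y :: "real ^ 'm ^ 'l"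
    by (simp add: unit_box_def indicator_def)
  have "(LINT \<omega>|lborel. f (u ** stack \<omega> t)) = (LINT z|lborel. complex_of_real (enn2real (unit_box (transpose \<xi> ** z))) * f (\<xi> ** t + z - \<xi> ** (transpose \<xi> ** z)))"
  \<comment> \<open>The box is a weight of mass 1 in the component \<open>s\<close> of
    \<open>z\<close>; the argument of \<open>f\<close> replaces that component by \<open>t\<close>
    and retains \<open>\<omega>\<close>.\<close>
  proof (rule integral_transfer[where T="\<lambda>\<omega>. u ** stack \<omega> t" and S="\<lambda>z. \<xi> ** t + z - \<xi> ** (transpose \<xi> ** z)"
      and w="\<lambda>z. enn2real (unit_box (transpose \<xi> ** z))"])
    fix h :: "real ^ 'm ^ ('k + 'l) \<Rightarrow> ennreal" assume [measurable]: "h \<in> borel_measurable borel"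
    have "(\<integral>\<^sup>+z. ennreal (enn2real (unit_box (transpose \<xi> ** z))) * h (\<xi> ** t + z - \<xi> ** (transpose \<xi> ** z)) \<partial>lborel)
      = (\<integral>\<^sup>+z. unit_box (transpose \<xi> ** z) * h (\<xi> ** t + z - \<xi> ** (transpose \<xi> ** z)) \<partial>lborel)"
      by (simp only: box)
    also have "\<dots> = (\<integral>\<^sup>+z. unit_box (transpose \<xi> ** (u ** z)) * h (\<xi> ** t + u ** z - \<xi> ** (transpose \<xi> ** (u ** z))) \<partial>lborel)"
      by (rule nn_integral_orthogonal_left[OF u(1), symmetric]) measurable
    also have "\<dots> = (\<integral>\<^sup>+\<omega>. \<integral>\<^sup>+s. unit_box (transpose \<xi> ** (u ** stack \<omega> s)) *
        h (\<xi> ** t + u ** stack \<omega> s - \<xi> ** (transpose \<xi> ** (u ** stack \<omega> s))) \<partial>lborel \<partial>lborel)"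
      by (rule nn_integral_stack) measurable
    also have "\<dots> = (\<integral>\<^sup>+\<omega>. \<integral>\<^sup>+s. unit_box (s :: real ^ 'm ^ 'l) * h (u ** stack \<omega> t) \<partial>lborel \<partial>lborel)"
      by (simp only: \<xi>u arg)
    also have "\<dots> = (\<integral>\<^sup>+\<omega>. h (u ** stack \<omega> t) \<partial>lborel)"
      by (simp add: nn_integral_multc)
    finally show "(\<integral>\<^sup>+\<omega>. h (u ** stack \<omega> t) \<partial>lborel)
      = (\<integral>\<^sup>+z. ennreal (enn2real (unit_box (transpose \<xi> ** z))) * h (\<xi> ** t + z - \<xi> ** (transpose \<xi> ** z)) \<partial>lborel)" by simp
  qed (use f in simp_all)
  then show ?thesis by (simp add: u_def)
qed


section \<open>The transform integrated over the Stiefel manifold\<close>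

context stiefel_law
begin

text \<open>The constant \<open>\<kappa>\<close> is the total mass of the chart density with
  exponent \<open>n\<close>, so \<open>\<sigma> / \<kappa>\<close> normalises the law of the
  projected Gram matrix. That mass is finite because \<open>ml\<close> gives k + m - 1 < n.\<close>

lemma kernel_of_chart_pair:
  fixes x :: "real ^ 'm ^ ('k + 'l)" and w v :: "real ^ 'm ^ 'm \<Rightarrow> complex"
  assumes ml: "CARD('m) \<le> CARD('l)" and pair: "chart_pair TYPE('k) (real CARD('k) + real CARD('l)) w v Kr Kc"
    and [measurable]: "w \<in> borel_measurable borel" and x: "posdef (gram x)"
  defines "\<kappa> \<equiv> chart_const_real TYPE('m) CARD('k) (real CARD('k) + real CARD('l))"
  shows "(\<integral>\<^sup>+\<xi>. ennreal (norm (w (gram (transpose \<xi> ** x)))) \<partial>\<mu>) = ennreal (\<sigma> / \<kappa> * Kr) * ennreal (norm (v (gram x)))"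
    and "(LINT \<xi>|\<mu>. w (gram (transpose \<xi> ** x))) = of_real \<sigma> * (Kc / of_real \<kappa>) * v (gram x)"
proof -
  define N where "N = real CARD('k) + real CARD('l)"
  have z: "real CARD('k) + real CARD('m) - 1 < Re (complex_of_real N)" using ml by (simp add: N_def)
  have \<kappa>: "0 < \<kappa>" using chart_const_real_pos[of "CARD('k)" N, where 'm='m] z by (simp add: \<kappa>_def N_def)
  obtain c where c: "gram x = gram c" "det c \<noteq> 0" using x by (rule posdef_obtain_root)
  have A1: "(\<integral>\<^sup>+\<tau>. chart_weight N (\<tau> :: real ^ 'm ^ 'k) \<partial>lborel) = ennreal \<kappa>"
    using chart_integral(1)[OF z] by (simp add: \<kappa>_def chart_const_real_def N_def)
  have law: "(\<integral>\<^sup>+\<xi>. g (gram (transpose \<xi> ** x)) \<partial>\<mu>)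
    = ennreal (\<sigma> / \<kappa>) * (\<integral>\<^sup>+\<tau>. chart_weight N (\<tau> :: real ^ 'm ^ 'k) * g (transpose c ** inv_gram \<tau> ** c) \<partial>lborel)"
    if [measurable]: "g \<in> borel_measurable borel" for g :: "real ^ 'm ^ 'm \<Rightarrow> ennreal"
  proof -
    let ?X = "\<integral>\<^sup>+\<xi>. g (gram (transpose \<xi> ** x)) \<partial>\<mu>"
    let ?Y = "\<integral>\<^sup>+\<tau>. chart_weight N (\<tau> :: real ^ 'm ^ 'k) * g (transpose c ** inv_gram \<tau> ** c) \<partial>lborel"
    have "?X * ennreal \<kappa> = ennreal \<sigma> * ?Y"
      using gram_law[OF ml c that] by (simp add: A1[unfolded N_def] N_def)
    then have "ennreal (1 / \<kappa>) * (?X * ennreal \<kappa>) = ennreal (1 / \<kappa>) * (ennreal \<sigma> * ?Y)" by simp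
    moreover have "ennreal (1 / \<kappa>) * (?X * ennreal \<kappa>) = (ennreal (1 / \<kappa>) * ennreal \<kappa>) * ?X" by (simp only: mult_ac)
    moreover have "ennreal (1 / \<kappa>) * ennreal \<kappa> = 1" using \<kappa> by (simp add: ennreal_mult'[symmetric])
    moreover have "ennreal (1 / \<kappa>) * (ennreal \<sigma> * ?Y) = ennreal (\<sigma> / \<kappa>) * ?Y"
      using \<kappa> by (simp add: mult.assoc[symmetric] ennreal_mult'[symmetric])
    ultimately show ?thesis by simp
  qed
  have pr: "(\<integral>\<^sup>+\<tau>. chart_weight N (\<tau> :: real ^ 'm ^ 'k) * ennreal (norm (w (transpose c ** inv_gram \<tau> ** c))) \<partial>lborel)
       = ennreal (Kr * norm (v (gram x)))"
    "(LINT \<tau>|lborel. complex_of_real (det (mat 1 + gram (\<tau> :: real ^ 'm ^ 'k)) powr (- N / 2)) * w (transpose c ** inv_gram \<tau> ** c))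
       = Kc * v (gram x)"
    using pair c unfolding chart_pair_def N_def by auto
  have "(\<integral>\<^sup>+\<xi>. ennreal (norm (w (gram (transpose \<xi> ** x)))) \<partial>\<mu>) = ennreal (\<sigma> / \<kappa>) * ennreal (Kr * norm (v (gram x)))"
    using law[of "\<lambda>u. ennreal (norm (w u))"] by (simp add: pr(1))
  also have "\<dots> = ennreal (\<sigma> / \<kappa> * Kr) * ennreal (norm (v (gram x)))"
    using \<kappa> sigma_pos by (simp add: ennreal_mult'[symmetric] ennreal_mult''[symmetric] mult.assoc)
  finally show "(\<integral>\<^sup>+\<xi>. ennreal (norm (w (gram (transpose \<xi> ** x)))) \<partial>\<mu>) = ennreal (\<sigma> / \<kappa> * Kr) * ennreal (norm (v (gram x)))" .
  have "(LINT \<xi>|\<mu>. w (gram (transpose \<xi> ** x)))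
    = (LINT \<tau>|lborel. complex_of_real (\<sigma> / \<kappa> * det (mat 1 + gram (\<tau> :: real ^ 'm ^ 'k)) powr (- N / 2)) * w (transpose c ** inv_gram \<tau> ** c))"
  proof (rule integral_transfer[where T="\<lambda>\<xi>. gram (transpose \<xi> ** x)" and S="\<lambda>\<tau>. transpose c ** inv_gram \<tau> ** c"
      and w="\<lambda>\<tau>. \<sigma> / \<kappa> * det (mat 1 + gram \<tau>) powr (- N / 2)" and f=w])
    fix g :: "real ^ 'm ^ 'm \<Rightarrow> ennreal" assume [measurable]: "g \<in> borel_measurable borel"
    have "ennreal (\<sigma> / \<kappa> * det (mat 1 + gram \<tau>) powr (- N / 2)) * g (transpose c ** inv_gram \<tau> ** c)
        = ennreal (\<sigma> / \<kappa>) * (chart_weight N \<tau> * g (transpose c ** inv_gram \<tau> ** c))" for \<tau> :: "real ^ 'm ^ 'k"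
    proof -
      have "ennreal (\<sigma> / \<kappa> * D) = ennreal (\<sigma> / \<kappa>) * ennreal D" for D
        by (rule ennreal_mult') (use \<kappa> sigma_pos in simp)
      then show ?thesis by (simp only: chart_weight_def mult.assoc)
    qed
    then show "(\<integral>\<^sup>+\<xi>. g (gram (transpose \<xi> ** x)) \<partial>\<mu>)
      = (\<integral>\<^sup>+\<tau>. ennreal (\<sigma> / \<kappa> * det (mat 1 + gram (\<tau> :: real ^ 'm ^ 'k)) powr (- N / 2)) * g (transpose c ** inv_gram \<tau> ** c) \<partial>lborel)"
      by (simp add: law nn_integral_cmult)
  qed (use \<kappa> sigma_pos in simp_all)
  also have "\<dots> = (LINT \<tau>|lborel. complex_of_real (\<sigma> / \<kappa>) *
      (complex_of_real (det (mat 1 + gram (\<tau> :: real ^ 'm ^ 'k)) powr (- N / 2)) * w (transpose c ** inv_gram \<tau> ** c)))"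
    by (simp only: of_real_mult mult.assoc)
  also have "\<dots> = complex_of_real (\<sigma> / \<kappa>) * (Kc * v (gram x))"
    unfolding integral_mult_right_zero pr(2) ..
  finally show "(LINT \<xi>|\<mu>. w (gram (transpose \<xi> ** x))) = of_real \<sigma> * (Kc / of_real \<kappa>) * v (gram x)" by simp
qed

text \<open>Since \<open>transpose \<xi> ** (frame_rotation \<xi> ** stack \<omega> t)\<close> is
  \<open>t\<close>, the weight at \<open>t\<close> becomes a kernel in \<open>\<xi>\<close> and
  \<open>x\<close>, and Fubini exchanges these two. In absolute values this gives the function side
  times \<open>Cr\<close>; as \<open>Cr\<close> is positive and finite, both sides exist
  together.\<close>

lemma radon_identity_of_kernel:
  fixes f :: "real ^ 'm ^ ('k + 'l) \<Rightarrow> complex" and w v :: "real ^ 'm ^ 'm \<Rightarrow> complex"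
  assumes ml: "CARD('m) \<le> CARD('l)" and f: "f \<in> borel_measurable lebesgue"
    and w [measurable]: "w \<in> borel_measurable borel" and v [measurable]: "v \<in> borel_measurable borel"
    and Cr: "0 < Cr"
    and K1: "\<And>x :: real ^ 'm ^ ('k + 'l). posdef (gram x) \<Longrightarrow>
      (\<integral>\<^sup>+\<xi>. ennreal (norm (w (gram (transpose \<xi> ** x)))) \<partial>\<mu>) = ennreal Cr * ennreal (norm (v (gram x)))"
    and K2: "\<And>x :: real ^ 'm ^ ('k + 'l). posdef (gram x) \<Longrightarrow>
      (LINT \<xi>|\<mu>. w (gram (transpose \<xi> ** x))) = of_real \<sigma> * C * v (gram x)"
  shows "radon_identity \<sigma> \<mu> f (\<lambda>t. w (gram t)) C (\<lambda>x. v (gram x))"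
proof -
  interpret \<mu>: sigma_finite_measure \<mu> by (rule sigma_finite_mu)
  interpret M: pair_sigma_finite \<mu> "lborel :: (real ^ 'm ^ ('k + 'l)) measure" ..
  obtain f0 where f0 [measurable]: "f0 \<in> borel_measurable borel" and ff0: "AE x in lborel. f x = f0 x"
    using f by (rule lebesgue_measurable_obtain_borel)
  have pdAE: "AE x :: real ^ 'm ^ ('k + 'l) in lborel. posdef (gram x)"
    by (rule AE_posdef_gram) (use ml in simp)
  define U where "U \<xi> x = w (gram (transpose \<xi> ** x))" for \<xi> :: "real ^ 'l ^ ('k + 'l)" and x :: "real ^ 'm ^ ('k + 'l)"
  have U_meas [measurable]: "(\<lambda>y. U (a y) (b y)) \<in> borel_measurable M"
    if [measurable]: "a \<in> borel_measurable M" "b \<in> borel_measurable M" for a b and M :: "'z measure"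
    unfolding U_def by measurable
  \<comment> \<open>The transform is defined through an arbitrary choice of rotation, from which no
    measurability in \<open>\<xi>\<close> can be read. \<open>R\<close> is a version of it that is
    jointly Borel in \<open>\<xi>\<close> and \<open>t\<close>.\<close>
  define R where "R \<xi> t = (LINT z|lborel. complex_of_real (enn2real (unit_box (transpose \<xi> ** z))) * f0 (\<xi> ** t + z - \<xi> ** (transpose \<xi> ** z)))"
    for \<xi> :: "real ^ 'l ^ ('k + 'l)" and t :: "real ^ 'm ^ 'l"
  have R_meas0: "(\<lambda>p. R (fst p) (snd p)) \<in> borel_measurable (borel \<Otimes>\<^sub>M borel)"
    unfolding R_def by measurable
  have R_meas [measurable]: "(\<lambda>y. R (a y) (b y)) \<in> borel_measurable M"
    if [measurable]: "a \<in> borel_measurable M" "b \<in> borel_measurable M" for a b and M :: "'z measure"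
  proof -
    have "(\<lambda>y. (a y, b y)) \<in> measurable M (borel \<Otimes>\<^sub>M borel)" by measurable
    from measurable_compose[OF this R_meas0] show ?thesis by simp
  qed
  have gram\<xi>: "gram \<xi> = mat 1" if "\<xi> \<in> space \<mu>" for \<xi>
    using that by (simp add: space_mu stiefel_def)
  have U_stack: "U \<xi> (frame_rotation \<xi> ** stack \<omega> t) = w (gram t)" if "\<xi> \<in> space \<mu>" for \<xi> \<omega> t
  proof -
    note u = frame_rotation[OF gram\<xi>[OF that]]
    have uu: "transpose (frame_rotation \<xi>) ** frame_rotation \<xi> = mat 1" using u(1) by (simp add: orthogonal_matrix)
    have "transpose \<xi> ** (frame_rotation \<xi> ** stack \<omega> t)
      = transpose (stack 0 (mat 1)) ** (transpose (frame_rotation \<xi>) ** frame_rotation \<xi>) ** stack \<omega> t"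
      by (subst u(2)[symmetric]) (simp only: matrix_transpose_mul matrix_mul_assoc)
    then show ?thesis by (simp add: U_def uu frame_transpose_stack)
  qed
  have radonR: "AE t in lborel. radon f \<xi> t = R \<xi> t" if "\<xi> \<in> space \<mu>" for \<xi>
    using AE_stack_rotated[OF frame_rotation(1)[OF gram\<xi>[OF that]] ff0]
  proof eventually_elim
    case (elim t)
    have "radon f \<xi> t = (LINT \<omega>|lborel. f0 (frame_rotation \<xi> ** stack \<omega> t))"
      unfolding radon_def by (rule integral_lebesgue_cong_AE[OF _ elim]) measurable
    then show ?case unfolding R_def radon_fibre_formula[OF gram\<xi>[OF that] f0] .
  qed
  have nnside: "(\<integral>\<^sup>+t. radon_abs f \<xi> t * ennreal (norm (w (gram t))) \<partial>lebesgue)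
    = (\<integral>\<^sup>+x. ennreal (norm (f0 x * U \<xi> x)) \<partial>lborel)" if \<xi>: "\<xi> \<in> space \<mu>" for \<xi>
  proof -
    note u = frame_rotation(1)[OF gram\<xi>[OF \<xi>]]
    have "(\<integral>\<^sup>+t. radon_abs f \<xi> t * ennreal (norm (w (gram t))) \<partial>lebesgue)
      = (\<integral>\<^sup>+t. (\<integral>\<^sup>+\<omega>. ennreal (norm (f0 (frame_rotation \<xi> ** stack \<omega> t))) \<partial>lborel) * ennreal (norm (w (gram t))) \<partial>lborel)"
      unfolding nn_integral_completion
    proof (rule nn_integral_cong_AE)
      show "AE t in lborel. radon_abs f \<xi> t * ennreal (norm (w (gram t)))
        = (\<integral>\<^sup>+\<omega>. ennreal (norm (f0 (frame_rotation \<xi> ** stack \<omega> t))) \<partial>lborel) * ennreal (norm (w (gram t)))"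
        using AE_stack_rotated[OF u ff0]
      proof eventually_elim
        case (elim t)
        have "radon_abs f \<xi> t = (\<integral>\<^sup>+\<omega>. ennreal (norm (f0 (frame_rotation \<xi> ** stack \<omega> t))) \<partial>lborel)"
          unfolding radon_abs_def nn_integral_completion
          by (rule nn_integral_cong_AE) (use elim in eventually_elim, simp)
        then show ?case by simp
      qed
    qed
    also have "\<dots> = (\<integral>\<^sup>+t. \<integral>\<^sup>+\<omega>. ennreal (norm (f0 (frame_rotation \<xi> ** stack \<omega> t) * U \<xi> (frame_rotation \<xi> ** stack \<omega> t))) \<partial>lborel \<partial>lborel)"
      unfolding U_stack[OF \<xi>] by (simp add: norm_mult ennreal_mult' nn_integral_multc)
    also have "\<dots> = (\<integral>\<^sup>+x. ennreal (norm (f0 (frame_rotation \<xi> ** x) * U \<xi> (frame_rotation \<xi> ** x))) \<partial>lborel)"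
      by (rule nn_integral_stack_swap[symmetric]) measurable
    also have "\<dots> = (\<integral>\<^sup>+x. ennreal (norm (f0 x * U \<xi> x)) \<partial>lborel)"
      by (rule nn_integral_orthogonal_left[OF u]) measurable
    finally show ?thesis .
  qed
  define I where "I = (\<integral>\<^sup>+x. ennreal (norm (f0 x)) * ennreal (norm (v (gram x))) \<partial>lborel)"
  have total: "(\<integral>\<^sup>+\<xi>. \<integral>\<^sup>+x. ennreal (norm (f0 x * U \<xi> x)) \<partial>lborel \<partial>\<mu>) = ennreal Cr * I"
  proof -
    have "(\<integral>\<^sup>+\<xi>. \<integral>\<^sup>+x. ennreal (norm (f0 x * U \<xi> x)) \<partial>lborel \<partial>\<mu>) = (\<integral>\<^sup>+x. \<integral>\<^sup>+\<xi>. ennreal (norm (f0 x * U \<xi> x)) \<partial>\<mu> \<partial>lborel)"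
      by (rule nn_integral_swap_mu) measurable
    also have "\<dots> = (\<integral>\<^sup>+x. ennreal Cr * (ennreal (norm (f0 x)) * ennreal (norm (v (gram x)))) \<partial>lborel)"
    proof (rule nn_integral_cong_AE)
      show "AE x in lborel. (\<integral>\<^sup>+\<xi>. ennreal (norm (f0 x * U \<xi> x)) \<partial>\<mu>) = ennreal Cr * (ennreal (norm (f0 x)) * ennreal (norm (v (gram x))))"
        using pdAE
      proof eventually_elim
        case (elim x)
        have "(\<integral>\<^sup>+\<xi>. ennreal (norm (f0 x * U \<xi> x)) \<partial>\<mu>) = ennreal (norm (f0 x)) * (\<integral>\<^sup>+\<xi>. ennreal (norm (U \<xi> x)) \<partial>\<mu>)"
          unfolding norm_mult by (subst nn_integral_cmult[symmetric]) (simp_all add: ennreal_mult')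
        also have "(\<integral>\<^sup>+\<xi>. ennreal (norm (U \<xi> x)) \<partial>\<mu>) = ennreal Cr * ennreal (norm (v (gram x)))"
          unfolding U_def by (rule K1[OF elim])
        finally show ?case by (simp only: mult_ac)
      qed
    qed
    also have "\<dots> = ennreal Cr * I" unfolding I_def by (rule nn_integral_cmult) measurable
    finally show ?thesis .
  qed
  have E1: "radon_side_exists \<mu> f (\<lambda>t. w (gram t)) \<longleftrightarrow> I < \<infinity>"
  proof -
    have "(\<integral>\<^sup>+\<xi>. \<integral>\<^sup>+t. radon_abs f \<xi> t * ennreal (norm (w (gram t))) \<partial>lebesgue \<partial>\<mu>) = ennreal Cr * I"
      unfolding total[symmetric] by (rule nn_integral_cong) (rule nnside)
    then show ?thesis using Cr by (auto simp: radon_side_exists_def ennreal_mult_less_top)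
  qed
  have E2: "function_side_exists f (\<lambda>x. v (gram x)) \<longleftrightarrow> I < \<infinity>"
  proof -
    have "(\<integral>\<^sup>+x. ennreal (norm (f x)) * ennreal (norm (v (gram x))) \<partial>lebesgue) = I"
      unfolding nn_integral_completion I_def by (rule nn_integral_cong_AE) (use ff0 in eventually_elim, simp)
    then show ?thesis by (simp add: function_side_exists_def)
  qed
  have "radon_side \<sigma> \<mu> f (\<lambda>t. w (gram t)) = C * function_side f (\<lambda>x. v (gram x))" if fin: "I < \<infinity>"
  proof -
    have "(LINT \<xi>|\<mu>. LINT t|lebesgue. radon f \<xi> t * w (gram t)) = (LINT \<xi>|\<mu>. LINT t|lborel. R \<xi> t * w (gram t))"
    proof (rule Bochner_Integration.integral_cong[OF refl])
      fix \<xi> assume \<xi>: "\<xi> \<in> space \<mu>"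
      have "AE t in lborel. radon f \<xi> t * w (gram t) = R \<xi> t * w (gram t)"
        using radonR[OF \<xi>] by eventually_elim simp
      then show "(LINT t|lebesgue. radon f \<xi> t * w (gram t)) = (LINT t|lborel. R \<xi> t * w (gram t))"
        by (rule integral_lebesgue_cong_AE[rotated]) measurable
    qed
    also have "\<dots> = (LINT \<xi>|\<mu>. LINT x|lborel. f0 x * U \<xi> x)"
    proof (rule integral_cong_AE)
      show "(\<lambda>\<xi>. LINT t|lborel. R \<xi> t * w (gram t)) \<in> borel_measurable \<mu>" by measurable
      show "(\<lambda>\<xi>. LINT x|lborel. f0 x * U \<xi> x) \<in> borel_measurable \<mu>" by measurable
      \<comment> \<open>For almost every \<open>\<xi>\<close> the absolute integral over
        \<open>x\<close> is finite, as splitting the integral along the fibres of that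
        \<open>\<xi>\<close> requires.\<close>
      have "(\<lambda>\<xi>. \<integral>\<^sup>+x. ennreal (norm (f0 x * U \<xi> x)) \<partial>lborel) \<in> borel_measurable \<mu>" by measurable
      moreover have "(\<integral>\<^sup>+\<xi>. \<integral>\<^sup>+x. ennreal (norm (f0 x * U \<xi> x)) \<partial>lborel \<partial>\<mu>) \<noteq> \<infinity>"
        unfolding total using fin by (simp add: ennreal_mult_eq_top_iff)
      ultimately have "AE \<xi> in \<mu>. (\<integral>\<^sup>+x. ennreal (norm (f0 x * U \<xi> x)) \<partial>lborel) \<noteq> \<infinity>"
        by (rule nn_integral_PInf_AE)
      with AE_space show "AE \<xi> in \<mu>. (LINT t|lborel. R \<xi> t * w (gram t)) = (LINT x|lborel. f0 x * U \<xi> x)"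
      proof eventually_elim
        case (elim \<xi>)
        note u = frame_rotation(1)[OF gram\<xi>[OF elim(1)]]
        have R: "R \<xi> t = (LINT \<omega>|lborel. f0 (frame_rotation \<xi> ** stack \<omega> t))" for t
          unfolding R_def radon_fibre_formula[OF gram\<xi>[OF elim(1)] f0] ..
        have "(LINT t|lborel. R \<xi> t * w (gram t))
          = (LINT t|lborel. LINT \<omega>|lborel. f0 (frame_rotation \<xi> ** stack \<omega> t) * U \<xi> (frame_rotation \<xi> ** stack \<omega> t))"
          unfolding U_stack[OF elim(1)] R integral_mult_left_zero ..
        also have "\<dots> = (LINT x|lborel. f0 (frame_rotation \<xi> ** x) * U \<xi> (frame_rotation \<xi> ** x))"
        proof (rule integral_stack[symmetric])
          have "(\<integral>\<^sup>+x. ennreal (norm (f0 (frame_rotation \<xi> ** x) * U \<xi> (frame_rotation \<xi> ** x))) \<partial>lborel)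
            = (\<integral>\<^sup>+x. ennreal (norm (f0 x * U \<xi> x)) \<partial>lborel)"
            by (rule nn_integral_orthogonal_left[OF u]) measurable
          then show "(\<integral>\<^sup>+x. ennreal (norm (f0 (frame_rotation \<xi> ** x) * U \<xi> (frame_rotation \<xi> ** x))) \<partial>lborel) < \<infinity>"
            using elim(2) by (simp add: less_top)
        qed measurable
        also have "\<dots> = (LINT x|lborel. f0 x * U \<xi> x)"
          by (rule integral_orthogonal_left[OF u]) measurable
        finally show ?case .
      qed
    qed
    also have "\<dots> = (LINT x|lborel. LINT \<xi>|\<mu>. f0 x * U \<xi> x)"
    proof -
      have "integrable (\<mu> \<Otimes>\<^sub>M lborel) (case_prod (\<lambda>\<xi> x. f0 x * U \<xi> x))"
      proof (rule integrableI_bounded)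
        show "case_prod (\<lambda>\<xi> x. f0 x * U \<xi> x) \<in> borel_measurable (\<mu> \<Otimes>\<^sub>M lborel)"
          unfolding case_prod_unfold by measurable
        have "(\<integral>\<^sup>+p. ennreal (norm (case_prod (\<lambda>\<xi> x. f0 x * U \<xi> x) p)) \<partial>(\<mu> \<Otimes>\<^sub>M lborel)) = ennreal Cr * I"
          unfolding total[symmetric] by (subst lborel.nn_integral_fst[symmetric]) (simp_all add: case_prod_unfold)
        then show "(\<integral>\<^sup>+p. ennreal (norm (case_prod (\<lambda>\<xi> x. f0 x * U \<xi> x) p)) \<partial>(\<mu> \<Otimes>\<^sub>M lborel)) < \<infinity>"
          using fin by (simp add: ennreal_mult_less_top)
      qed
      then show ?thesis by (rule M.Fubini_integral[symmetric])
    qed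
    also have "\<dots> = (LINT x|lborel. of_real \<sigma> * C * (f0 x * v (gram x)))"
    proof (rule integral_cong_AE)
      show "(\<lambda>x. LINT \<xi>|\<mu>. f0 x * U \<xi> x) \<in> borel_measurable lborel" by measurable
      show "(\<lambda>x. of_real \<sigma> * C * (f0 x * v (gram x))) \<in> borel_measurable lborel" by measurable
      show "AE x in lborel. (LINT \<xi>|\<mu>. f0 x * U \<xi> x) = of_real \<sigma> * C * (f0 x * v (gram x))"
        using pdAE
      proof eventually_elim
        case (elim x)
        show ?case
          using K2[OF elim] by (simp add: U_def)
      qed
    qed
    also have "\<dots> = of_real \<sigma> * C * (LINT x|lborel. f0 x * v (gram x))" by (rule integral_mult_right_zero)
    also have "(LINT x|lborel. f0 x * v (gram x)) = function_side f (\<lambda>x. v (gram x))"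
    proof -
      have "AE x in lborel. f x * v (gram x) = f0 x * v (gram x)"
        using ff0 by eventually_elim simp
      then show ?thesis
        unfolding function_side_def by (intro integral_lebesgue_cong_AE[symmetric]) measurable
    qed
    finally show ?thesis using sigma_pos by (simp add: radon_side_def)
  qed
  with E1 E2 show ?thesis unfolding radon_identity_def by blast
qed

end


section \<open>The constant in terms of multivariate Gamma functions\<close>

lemma prod_lessThan_split: "(\<Prod>i<a. h i) * (\<Prod>j<b. h (a + j)) = (\<Prod>i<a + b. h i)"
  for h :: "nat \<Rightarrow> complex"
  by (induction b) (simp_all add: mult.assoc[symmetric])

text \<open>Both quotients arise by splitting the product of \<open>h\<close> over the first k + m
  indices, after k factors or after m factors. The bound on \<open>Re z\<close> keeps all arguments
  in the right half-plane, where \<open>Gamma\<close> does not vanish; at its poles it has the value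
  0.\<close>

lemma multi_Gamma_ratio:
  fixes z :: complex
  assumes z: "real k + real m - 1 < Re z"
  shows "multi_Gamma m ((z - of_nat k) / 2) / multi_Gamma m (z / 2)
      = (\<Prod>i<k. Gamma ((z - of_nat i - of_nat m) / 2) / Gamma ((z - of_nat i) / 2))"
    and "multi_Gamma m ((z - of_nat k) / 2) \<noteq> 0" "multi_Gamma m (z / 2) \<noteq> 0"
proof -
  define h where "h j = Gamma ((z - of_nat j) / 2)" for j
  define c where "c = complex_of_real (pi powr (real m * (real m - 1) / 4))"
  have c: "c \<noteq> 0" by (simp add: c_def)
  have nz: "h j \<noteq> 0" if "j < k + m" for j
  proof -
    have "real j \<le> real (k + m) - 1" using that by linarith
    then have "0 < Re ((z - of_nat j) / 2)" using z by simp
    moreover have "w \<notin> \<int>\<^sub>\<le>\<^sub>0" if "0 < Re w" for w :: complex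
      using that by (auto elim!: nonpos_Ints_cases)
    ultimately show ?thesis unfolding h_def by (simp add: Gamma_eq_zero_iff del: Re_divide_numeral)
  qed
  have nzs: "(\<Prod>j<m. h (k + j)) \<noteq> 0" "(\<Prod>j<m. h j) \<noteq> 0" "(\<Prod>i<k. h i) \<noteq> 0" "(\<Prod>i<k. h (m + i)) \<noteq> 0"
    using nz by (auto simp: prod_zero_iff)
  have m1: "multi_Gamma m ((z - of_nat k) / 2) = c * (\<Prod>j<m. h (k + j))"
    unfolding multi_Gamma_def c_def h_def
    by (intro arg_cong2[where f="(*)"] refl prod.cong arg_cong[where f=Gamma]) (simp add: field_simps)
  have m2: "multi_Gamma m (z / 2) = c * (\<Prod>j<m. h j)"
    unfolding multi_Gamma_def c_def h_def
    by (intro arg_cong2[where f="(*)"] refl prod.cong arg_cong[where f=Gamma]) (simp add: field_simps)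
  show "multi_Gamma m ((z - of_nat k) / 2) \<noteq> 0" "multi_Gamma m (z / 2) \<noteq> 0"
    unfolding m1 m2 using c nzs by simp_all
  have "(\<Prod>i<k. h i) * (\<Prod>j<m. h (k + j)) = (\<Prod>j<m. h j) * (\<Prod>i<k. h (m + i))"
    unfolding prod_lessThan_split by (simp add: add.commute)
  then have "(\<Prod>j<m. h (k + j)) / (\<Prod>j<m. h j) = (\<Prod>i<k. h (m + i)) / (\<Prod>i<k. h i)"
    using nzs by (simp add: field_simps)
  moreover have "multi_Gamma m ((z - of_nat k) / 2) / multi_Gamma m (z / 2) = (\<Prod>j<m. h (k + j)) / (\<Prod>j<m. h j)"
    unfolding m1 m2 using c by simp
  moreover have "(\<Prod>i<k. h (m + i)) / (\<Prod>i<k. h i) = (\<Prod>i<k. Gamma ((z - of_nat i - of_nat m) / 2) / Gamma ((z - of_nat i) / 2))"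
    unfolding prod_dividef[symmetric] h_def by (simp add: diff_diff_eq add.commute)
  ultimately show "multi_Gamma m ((z - of_nat k) / 2) / multi_Gamma m (z / 2)
      = (\<Prod>i<k. Gamma ((z - of_nat i - of_nat m) / 2) / Gamma ((z - of_nat i) / 2))" by simp
qed

text \<open>Each row contributes one Gaussian factor. Their power depends on \<open>k\<close> but
  not on \<open>z\<close>, so it cancels in quotients and the Gaussian mass need not be
  evaluated.\<close>

lemma chart_const_eq:
  fixes z :: complex
  assumes "real k + real CARD('m::finite) - 1 < Re z"
  shows "chart_const TYPE('m) k z = of_real (gauss_mass TYPE(real ^ 'm ^ 1)) ^ k *
    (multi_Gamma CARD('m) ((z - of_nat k) / 2) / multi_Gamma CARD('m) (z / 2))"
  unfolding multi_Gamma_ratio(1)[OF assms] chart_const_def row_const_def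
  by (simp only: times_divide_eq_right[symmetric] prod.distrib prod_constant card_lessThan)

lemma chart_const_of_real: "chart_const TYPE('m::finite) k (of_real a) = of_real (chart_const_real TYPE('m) k a)"
proof -
  have "row_const TYPE('m) (of_real a - of_nat i) = of_real (row_const_real TYPE('m) (a - real i))" for i
  proof -
    have "Gamma ((complex_of_real a - of_nat i - of_nat CARD('m)) / 2) = of_real (Gamma ((a - real i - real CARD('m)) / 2))"
      "Gamma ((complex_of_real a - of_nat i) / 2) = of_real (Gamma ((a - real i) / 2))"
      by (simp_all flip: Gamma_complex_of_real)
    then show ?thesis
      unfolding row_const_def row_const_real_def by simp
  qed
  then show ?thesis by (simp add: chart_const_def chart_const_real_def)
qed

theorem theorem4p23:
  fixes f :: "real ^ 'm ^ ('k::finite + 'l::finite) \<Rightarrow> complex"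
    and a :: "real ^ 'm ^ 'm"
    and \<mu> :: "(real ^ 'l ^ ('k::finite + 'l::finite)) measure"
    and \<sigma> d \<delta> :: real and lam lam2 :: complex and n m k :: nat
  assumes n: "n = CARD('k + 'l)" and m: "m = CARD('m)" and k: "k = CARD('k)"
    and "1 \<le> m" and "1 \<le> k" and "k + m \<le> n"
    and "Re lam > real k + real m - 1"
    and "posdef a"
    and "d = (real m + 1) / 2"
    and "\<delta> = (real n - real k) / 2 - d"
    and "lam2 = multi_Gamma m (of_nat n / 2) * multi_Gamma m ((lam - of_nat k) / 2) /
                (multi_Gamma m (lam / 2) * multi_Gamma m ((of_nat n - of_nat k) / 2))"
    and "stiefel_measure \<sigma> \<mu>"
    and "f \<in> borel_measurable lebesgue"
  shows "radon_identity \<sigma> \<mu> f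
           (\<lambda>t. det_powr (transpose t ** t) ((lam - of_nat n) / 2))
           lam2
           (\<lambda>x. det_powr (transpose x ** x) ((lam - of_nat n) / 2))
    \<and> radon_identity \<sigma> \<mu> f
           (\<lambda>t. det_powr (transpose t ** t) ((lam - of_nat n) / 2)
                 * det_powr (mat 1 + transpose t ** t) (- lam / 2))
           lam2
           (\<lambda>x. det_powr (transpose x ** x) ((lam - of_nat n) / 2)
                 * det_powr (mat 1 + transpose x ** x) ((of_nat k - lam) / 2))
    \<and> radon_identity \<sigma> \<mu> f
           (\<lambda>t. det_powr (transpose t ** t) (- of_real \<delta>)
                 * det_powr_plus (transpose t ** t - a) ((lam - of_nat k) / 2 - of_real d))
           lam2
           (\<lambda>x. det_powr (transpose x ** x) (of_real d - of_nat n / 2)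
                 * det_powr_plus (transpose x ** x - a) (lam / 2 - of_real d))"
proof -
  interpret stiefel_law \<sigma> \<mu> by unfold_locales (rule assms)
  define N where "N = real CARD('k) + real CARD('l)"
  define \<kappa> where "\<kappa> = chart_const_real TYPE('m) CARD('k) N"
  have nkl: "n = CARD('k) + CARD('l)" by (simp add: n)
  then have Nn: "N = real n" by (simp add: N_def)
  have ml: "CARD('m) \<le> CARD('l)" using \<open>k + m \<le> n\<close> nkl k m by simp
  have z: "real CARD('k) + real CARD('m) - 1 < Re lam" using \<open>Re lam > _\<close> k m by simp
  have zN: "real CARD('k) + real CARD('m) - 1 < Re (complex_of_real N)" using ml by (simp add: N_def)
  have \<kappa>: "0 < \<kappa>" using chart_const_real_pos[of "CARD('k)" N, where 'm='m] zN by (simp add: \<kappa>_def)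
  \<comment> \<open>The normalisation \<open>\<kappa>\<close> is the chart constant at
    \<open>n\<close>. The Gaussian powers cancel, and the two ratios of \<open>multi_Gamma\<close>
    combine to the constant of the theorem.\<close>
  have lam2: "chart_const TYPE('m) CARD('k) lam / of_real \<kappa> = lam2"
  proof -
    have g: "complex_of_real (gauss_mass TYPE(real ^ 'm ^ 1)) \<noteq> 0"
      using gauss_mass_pos[where 'a="real ^ 'm ^ 1"] by simp
    note nz = multi_Gamma_ratio(2,3)[OF z] multi_Gamma_ratio(2,3)[OF zN]
    have "complex_of_real \<kappa> = chart_const TYPE('m) CARD('k) (of_real N)" by (simp add: \<kappa>_def chart_const_of_real)
    then show ?thesis
      using g nz unfolding chart_const_eq[OF z] assms(11) m k
      by (simp only: chart_const_eq[OF zN]) (simp add: Nn field_simps)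
  qed
  have main: "radon_identity \<sigma> \<mu> f (\<lambda>t. w (gram t)) lam2 (\<lambda>x. v (gram x))"
    if pair: "chart_pair TYPE('k) N w v (chart_const_real TYPE('m) CARD('k) (Re lam)) (chart_const TYPE('m) CARD('k) lam)"
      and w: "w \<in> borel_measurable borel" and v: "v \<in> borel_measurable borel" for w v :: "real ^ 'm ^ 'm \<Rightarrow> complex"
  proof (rule radon_identity_of_kernel[OF ml assms(13) w v])
    show "0 < \<sigma> / \<kappa> * chart_const_real TYPE('m) CARD('k) (Re lam)"
      using sigma_pos \<kappa> chart_const_real_pos[OF z] by simp
    fix x :: "real ^ 'm ^ ('k + 'l)" assume x: "posdef (gram x)"
    note kernel = kernel_of_chart_pair[OF ml pair[unfolded N_def] w x, folded N_def, folded \<kappa>_def]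
    show "(\<integral>\<^sup>+\<xi>. ennreal (norm (w (gram (transpose \<xi> ** x)))) \<partial>\<mu>)
      = ennreal (\<sigma> / \<kappa> * chart_const_real TYPE('m) CARD('k) (Re lam)) * ennreal (norm (v (gram x)))"
      by (rule kernel(1))
    show "(LINT \<xi>|\<mu>. w (gram (transpose \<xi> ** x))) = of_real \<sigma> * lam2 * v (gram x)"
      using kernel(2) by (simp only: lam2)
  qed
  have of_N: "complex_of_real N = of_nat n" by (simp add: Nn)
  have d: "d = (real CARD('m) + 1) / 2" using assms(9) m by simp
  have \<delta>: "\<delta> = (N - real CARD('k)) / 2 - d" using assms(10) k by (simp add: Nn)
  note p1 = chart_pair_power[OF z, of N] and p2 = chart_pair_beta[OF z, of N]
    and p3 = chart_pair_truncated[OF z \<open>posdef a\<close> d \<delta>]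
  show ?thesis
    using main[OF p1] main[OF p2] main[OF p3] unfolding of_N k[symmetric] by simp
qed

end
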